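(* The projection $(F^{\lrcorner},R^{\lrcorner}_\bullet)$ of an IMCGD $(F,R_\bullet)$ is a CGD over $\mathcal{X}_{\Sigma,\Delta,\pi}$.
   Context: Fix finite sets $\pi$ (ports), $\Sigma,\Delta$ (labels), with $m\notin\Sigma$, $m,l,r\notin\pi$. A graph has an at most countable vertex set, edges $\{u:a,v:b\}$ (unordered, $a,b$ ports) with each vertex–port pair in at most one edge, partial vertex and edge labels, and is connected. $\mathcal{X}_{\Sigma,\Delta,\pi}$ is the set of pointed graphs modulo (isomorphism classes of pointed graphs under renamings preserving edges, ports, labels, pointer). In a pointed graph modulo $X$, vertices are designated by paths (words of port pairs $ab$, "leave by $a$, arrive by $b$", from the pointer), identified when reaching the same vertex; $V(X)$ is the vertex set, $\varepsilon$ the pointer, "." concatenation, $X_u$ re-pointing at $u$, $X^r$ the disk of radius $r$ (subgraph induced by vertices at distance $\le r+1$ from the pointer, labels kept only on vertices at distance $\le r$ and edges between them). A dynamics $(F,R_\bullet)$ over a set $\mathcal{S}$ of pointed graphs modulo is $F:\mathcal{S}\to\mathcal{S}$ with maps $R_X:V(X)\to V(F(X))$; continuous: for all $X,m$ there is $n$ with $F(X)^m=F(X^n)^m$, $\mathrm{dom}\,R_X^m\subseteq V(X^n)$, $R_X^m=R_{X^n}^m$ ($R_X^m$ = restriction of $R_X$ to vertices mapped into $F(X)^m$); shift-invariant: $F(X_u)=F(X)_{R_X(u)}$, $R_X(u.v)=R_X(u).R_{X_u}(v)$; bounded: there is $b$ such that every $w'\in V(F(X))$ is $u'.v'$ with $u'\in\mathrm{Im}R_X$,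 $v'\in V(F(X)^b_{u'})$. A CGD is continuous, shift-invariant and bounded. Invisible matter: $T$ is the infinite rooted binary tree, all vertices labelled $m$, each vertex linked via port $l$ (resp. $r$) to port $m$ of its left (resp. right) child. Each $X\in\mathcal{X}_{\Sigma,\Delta,\pi}$ is identified with the graph of $\mathcal{X}_{\Sigma\cup\{m\},\Delta,\pi\cup\{m,l,r\}}$ obtained by attaching to each vertex $v$ a copy of $T$ whose root's port $m$ is linked to port $m$ of $v$; $\mathcal{Y}$ is the set of all such graphs pointed at any vertex (tree vertices invisible, others visible). $X_{\bullet s}=X_{mm.s}$, $s\in\{lm,rm\}^*$. A dynamics over $\mathcal{Y}$ is invisible matter quiescent if there is $b$ with $R_{X_{\bullet s}}(t)=t$ for all $X\in\mathcal{X}_{\Sigma,\Delta,\pi}$, $s,t\in\{lm,rm\}^*$, $|s|\ge b$; vertex-preserving if each $R_Y$ is bijective. An IMCGD is a vertex-preserving invisible matter quiescent CGD over $\mathcal{Y}$. Projection: for a dynamics $(F,R_\bullet)$ over $\mathcal{Y}$, its projection $(F^{\lrcorner},R^{\lrcorner}_\bullet)$ over $\mathcal{X}_{\Sigma,\Delta,\pi}$ is defined, for $X\in\mathcal{X}_{\Sigma,\Delta,\pi}$ (pointed at a visible vertex), by: $F^{\lrcorner}(X)=X'$ where $X'\in\mathcal{X}_{\Sigma,\Delta,\pi}$ and $F(X)=X'$ or $F(X)=X'_{\bullet t}$ for some $t\in\{lm,rm\}^*$; and $R^{\lrcorner}_X(u)=v$ where $v\in\Pi^*$ ($\Pi=\pi^2$)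 is the visible vertex of $F^{\lrcorner}(X)$ that either equals $R_X(u)$ or carries the invisible tree containing $R_X(u)$ (i.e. $R_X(u)$ is one of $\overline{s}\bullet v\bullet t$, $\overline{s}\bullet v$, $v\bullet t$, $v$ with $s,t\in\{lm,rm\}^*$, where $\bullet$ stands for $mm$ and $\overline{s}$ is $s$ read backwards; and $v=\varepsilon$ when $R_X(u)$ is $\overline{s}t$, $\overline{s}$ or $t$).
   Formalization: Over 𝒴 the disk X^n is not in 𝒴, so F(X^n) is undefined; continuity is read as: for all X, m there is n with dom R_X^m ⊆ V(X^n) such that every X' in the set with X'^n = X^n has F(X')^m = F(X)^m and R_{X'}^m = R_X^m. Over 𝒳 this implies the stated condition. *)

theory Defs
  imports "HOL-Library.Countable_Set"
begin

section \<open>Pointed graphs\<close>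

record ('v, 'p, 's, 'd) pgraph =
  verts :: "'v set"
  edges :: "('v \<times> 'p) set set"
  vlab :: "'v \<rightharpoonup> 's"
  elab :: "('v \<times> 'p) set \<rightharpoonup> 'd"
  ptr :: 'v

type_synonym 'p path = "('p \<times> 'p) list"

text \<open>The letter \<open>(a, b)\<close> of a path means: leave by port \<open>a\<close>, arrive by port \<open>b\<close>.\<close>

inductive walk :: "('v, 'p, 's, 'd) pgraph \<Rightarrow> 'v \<Rightarrow> 'p path \<Rightarrow> 'v \<Rightarrow> bool" for G where
  walk_Nil: "walk G u [] u"
| walk_Cons: "{(u, a), (v, b)} \<in> edges G \<Longrightarrow> walk G v w x \<Longrightarrow> walk G u ((a, b) # w) x"

text \<open>An edge \<open>{u:a, v:b}\<close> is a two-element set of vertex-port pairs; \<open>u = v\<close> is allowed,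
  but then \<open>a \<noteq> b\<close>.\<close>

definition pointed_graph ::
  "'s set \<Rightarrow> 'd set \<Rightarrow> 'p set \<Rightarrow> ('v, 'p, 's, 'd) pgraph \<Rightarrow> bool" where
  "pointed_graph \<Sigma> \<Delta> \<pi> G \<longleftrightarrow>
     countable (verts G) \<and> ptr G \<in> verts G \<and>
     (\<forall>e\<in>edges G. card e = 2 \<and> e \<subseteq> verts G \<times> \<pi>) \<and>
     (\<forall>e\<in>edges G. \<forall>e'\<in>edges G. e \<inter> e' \<noteq> {} \<longrightarrow> e = e') \<and>
     dom (vlab G) \<subseteq> verts G \<and> ran (vlab G) \<subseteq> \<Sigma> \<and>
     dom (elab G) \<subseteq> edges G \<and> ran (elab G) \<subseteq> \<Delta> \<and>
     (\<forall>u\<in>verts G. \<forall>v\<in>verts G. \<exists>w. walk G u w v)"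

abbreviation rename_edge :: "('v \<Rightarrow> 'w) \<Rightarrow> ('v \<times> 'p) set \<Rightarrow> ('w \<times> 'p) set" where
  "rename_edge f e \<equiv> map_prod f id ` e"

definition isomorphic ::
  "('v, 'p, 's, 'd) pgraph \<Rightarrow> ('w, 'p, 's, 'd) pgraph \<Rightarrow> bool" where
  "isomorphic G H \<longleftrightarrow> (\<exists>f. bij_betw f (verts G) (verts H) \<and>
     f (ptr G) = ptr H \<and>
     edges H = rename_edge f ` edges G \<and>
     (\<forall>v\<in>verts G. vlab H (f v) = vlab G v) \<and>
     (\<forall>e\<in>edges G. elab H (rename_edge f e) = elab G e))"

definition ball :: "('v, 'p, 's, 'd) pgraph \<Rightarrow> nat \<Rightarrow> 'v set" where
  "ball G r = {v. \<exists>w. length w \<le> r \<and> walk G (ptr G) w v}"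

definition gdisk :: "nat \<Rightarrow> ('v, 'p, 's, 'd) pgraph \<Rightarrow> ('v, 'p, 's, 'd) pgraph" where
  "gdisk r G =
     \<lparr>verts = ball G (r + 1),
      edges = {e \<in> edges G. e \<subseteq> ball G (r + 1) \<times> UNIV},
      vlab = vlab G |` ball G r,
      elab = elab G |` {e. e \<subseteq> ball G r \<times> UNIV},
      ptr = ptr G\<rparr>"


section \<open>Pointed graphs modulo\<close>

text \<open>Vertex sets are at most countable, so every isomorphism class has representatives with
  vertices in \<open>nat\<close>. A graph modulo is the set of all of these. Operations on graphs are
  transported to classes by a union over the representatives, all of which give the same result.\<close>

type_synonym ('p, 's, 'd) pgm = "(nat, 'p, 's, 'd) pgraph set"

definition modulo :: "('v, 'p, 's, 'd) pgraph \<Rightarrow> ('p, 's, 'd) pgm" where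
  "modulo G = {H. pointed_graph UNIV UNIV UNIV H \<and> isomorphic G H}"

definition pgms :: "'s set \<Rightarrow> 'd set \<Rightarrow> 'p set \<Rightarrow> ('p, 's, 'd) pgm set" where
  "pgms \<Sigma> \<Delta> \<pi> = {modulo G |G :: (nat, 'p, 's, 'd) pgraph. pointed_graph \<Sigma> \<Delta> \<pi> G}"

definition paths :: "('p, 's, 'd) pgm \<Rightarrow> 'p path set" where
  "paths X = {w. \<exists>G\<in>X. \<exists>v. walk G (ptr G) w v}"

text \<open>A vertex is the set of all paths from the pointer that reach it;
  \<open>vertex X w\<close> is the one reached by \<open>w\<close>, and is empty if \<open>w\<close> is not a path of \<open>X\<close>.\<close>

definition vertex :: "('p, 's, 'd) pgm \<Rightarrow> 'p path \<Rightarrow> 'p path set" where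
  "vertex X w = {w'. \<exists>G\<in>X. \<exists>v. walk G (ptr G) w v \<and> walk G (ptr G) w' v}"

definition V :: "('p, 's, 'd) pgm \<Rightarrow> 'p path set set" where
  "V X = vertex X ` paths X"

definition cat :: "('p, 's, 'd) pgm \<Rightarrow> 'p path set \<Rightarrow> 'p path set \<Rightarrow> 'p path set" where
  "cat X u v = (\<Union>w\<in>u. \<Union>w'\<in>v. vertex X (w @ w'))"

definition repoint :: "('p, 's, 'd) pgm \<Rightarrow> 'p path set \<Rightarrow> ('p, 's, 'd) pgm" where
  "repoint X u = \<Union> {modulo (G\<lparr>ptr := v\<rparr>) |G v. G \<in> X \<and> (\<exists>w\<in>u. walk G (ptr G) w v)}"

definition disk :: "nat \<Rightarrow> ('p, 's, 'd) pgm \<Rightarrow> ('p, 's, 'd) pgm" where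
  "disk r X = (\<Union>G\<in>X. modulo (gdisk r G))"


section \<open>Causal graph dynamics\<close>

type_synonym ('p, 's, 'd) gmap = "('p, 's, 'd) pgm \<Rightarrow> ('p, 's, 'd) pgm"
type_synonym ('p, 's, 'd) vmap = "('p, 's, 'd) pgm \<Rightarrow> 'p path set \<Rightarrow> 'p path set"

definition dynamics ::
  "('p, 's, 'd) pgm set \<Rightarrow> ('p, 's, 'd) gmap \<Rightarrow> ('p, 's, 'd) vmap \<Rightarrow> bool" where
  "dynamics S F R \<longleftrightarrow> (\<forall>X\<in>S. F X \<in> S \<and> (\<forall>u\<in>V X. R X u \<in> V (F X)))"

text \<open>A vertex \<open>u\<close> of \<open>X\<close>, seen in \<open>disk r X\<close>, is designated by those of its paths that stay
  in the disk; it lies in the disk iff there is at least one.\<close>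

definition trace :: "nat \<Rightarrow> ('p, 's, 'd) pgm \<Rightarrow> 'p path set \<Rightarrow> 'p path set" where
  "trace r X u = u \<inter> paths (disk r X)"

definition restr_dom ::
  "nat \<Rightarrow> ('p, 's, 'd) gmap \<Rightarrow> ('p, 's, 'd) vmap \<Rightarrow> ('p, 's, 'd) pgm \<Rightarrow> 'p path set set" where
  "restr_dom m F R X = {u \<in> V X. trace m (F X) (R X u) \<noteq> {}}"

text \<open>The graph of the partial map \<open>R\<^sub>X\<^sup>m\<close>, with arguments read in \<open>disk n X\<close> and values
  read in \<open>disk m (F X)\<close>, so that it can be compared between different graphs.\<close>

definition restr_graph ::
  "nat \<Rightarrow> nat \<Rightarrow> ('p, 's, 'd) gmap \<Rightarrow> ('p, 's, 'd) vmap \<Rightarrow> ('p, 's, 'd) pgm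
     \<Rightarrow> ('p path set \<times> 'p path set) set" where
  "restr_graph n m F R X = (\<lambda>u. (trace n X u, trace m (F X) (R X u))) ` restr_dom m F R X"

text \<open>\<open>S\<close> need not be closed under \<open>disk\<close> (invisible matter graphs are not), so
  \<open>F(X)\<^sup>m = F(X\<^sup>n)\<^sup>m\<close> is read as: all \<open>X' \<in> S\<close> with the same disk of radius \<open>n\<close> as \<open>X\<close> have
  the same \<open>F(X')\<^sup>m\<close>. If \<open>disk n X \<in> S\<close>, then \<open>X' = disk n X\<close> is an instance:
  see lemma \<open>continuous_on_disks\<close> below.\<close>

definition continuous ::
  "('p, 's, 'd) pgm set \<Rightarrow> ('p, 's, 'd) gmap \<Rightarrow> ('p, 's, 'd) vmap \<Rightarrow> bool" where
  "continuous S F R \<longleftrightarrow> (\<forall>X\<in>S. \<forall>m. \<exists>n.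
     (\<forall>u\<in>restr_dom m F R X. trace n X u \<noteq> {}) \<and>
     (\<forall>X'\<in>S. disk n X' = disk n X \<longrightarrow>
        disk m (F X) = disk m (F X') \<and> restr_graph n m F R X = restr_graph n m F R X'))"

definition shift_invariant ::
  "('p, 's, 'd) pgm set \<Rightarrow> ('p, 's, 'd) gmap \<Rightarrow> ('p, 's, 'd) vmap \<Rightarrow> bool" where
  "shift_invariant S F R \<longleftrightarrow> (\<forall>X\<in>S. \<forall>u\<in>V X.
     F (repoint X u) = repoint (F X) (R X u) \<and>
     (\<forall>v\<in>V (repoint X u). R X (cat X u v) = cat (F X) (R X u) (R (repoint X u) v)))"

definition bounded ::
  "('p, 's, 'd) pgm set \<Rightarrow> ('p, 's, 'd) gmap \<Rightarrow> ('p, 's, 'd) vmap \<Rightarrow> bool" where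
  "bounded S F R \<longleftrightarrow> (\<exists>b. \<forall>X\<in>S. \<forall>w'\<in>V (F X).
     \<exists>u'\<in>R X ` V X. \<exists>v'\<in>V (disk b (repoint (F X) u')). w' = cat (F X) u' v')"

definition cgd ::
  "('p, 's, 'd) pgm set \<Rightarrow> ('p, 's, 'd) gmap \<Rightarrow> ('p, 's, 'd) vmap \<Rightarrow> bool" where
  "cgd S F R \<longleftrightarrow> dynamics S F R \<and> continuous S F R \<and> shift_invariant S F R \<and> bounded S F R"


section \<open>Invisible matter\<close>

text \<open>\<open>\<Sigma> \<union> {m}\<close> and \<open>\<pi> \<union> {m, l, r}\<close>, as disjoint unions.\<close>

datatype 's ilabel = Lab 's | MLab
datatype 'p iport = Port 'p | Mp | Lp | Rp

definition ilabels :: "'s set \<Rightarrow> 's ilabel set" where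
  "ilabels \<Sigma> = Lab ` \<Sigma> \<union> {MLab}"

definition iports :: "'p set \<Rightarrow> 'p iport set" where
  "iports \<pi> = Port ` \<pi> \<union> {Mp, Lp, Rp}"

text \<open>\<open>Invisible v ds\<close> is the node of the tree attached to \<open>v\<close> that is reached from the root by
  the turns \<open>ds\<close>, where \<open>False\<close> is left and \<open>True\<close> is right.\<close>

datatype 'v ivertex = Visible 'v | Invisible 'v "bool list"

abbreviation visible_edge :: "('v \<times> 'p) set \<Rightarrow> ('v ivertex \<times> 'p iport) set" where
  "visible_edge e \<equiv> map_prod Visible Port ` e"

definition gattach ::
  "('v, 'p, 's, 'd) pgraph \<Rightarrow> ('v ivertex, 'p iport, 's ilabel, 'd) pgraph" where
  "gattach G =
     \<lparr>verts = Visible ` verts G \<union> {Invisible v ds |v ds. v \<in> verts G},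
      edges = visible_edge ` edges G
        \<union> {{(Visible v, Mp), (Invisible v [], Mp)} |v. v \<in> verts G}
        \<union> {{(Invisible v ds, if d then Rp else Lp), (Invisible v (ds @ [d]), Mp)} |v ds d.
             v \<in> verts G},
      vlab = (\<lambda>x. case x of
          Visible v \<Rightarrow> map_option Lab (vlab G v)
        | Invisible v ds \<Rightarrow> if v \<in> verts G then Some MLab else None),
      elab = (\<lambda>e. if e \<in> visible_edge ` edges G
        then elab G (the_inv_into UNIV visible_edge e) else None),
      ptr = Visible (ptr G)\<rparr>"

definition attach :: "('p, 's, 'd) pgm \<Rightarrow> ('p iport, 's ilabel, 'd) pgm" where
  "attach X = (\<Union>G\<in>X. modulo (gattach G))"

definition imgraphs ::
  "'s set \<Rightarrow> 'd set \<Rightarrow> 'p set \<Rightarrow> ('p iport, 's ilabel, 'd) pgm set" where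
  "imgraphs \<Sigma> \<Delta> \<pi> = {repoint (attach X) u |X u. X \<in> pgms \<Sigma> \<Delta> \<pi> \<and> u \<in> V (attach X)}"

text \<open>\<open>{lm, rm}\<^sup>*\<close>\<close>
definition tree_paths :: "'p iport path set" where
  "tree_paths = lists {(Lp, Mp), (Rp, Mp)}"

text \<open>The letter \<open>\<bullet> = mm\<close>, and \<open>s\<close> read backwards.\<close>

abbreviation dot :: "'p iport path" where
  "dot \<equiv> [(Mp, Mp)]"

definition backwards :: "'p path \<Rightarrow> 'p path" where
  "backwards s = rev (map prod.swap s)"

text \<open>\<open>X\<^bsub>\<bullet>s\<^esub>\<close>, for \<open>X\<close> without invisible matter\<close>
definition dive ::
  "('p, 's, 'd) pgm \<Rightarrow> 'p iport path \<Rightarrow> ('p iport, 's ilabel, 'd) pgm" where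
  "dive X s = repoint (attach X) (vertex (attach X) (dot @ s))"

definition im_quiescent ::
  "'s set \<Rightarrow> 'd set \<Rightarrow> 'p set \<Rightarrow> ('p iport, 's ilabel, 'd) gmap
     \<Rightarrow> ('p iport, 's ilabel, 'd) vmap \<Rightarrow> bool" where
  "im_quiescent \<Sigma> \<Delta> \<pi> F R \<longleftrightarrow> (\<exists>b. \<forall>X\<in>pgms \<Sigma> \<Delta> \<pi>. \<forall>s\<in>tree_paths. \<forall>t\<in>tree_paths.
     b \<le> length s \<longrightarrow> R (dive X s) (vertex (dive X s) t) = vertex (F (dive X s)) t)"

definition vertex_preserving ::
  "('p, 's, 'd) pgm set \<Rightarrow> ('p, 's, 'd) gmap \<Rightarrow> ('p, 's, 'd) vmap \<Rightarrow> bool" where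
  "vertex_preserving S F R \<longleftrightarrow> (\<forall>X\<in>S. bij_betw (R X) (V X) (V (F X)))"

definition imcgd ::
  "'s set \<Rightarrow> 'd set \<Rightarrow> 'p set \<Rightarrow> ('p iport, 's ilabel, 'd) gmap
     \<Rightarrow> ('p iport, 's ilabel, 'd) vmap \<Rightarrow> bool" where
  "imcgd \<Sigma> \<Delta> \<pi> F R \<longleftrightarrow> cgd (imgraphs \<Sigma> \<Delta> \<pi>) F R \<and>
     vertex_preserving (imgraphs \<Sigma> \<Delta> \<pi>) F R \<and> im_quiescent \<Sigma> \<Delta> \<pi> F R"


section \<open>Projection\<close>

definition proj_graph ::
  "'s set \<Rightarrow> 'd set \<Rightarrow> 'p set \<Rightarrow> ('p iport, 's ilabel, 'd) gmap \<Rightarrow> ('p, 's, 'd) gmap" where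
  "proj_graph \<Sigma> \<Delta> \<pi> F X = (THE X'. X' \<in> pgms \<Sigma> \<Delta> \<pi> \<and>
     (F (attach X) = attach X' \<or> (\<exists>t\<in>tree_paths. F (attach X) = dive X' t)))"

abbreviation visible_path :: "'p path \<Rightarrow> 'p iport path" where
  "visible_path \<equiv> map (map_prod Port Port)"

text \<open>The vertex of \<open>attach X\<close> identified with the vertex \<open>u\<close> of \<open>X\<close>\<close>
definition visible_vertex :: "('p, 's, 'd) pgm \<Rightarrow> 'p path set \<Rightarrow> 'p iport path set" where
  "visible_vertex X u = (\<Union>w\<in>u. vertex (attach X) (visible_path w))"

text \<open>\<open>x\<close> is a vertex of the invisible matter graph \<open>Y\<close>, whose pointer is either visible or in the
  tree of the visible vertex \<open>\<epsilon>\<close>; \<open>x\<close> is, or is carried by, the visible vertex that \<open>w\<close> reaches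
  from \<open>\<epsilon>\<close>.\<close>

definition carried ::
  "('p iport, 's ilabel, 'd) pgm \<Rightarrow> 'p iport path set \<Rightarrow> 'p path \<Rightarrow> bool" where
  "carried Y x w \<longleftrightarrow> (\<exists>s\<in>tree_paths. \<exists>t\<in>tree_paths.
     x \<in> vertex Y ` {backwards s @ dot @ visible_path w @ dot @ t,
                     backwards s @ dot @ visible_path w,
                     visible_path w @ dot @ t,
                     visible_path w} \<or>
     w = [] \<and> x \<in> vertex Y ` {backwards s @ t, backwards s, t})"

definition proj_vertex ::
  "'s set \<Rightarrow> 'd set \<Rightarrow> 'p set \<Rightarrow> ('p iport, 's ilabel, 'd) gmap
     \<Rightarrow> ('p iport, 's ilabel, 'd) vmap \<Rightarrow> ('p, 's, 'd) vmap" where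
  "proj_vertex \<Sigma> \<Delta> \<pi> F R X u = (THE v. v \<in> V (proj_graph \<Sigma> \<Delta> \<pi> F X) \<and>
     (\<exists>w\<in>v. carried (F (attach X)) (R (attach X) (visible_vertex X u)) w))"


section \<open>Basic facts\<close>

text \<open>Disks, attached trees and re-pointing stay within pointed graphs modulo, and the continuity
  condition above specialises to the one with \<open>F(X\<^sup>n)\<close> on \<open>pgms \<Sigma> \<Delta> \<pi>\<close>.\<close>

lemma walk_append: "walk G u w v \<Longrightarrow> walk G v w' x \<Longrightarrow> walk G u (w @ w') x"
  by (induction rule: walk.induct) (auto intro: walk.intros)

lemma walk_single: "{(u, a), (v, b)} \<in> edges G \<Longrightarrow> walk G u [(a, b)] v"
  by (rule walk_Cons[OF _ walk_Nil])

lemma walk_sym: "walk G u w v \<Longrightarrow> walk G v (backwards w) u"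
proof (induction rule: walk.induct)
  case (walk_Nil u) then show ?case by (simp add: backwards_def walk.intros)
next
  case (walk_Cons u a v b w x)
  then have "walk G v [(b, a)] u" by (intro walk_single) (simp add: insert_commute)
  with walk_Cons.IH show ?case by (auto simp: backwards_def intro: walk_append)
qed

lemma walk_append_iff: "walk G u (w @ w') x \<longleftrightarrow> (\<exists>v. walk G u w v \<and> walk G v w' x)"
proof
  show "walk G u (w @ w') x \<Longrightarrow> \<exists>v. walk G u w v \<and> walk G v w' x"
  proof (induction w arbitrary: u)
    case (Cons l w)
    from Cons.prems obtain y where
      *: "{(u, fst l), (y, snd l)} \<in> edges G" "walk G y (w @ w') x"
      by (auto elim: walk.cases)
    then obtain v where "walk G y w v" "walk G v w' x" using Cons.IH by blast
    then show ?case using walk_Cons[OF *(1)] by (metis prod.collapse)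
  qed (auto intro: walk.intros)
qed (auto intro: walk_append)

lemma pgD:
  assumes "pointed_graph \<Sigma> \<Delta> \<pi> G"
  shows "countable (verts G)" "ptr G \<in> verts G"
    "\<And>e. e \<in> edges G \<Longrightarrow> card e = 2"
    "\<And>e. e \<in> edges G \<Longrightarrow> e \<subseteq> verts G \<times> \<pi>"
    "\<And>e e'. e \<in> edges G \<Longrightarrow> e' \<in> edges G \<Longrightarrow> e \<inter> e' \<noteq> {} \<Longrightarrow> e = e'"
    "dom (vlab G) \<subseteq> verts G" "ran (vlab G) \<subseteq> \<Sigma>"
    "dom (elab G) \<subseteq> edges G" "ran (elab G) \<subseteq> \<Delta>"
    "\<And>u v. u \<in> verts G \<Longrightarrow> v \<in> verts G \<Longrightarrow> \<exists>w. walk G u w v"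
  using assms unfolding pointed_graph_def by simp_all

lemma ran_restrict: "ran (f |` A) \<subseteq> ran f"
  by (auto simp: ran_def restrict_map_def split: if_splits)

lemma walk_verts:
  assumes "walk G u w v" "pointed_graph \<Sigma> \<Delta> \<pi> G" "u \<in> verts G"
  shows "v \<in> verts G"
  using assms
proof (induction rule: walk.induct)
  case (walk_Cons u a v b w x)
  from pgD(4)[OF walk_Cons.prems(1) walk_Cons.hyps(1)]
  have "{(u, a), (v, b)} \<subseteq> verts G \<times> \<pi>" .
  then show ?case using walk_Cons by simp
qed

lemma pointed_graph_mono:
  "pointed_graph \<Sigma> \<Delta> \<pi> G \<Longrightarrow> \<Sigma> \<subseteq> \<Sigma>' \<Longrightarrow> \<Delta> \<subseteq> \<Delta>' \<Longrightarrow> \<pi> \<subseteq> \<pi>' \<Longrightarrow> pointed_graph \<Sigma>' \<Delta>' \<pi>' G"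
  unfolding pointed_graph_def
  by (elim conjE, intro conjI) (assumption | meson order_trans Sigma_mono order_refl)+

lemma pointed_graph_UNIV: "pointed_graph \<Sigma> \<Delta> \<pi> G \<Longrightarrow> pointed_graph UNIV UNIV UNIV G"
  by (erule pointed_graph_mono) auto

lemma ball_mono: "r \<le> r' \<Longrightarrow> ball G r \<subseteq> ball G r'"
  by (auto simp: ball_def intro: order_trans)

lemma ball_verts: "pointed_graph \<Sigma> \<Delta> \<pi> G \<Longrightarrow> ball G r \<subseteq> verts G"
  by (auto simp: ball_def elim!: walk_verts) (auto simp: pointed_graph_def)

lemma walk_gdisk_imp: "walk (gdisk r G) u w v \<Longrightarrow> walk G u w v"
  by (induction rule: walk.induct) (auto simp: gdisk_def intro: walk.intros)

lemma walk_gdisk: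
  assumes "walk G u w v" "walk G (ptr G) w0 u" "length w0 + length w \<le> r + 1"
  shows "walk (gdisk r G) u w v"
  using assms
proof (induction arbitrary: w0 rule: walk.induct)
  case (walk_Nil u) show ?case by (rule walk.intros)
next
  case (walk_Cons u a v b w x)
  have *: "walk G (ptr G) (w0 @ [(a, b)]) v"
    using walk_Cons by (intro walk_append walk_single)
  with walk_Cons have "walk (gdisk r G) v w x" by fastforce
  moreover have "u \<in> ball G (r + 1)" using walk_Cons.prems
    by (auto simp: ball_def intro!: exI[of _ w0])
  moreover have "v \<in> ball G (r + 1)" using * walk_Cons.prems
    by (auto simp: ball_def intro!: exI[of _ "w0 @ [(a, b)]"])
  ultimately show ?case using walk_Cons.hyps
    by (intro walk.intros) (auto simp: gdisk_def)
qed

lemma ball_gdisk: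
  assumes "r \<le> n + 1" shows "ball (gdisk n G) r = ball G r"
proof
  have [simp]: "ptr (gdisk n G) = ptr G" by (simp add: gdisk_def)
  show "ball (gdisk n G) r \<subseteq> ball G r" by (auto simp: ball_def dest: walk_gdisk_imp)
  show "ball G r \<subseteq> ball (gdisk n G) r"
  proof
    fix v assume "v \<in> ball G r"
    then obtain w where "length w \<le> r" "walk G (ptr G) w v" by (auto simp: ball_def)
    with assms have "walk (gdisk n G) (ptr G) w v"
      by (intro walk_gdisk[where ?w0.0 = "[]"]) (auto intro: walk.intros)
    with \<open>length w \<le> r\<close> show "v \<in> ball (gdisk n G) r" by (auto simp: ball_def)
  qed
qed

lemma gdisk_gdisk: "gdisk n (gdisk n G) = gdisk n G"
proof -
  have "gdisk n (gdisk n G) =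
     \<lparr>verts = ball G (n + 1),
      edges = {e \<in> edges (gdisk n G). e \<subseteq> ball G (n + 1) \<times> UNIV},
      vlab = vlab (gdisk n G) |` ball G n,
      elab = elab (gdisk n G) |` {e. e \<subseteq> ball G n \<times> UNIV},
      ptr = ptr (gdisk n G)\<rparr>"
    unfolding gdisk_def[of n "gdisk n G"] by (simp only: ball_gdisk order.refl le_add1)
  then show ?thesis by (simp add: gdisk_def)
qed

lemma pointed_graph_gdisk:
  assumes G: "pointed_graph \<Sigma> \<Delta> \<pi> G" shows "pointed_graph \<Sigma> \<Delta> \<pi> (gdisk n G)"
  unfolding pointed_graph_def
proof (intro conjI)
  have bv: "ball G r \<subseteq> verts G" for r using ball_verts[OF G] .
  show "countable (verts (gdisk n G))"
    using G bv[of "n + 1"] by (auto simp: gdisk_def pointed_graph_def intro: countable_subset)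
  show "ptr (gdisk n G) \<in> verts (gdisk n G)"
    by (auto simp: gdisk_def ball_def intro: walk.intros exI[of _ "[]"])
  show "\<forall>e\<in>edges (gdisk n G). card e = 2 \<and> e \<subseteq> verts (gdisk n G) \<times> \<pi>"
  proof
    fix e assume "e \<in> edges (gdisk n G)"
    then have e: "e \<in> edges G" "e \<subseteq> ball G (n + 1) \<times> UNIV" by (auto simp: gdisk_def)
    then have "card e = 2" "e \<subseteq> verts G \<times> \<pi>" using G unfolding pointed_graph_def by blast+
    with e show "card e = 2 \<and> e \<subseteq> verts (gdisk n G) \<times> \<pi>" by (auto simp: gdisk_def)
  qed
  show "\<forall>e\<in>edges (gdisk n G). \<forall>e'\<in>edges (gdisk n G). e \<inter> e' \<noteq> {} \<longrightarrow> e = e'"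
    using G unfolding gdisk_def pointed_graph_def by simp
  show "dom (vlab (gdisk n G)) \<subseteq> verts (gdisk n G)"
    using ball_mono[of n "n + 1" G] by (auto simp: gdisk_def)
  show "ran (vlab (gdisk n G)) \<subseteq> \<Sigma>"
    using pgD(7)[OF G] ran_restrict[of "vlab G"] by (simp add: gdisk_def) blast
  show "dom (elab (gdisk n G)) \<subseteq> edges (gdisk n G)"
  proof
    fix e assume "e \<in> dom (elab (gdisk n G))"
    then have e: "e \<in> dom (elab G)" "e \<subseteq> ball G n \<times> UNIV" by (auto simp: gdisk_def)
    then have "e \<in> edges G" using G unfolding pointed_graph_def by blast
    moreover have "e \<subseteq> ball G (n + 1) \<times> UNIV" using e ball_mono[of n "n + 1" G] by fastforce
    ultimately show "e \<in> edges (gdisk n G)" by (simp add: gdisk_def)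
  qed
  show "ran (elab (gdisk n G)) \<subseteq> \<Delta>"
    using pgD(9)[OF G] ran_restrict[of "elab G"] by (simp add: gdisk_def) blast
  have *: "\<exists>w. walk (gdisk n G) (ptr G) w v" if "v \<in> ball G (n + 1)" for v
    using that ball_gdisk[of "n + 1" n G] by (auto simp: ball_def gdisk_def)
  show "\<forall>u\<in>verts (gdisk n G). \<forall>v\<in>verts (gdisk n G). \<exists>w. walk (gdisk n G) u w v"
  proof (intro ballI)
    fix u v assume "u \<in> verts (gdisk n G)" "v \<in> verts (gdisk n G)"
    then have "u \<in> ball G (n + 1)" "v \<in> ball G (n + 1)" by (auto simp: gdisk_def)
    with * show "\<exists>w. walk (gdisk n G) u w v" by (meson walk_sym walk_append)
  qed
qed

definition iso_via where
  "iso_via f G H \<longleftrightarrow> bij_betw f (verts G) (verts H) \<and>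
     f (ptr G) = ptr H \<and>
     edges H = rename_edge f ` edges G \<and>
     (\<forall>v\<in>verts G. vlab H (f v) = vlab G v) \<and>
     (\<forall>e\<in>edges G. elab H (rename_edge f e) = elab G e)"

lemma isomorphic_via: "isomorphic G H \<longleftrightarrow> (\<exists>f. iso_via f G H)"
  by (simp add: isomorphic_def iso_via_def)

lemma rename_edge_comp: "rename_edge g (rename_edge f e) = rename_edge (g \<circ> f) e"
  by (force simp: image_iff map_prod_def)

lemma rename_edge_id: "e \<subseteq> A \<times> UNIV \<Longrightarrow> (\<And>x. x \<in> A \<Longrightarrow> f x = x) \<Longrightarrow> rename_edge f e = e"
  by (force simp: image_iff map_prod_def)

lemma iso_via_trans: "iso_via f G H \<Longrightarrow> iso_via g H K \<Longrightarrow> iso_via (g \<circ> f) G K"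
proof -
  assume a: "iso_via f G H" "iso_via g H K"
  then have "f v \<in> verts H" if "v \<in> verts G" for v
    using that by (auto simp: iso_via_def bij_betw_def)
  with a show ?thesis
    unfolding iso_via_def by (auto simp: image_image rename_edge_comp[symmetric] intro: bij_betw_trans)
qed

lemma iso_via_inv:
  assumes f: "iso_via f G H" and G: "pointed_graph \<Sigma> \<Delta> \<pi> G"
  shows "iso_via (the_inv_into (verts G) f) H G"
proof -
  let ?g = "the_inv_into (verts G) f"
  have inj: "inj_on f (verts G)" and im: "f ` verts G = verts H"
    using f by (auto simp: iso_via_def bij_betw_def)
  have g: "?g (f v) = v" if "v \<in> verts G" for v using inj that by (rule the_inv_into_f_f)
  have e: "rename_edge ?g (rename_edge f e) = e" if "e \<in> edges G" for e
    unfolding rename_edge_comp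
    by (rule rename_edge_id[where A = "verts G"]) (use that pgD(4)[OF G] g in auto)
  show ?thesis unfolding iso_via_def
  proof (intro conjI)
    show "bij_betw ?g (verts H) (verts G)"
      using f by (auto simp: iso_via_def intro: bij_betw_the_inv_into)
    show "?g (ptr H) = ptr G" using f pgD(2)[OF G] g unfolding iso_via_def by metis
    show "edges G = rename_edge ?g ` edges H"
      using f e by (auto simp: iso_via_def image_image)
    show "\<forall>v\<in>verts H. vlab G (?g v) = vlab H v"
      using f g im[symmetric] by (auto simp: iso_via_def simp del: bij_betw_imp_surj_on)
    show "\<forall>x\<in>edges H. elab G (rename_edge ?g x) = elab H x"
      using f e by (auto simp: iso_via_def)
  qed
qed

lemma iso_via_walk: "iso_via f G H \<Longrightarrow> walk G u w v \<Longrightarrow> walk H (f u) w (f v)"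
proof (rotate_tac, induction rule: walk.induct)
  case (walk_Cons u a v b w x)
  then have "rename_edge f {(u, a), (v, b)} \<in> edges H" 
    unfolding iso_via_def by blast
  then show ?case using walk_Cons by (auto intro: walk.intros)
qed (rule walk.intros)

lemma iso_refl: "isomorphic G G"
  unfolding isomorphic_via iso_via_def
  by (rule exI[of _ id]) (auto simp: prod.map_id0 bij_betw_def)

lemma iso_trans: "isomorphic G H \<Longrightarrow> isomorphic H K \<Longrightarrow> isomorphic G K"
  unfolding isomorphic_via using iso_via_trans by blast

lemma iso_sym: "isomorphic G H \<Longrightarrow> pointed_graph \<Sigma> \<Delta> \<pi> G \<Longrightarrow> isomorphic H G"
  unfolding isomorphic_via using iso_via_inv by blast

lemma modulo_eq:
  assumes "isomorphic G H" "pointed_graph \<Sigma> \<Delta> \<pi> G"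
  shows "modulo G = modulo H"
  unfolding modulo_def by (auto intro: iso_trans[OF assms(1)] iso_trans[OF iso_sym[OF assms]])

lemma self_in_modulo: "pointed_graph \<Sigma> \<Delta> \<pi> G \<Longrightarrow> G \<in> modulo G"
  by (auto simp: modulo_def iso_refl pointed_graph_UNIV)

lemma ball_iso:
  assumes f: "iso_via f G H" and G: "pointed_graph \<Sigma> \<Delta> \<pi> G"
  shows "ball H r = f ` ball G r"
proof
  have p: "f (ptr G) = ptr H" using f by (simp add: iso_via_def)
  show "f ` ball G r \<subseteq> ball H r"
    using iso_via_walk[OF f, of "ptr G"] p by (auto simp: ball_def)
  let ?g = "the_inv_into (verts G) f"
  have g: "iso_via ?g H G" using iso_via_inv[OF f G] .
  then have pg: "?g (ptr H) = ptr G" by (simp add: iso_via_def)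
  show "ball H r \<subseteq> f ` ball G r"
  proof
    fix v assume "v \<in> ball H r"
    then obtain w where w: "length w \<le> r" "walk H (ptr H) w v" by (auto simp: ball_def)
    then have *: "walk G (ptr G) w (?g v)" using iso_via_walk[OF g, of "ptr H"] pg by auto
    then have "?g v \<in> ball G r" using w by (auto simp: ball_def)
    moreover from * have "walk H (ptr H) w (f (?g v))" using iso_via_walk[OF f, of "ptr G"] p by auto
    moreover have "v \<in> verts H"
    proof -
      have "x \<in> verts H" if "walk H u w x" "u \<in> verts H" for u w x
        using that
      proof (induction rule: walk.induct)
        case (walk_Cons u a v b w x)
        then obtain e where "e \<in> edges G" "{(u, a), (v, b)} = rename_edge f e"
          using f by (auto simp: iso_via_def)
        moreover from this have "e \<subseteq> verts G \<times> UNIV" using pgD(4)[OF G] by blast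
        ultimately have "v \<in> f ` verts G" by (force simp: set_eq_iff)
        then show ?case using walk_Cons f by (auto simp: iso_via_def bij_betw_def)
      qed
      moreover have "ptr H \<in> verts H"
        using p f pgD(2)[OF G] unfolding iso_via_def by (metis bij_betwE)
      ultimately show ?thesis using w by blast
    qed
    then have "f (?g v) = v"
      using f by (auto simp: iso_via_def bij_betw_def f_the_inv_into_f)
    ultimately show "v \<in> f ` ball G r" by (metis image_eqI)
  qed
qed

lemma gdisk_iso:
  assumes f: "iso_via f G H" and G: "pointed_graph \<Sigma> \<Delta> \<pi> G"
  shows "iso_via f (gdisk n G) (gdisk n H)"
proof -
  have b: "ball H r = f ` ball G r" for r using ball_iso[OF f G] .
  have inj: "inj_on f (verts G)" using f by (auto simp: iso_via_def bij_betw_def)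
  have bv: "ball G r \<subseteq> verts G" for r using ball_verts[OF G] .
  have sub: "rename_edge f e \<subseteq> f ` ball G r \<times> UNIV \<longleftrightarrow> e \<subseteq> ball G r \<times> UNIV"
    if "e \<in> edges G" for e r
  proof
    assume *: "rename_edge f e \<subseteq> f ` ball G r \<times> UNIV"
    show "e \<subseteq> ball G r \<times> UNIV"
    proof
      fix x assume x: "x \<in> e"
      then have "(f (fst x), snd x) \<in> rename_edge f e" by (cases x) force
      from subsetD[OF * this] have "f (fst x) \<in> f ` ball G r" by simp
      moreover have "fst x \<in> verts G" using x pgD(4)[OF G that] by fastforce
      ultimately have "fst x \<in> ball G r" using inj bv[of r] by (auto dest: inj_onD)
      then show "x \<in> ball G r \<times> UNIV" by (cases x) auto
    qed
  qed fastforce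
  show ?thesis unfolding iso_via_def
  proof (intro conjI)
    show "bij_betw f (verts (gdisk n G)) (verts (gdisk n H))"
      using inj bv b by (auto simp: gdisk_def bij_betw_def intro: inj_on_subset)
    show "f (ptr (gdisk n G)) = ptr (gdisk n H)" using f by (simp add: gdisk_def iso_via_def)
    show "edges (gdisk n H) = rename_edge f ` edges (gdisk n G)"
      using f sub by (auto simp: gdisk_def iso_via_def b simp del: image_subset_iff)
    show "\<forall>v\<in>verts (gdisk n G). vlab (gdisk n H) (f v) = vlab (gdisk n G) v"
    proof
      fix v assume "v \<in> verts (gdisk n G)"
      then have v: "v \<in> verts G" using bv by (auto simp: gdisk_def)
      then have "f v \<in> f ` ball G n \<longleftrightarrow> v \<in> ball G n" using inj bv[of n] by (auto dest: inj_onD)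
      then show "vlab (gdisk n H) (f v) = vlab (gdisk n G) v"
        using f v by (auto simp: gdisk_def iso_via_def b restrict_map_def)
    qed
    show "\<forall>e\<in>edges (gdisk n G). elab (gdisk n H) (rename_edge f e) = elab (gdisk n G) e"
      using f sub by (auto simp: gdisk_def iso_via_def b restrict_map_def simp del: image_subset_iff)
  qed
qed

lemma disk_modulo:
  assumes G: "pointed_graph \<Sigma> \<Delta> \<pi> (G :: (nat, 'p, 's, 'd) pgraph)"
  shows "disk n (modulo G) = modulo (gdisk n G)"
proof -
  have "modulo (gdisk n H) = modulo (gdisk n G)" if "H \<in> modulo G" for H
    using that gdisk_iso[OF _ G] modulo_eq[OF _ pointed_graph_gdisk[OF G]]
    unfolding modulo_def isomorphic_via by blast
  then show ?thesis using self_in_modulo[OF G] unfolding disk_def by blast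
qed

lemma disk_pgms: "X \<in> pgms \<Sigma> \<Delta> \<pi> \<Longrightarrow> disk n X \<in> pgms \<Sigma> \<Delta> \<pi>"
  unfolding pgms_def using disk_modulo pointed_graph_gdisk by blast

lemma disk_disk: "X \<in> pgms \<Sigma> \<Delta> \<pi> \<Longrightarrow> disk n (disk n X) = disk n X"
  unfolding pgms_def using disk_modulo pointed_graph_gdisk gdisk_gdisk
  by (smt (verit) mem_Collect_eq)

lemma continuous_on_disks:
  assumes "continuous (pgms \<Sigma> \<Delta> \<pi>) F R" and X: "X \<in> pgms \<Sigma> \<Delta> \<pi>"
  shows "\<exists>n. disk m (F X) = disk m (F (disk n X)) \<and>
    (\<forall>u\<in>restr_dom m F R X. trace n X u \<noteq> {}) \<and>
    restr_graph n m F R X = restr_graph n m F R (disk n X)"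
  using assms disk_pgms[OF X] disk_disk[OF X] unfolding continuous_def by meson


lemma ex_nat_representative:
  fixes G :: "('v, 'p, 's, 'd) pgraph"
  assumes G: "pointed_graph \<Sigma> \<Delta> \<pi> G"
  shows "\<exists>H :: (nat, 'p, 's, 'd) pgraph. pointed_graph \<Sigma> \<Delta> \<pi> H \<and> isomorphic G H"
proof -
  define f where "f = to_nat_on (verts G)"
  define g where "g = the_inv_into (verts G) f"
  have inj: "inj_on f (verts G)" unfolding f_def by (rule inj_on_to_nat_on[OF pgD(1)[OF G]])
  have g: "g (f v) = v" if "v \<in> verts G" for v
    unfolding g_def using inj that by (rule the_inv_into_f_f)
  have e: "rename_edge g (rename_edge f e) = e" if "e \<in> edges G" for e
    unfolding rename_edge_comp
    by (rule rename_edge_id[where A = "verts G"]) (use that pgD(4)[OF G] g in auto)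
  define H where "H = \<lparr>verts = f ` verts G, edges = rename_edge f ` edges G,
     vlab = (\<lambda>v. if v \<in> f ` verts G then vlab G (g v) else None),
     elab = (\<lambda>x. if x \<in> rename_edge f ` edges G then elab G (rename_edge g x) else None),
     ptr = f (ptr G)\<rparr>"
  have iso: "iso_via f G H"
    unfolding iso_via_def H_def using inj e g by (auto simp: bij_betw_def)
  have inj2: "inj_on (map_prod f id) (verts G \<times> UNIV)"
    by (rule map_prod_inj_on[OF inj]) auto
  have sub: "e \<subseteq> verts G \<times> UNIV" if "e \<in> edges G" for e
    using pgD(4)[OF G that] by blast
  have "pointed_graph \<Sigma> \<Delta> \<pi> H"
    unfolding pointed_graph_def
  proof (intro conjI)
    show "countable (verts H)" by simp
    show "ptr H \<in> verts H" using pgD(2)[OF G] by (simp add: H_def)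
    show "\<forall>x\<in>edges H. card x = 2 \<and> x \<subseteq> verts H \<times> \<pi>"
    proof
      fix x assume "x \<in> edges H"
      then obtain e where e': "e \<in> edges G" "x = rename_edge f e" by (auto simp: H_def)
      then have "card x = 2"
        using card_image[OF inj_on_subset[OF inj2 sub[OF e'(1)]]] pgD(3)[OF G] by simp
      moreover have "x \<subseteq> verts H \<times> \<pi>"
        unfolding e'(2) H_def using pgD(4)[OF G e'(1)] by auto
      ultimately show "card x = 2 \<and> x \<subseteq> verts H \<times> \<pi>" by simp
    qed
    show "\<forall>x\<in>edges H. \<forall>y\<in>edges H. x \<inter> y \<noteq> {} \<longrightarrow> x = y"
    proof (intro ballI impI)
      fix x y assume "x \<in> edges H" "y \<in> edges H" and ne: "x \<inter> y \<noteq> {}"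
      then obtain d e where e': "d \<in> edges G" "x = rename_edge f d" "e \<in> edges G" "y = rename_edge f e"
        by (auto simp: H_def)
      have "rename_edge f (d \<inter> e) = x \<inter> y"
        unfolding e' by (rule inj_on_image_Int[OF inj2 sub sub]) (use e' in auto)
      with ne have "d \<inter> e \<noteq> {}" by blast
      then show "x = y" using e' pgD(5)[OF G] by metis
    qed
    show "dom (vlab H) \<subseteq> verts H" by (auto simp: H_def split: if_splits)
    show "ran (vlab H) \<subseteq> \<Sigma>"
      using pgD(7)[OF G] by (force simp: H_def ran_def split: if_splits)
    show "dom (elab H) \<subseteq> edges H" by (auto simp: H_def split: if_splits)
    show "ran (elab H) \<subseteq> \<Delta>"
      using pgD(9)[OF G] by (force simp: H_def ran_def split: if_splits)
    show "\<forall>u\<in>verts H. \<forall>v\<in>verts H. \<exists>w. walk H u w v"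
      using pgD(10)[OF G] iso_via_walk[OF iso] by (fastforce simp: H_def)
  qed
  with iso show ?thesis unfolding isomorphic_via by blast
qed

lemma modulo_in_pgms:
  assumes G: "pointed_graph \<Sigma> \<Delta> \<pi> G" shows "modulo G \<in> pgms \<Sigma> \<Delta> \<pi>"
  using ex_nat_representative[OF G] modulo_eq[OF _ G] unfolding pgms_def by blast

lemma modulo_nonempty: "pointed_graph \<Sigma> \<Delta> \<pi> G \<Longrightarrow> modulo G \<noteq> {}"
  using ex_nat_representative pointed_graph_UNIV unfolding modulo_def by fastforce

lemma inj_visible_port: "inj (map_prod Visible Port)"
  by (rule prod.inj_map) (auto intro: injI)

lemma inj_visible_edge: "inj visible_edge"
  by (rule injI) (simp only: inj_image_eq_iff[OF inj_visible_port])

lemma gattach_edgeI: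
  "e \<in> edges G \<Longrightarrow> visible_edge e \<in> edges (gattach G)"
  "v \<in> verts G \<Longrightarrow> {(Visible v, Mp), (Invisible v [], Mp)} \<in> edges (gattach G)"
  "v \<in> verts G \<Longrightarrow>
    {(Invisible v ds, if d then Rp else Lp), (Invisible v (ds @ [d]), Mp)} \<in> edges (gattach G)"
  unfolding gattach_def by (simp_all only: pgraph.simps) blast+

lemma walk_gattach: "walk G u w v \<Longrightarrow> walk (gattach G) (Visible u) (visible_path w) (Visible v)"
proof (induction rule: walk.induct)
  case (walk_Cons u a v b w x)
  then have "visible_edge {(u, a), (v, b)} \<in> edges (gattach G)"
    using gattach_edgeI(1) by blast
  then show ?case using walk_Cons by (auto intro: walk.intros)
qed (simp add: walk.intros)

lemma walk_gattach_tree: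
  assumes "v \<in> verts G"
  shows "\<exists>w. walk (gattach G) (Visible v) w (Invisible v ds)"
proof (induction ds rule: rev_induct)
  case Nil
  have "{(Visible v, Mp), (Invisible v [], Mp)} \<in> edges (gattach G)"
    using assms by (auto simp: gattach_def)
  then show ?case by (blast intro: walk_single)
next
  case (snoc d ds)
  have "{(Invisible v ds, if d then Rp else Lp), (Invisible v (ds @ [d]), Mp)} \<in> edges (gattach G)"
    using assms unfolding gattach_def by simp blast
  with snoc show ?case by (blast intro: walk_single walk_append)
qed

lemma gattach_edge_cases:
  assumes "e \<in> edges (gattach G)"
  obtains d where "d \<in> edges G" "e = visible_edge d"
  | v where "v \<in> verts G" "e = {(Visible v, Mp), (Invisible v [], Mp)}"
  | v ds d where "v \<in> verts G"
      "e = {(Invisible v ds, if d then Rp else Lp), (Invisible v (ds @ [d]), Mp)}"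
  using assms unfolding gattach_def by auto

lemma pointed_graph_gattach:
  assumes G: "pointed_graph \<Sigma> \<Delta> \<pi> G"
  shows "pointed_graph (ilabels \<Sigma>) \<Delta> (iports \<pi>) (gattach G)"
  unfolding pointed_graph_def
proof (intro conjI)
  have "{Invisible v ds |v ds. v \<in> verts G} = case_prod Invisible ` (verts G \<times> UNIV)" by auto
  then show "countable (verts (gattach G))" using pgD(1)[OF G] by (simp add: gattach_def)
  show "ptr (gattach G) \<in> verts (gattach G)" using pgD(2)[OF G] by (simp add: gattach_def)
  note inj = inj_visible_port
  show "\<forall>e\<in>edges (gattach G). card e = 2 \<and> e \<subseteq> verts (gattach G) \<times> iports \<pi>"
  proof
    fix e assume "e \<in> edges (gattach G)"
    then show "card e = 2 \<and> e \<subseteq> verts (gattach G) \<times> iports \<pi>"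
    proof (cases rule: gattach_edge_cases)
      case (1 d)
      have "card e = 2" using 1(2) pgD(3)[OF G 1(1)] card_image[OF inj_on_subset[OF inj subset_UNIV], of d]
        by simp
      moreover have "e \<subseteq> verts (gattach G) \<times> iports \<pi>"
        unfolding 1(2) using pgD(4)[OF G 1(1)] by (auto simp: gattach_def iports_def)
      ultimately show ?thesis by simp
    qed (auto simp: gattach_def iports_def)
  qed
  show "\<forall>e\<in>edges (gattach G). \<forall>e'\<in>edges (gattach G). e \<inter> e' \<noteq> {} \<longrightarrow> e = e'"
  proof (intro ballI impI)
    fix e e' assume e: "e \<in> edges (gattach G)" and e': "e' \<in> edges (gattach G)" and "e \<inter> e' \<noteq> {}"
    then obtain x where x: "x \<in> e" "x \<in> e'" by blast
    show "e = e'" using e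
    proof (cases rule: gattach_edge_cases)
      case (1 d)
      note d = this
      show ?thesis using e'
      proof (cases rule: gattach_edge_cases)
        case (1 d')
        have "visible_edge (d \<inter> d') = e \<inter> e'"
          unfolding d 1 by (rule image_Int[OF inj])
        with x have "d \<inter> d' \<noteq> {}" by blast
        then show ?thesis using d 1 pgD(5)[OF G] by metis
      qed (use x d in auto)
    next
      case (2 v)
      show ?thesis using e' by (cases rule: gattach_edge_cases) (use 2 x in \<open>auto split: if_splits\<close>)
    next
      case (3 v ds d)
      show ?thesis using e' by (cases rule: gattach_edge_cases) (use 3 x in \<open>auto split: if_splits\<close>)
    qed
  qed
  show "dom (vlab (gattach G)) \<subseteq> verts (gattach G)"
  proof
    fix x assume "x \<in> dom (vlab (gattach G))"
    then show "x \<in> verts (gattach G)"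
      using subsetD[OF pgD(6)[OF G] domI] by (cases x) (auto simp: gattach_def split: if_splits)
  qed
  show "ran (vlab (gattach G)) \<subseteq> ilabels \<Sigma>"
  proof
    fix y assume "y \<in> ran (vlab (gattach G))"
    then obtain x where "vlab (gattach G) x = Some y" by (auto simp: ran_def)
    then show "y \<in> ilabels \<Sigma>" using subsetD[OF pgD(7)[OF G] ranI]
      by (cases x) (auto simp: gattach_def ilabels_def split: if_splits)
  qed
  show "dom (elab (gattach G)) \<subseteq> edges (gattach G)"
    by (auto simp: gattach_def split: if_splits)
  show "ran (elab (gattach G)) \<subseteq> \<Delta>"
  proof
    fix y assume "y \<in> ran (elab (gattach G))"
    then obtain x where "elab (gattach G) x = Some y" by (auto simp: ran_def)
    then show "y \<in> \<Delta>" using subsetD[OF pgD(9)[OF G] ranI]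
      by (auto simp: gattach_def split: if_splits)
  qed
  have *: "\<exists>w. walk (gattach G) (Visible (ptr G)) w x" if x: "x \<in> verts (gattach G)" for x
  proof -
    obtain v where v: "v \<in> verts G" "x = Visible v \<or> (\<exists>ds. x = Invisible v ds)"
      using x by (auto simp: gattach_def)
    obtain w where "walk G (ptr G) w v" using pgD(10)[OF G pgD(2)[OF G] v(1)] by blast
    then have "walk (gattach G) (Visible (ptr G)) (visible_path w) (Visible v)" by (rule walk_gattach)
    then show ?thesis using v(2) walk_gattach_tree[OF v(1)] walk_append by metis
  qed
  show "\<forall>u\<in>verts (gattach G). \<forall>v\<in>verts (gattach G). \<exists>w. walk (gattach G) u w v"
    using * by (meson walk_sym walk_append)
qed

lemma elab_gattach: "e \<in> edges G \<Longrightarrow> elab (gattach G) (visible_edge e) = elab G e"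
  by (simp add: gattach_def the_inv_into_f_f[OF inj_visible_edge])


lemma gattach_iso:
  assumes f: "iso_via f G H"
  shows "iso_via (map_ivertex f) (gattach G) (gattach H)"
proof -
  have fi: "inj_on f (verts G)" and fv: "verts H = f ` verts G" and fp: "ptr H = f (ptr G)"
    and fe: "edges H = rename_edge f ` edges G"
    and fl: "\<And>v. v \<in> verts G \<Longrightarrow> vlab H (f v) = vlab G v"
    and fd: "\<And>e. e \<in> edges G \<Longrightarrow> elab H (rename_edge f e) = elab G e"
    using f by (auto simp: iso_via_def bij_betw_def)
  have r: "rename_edge (map_ivertex f) (visible_edge e) = visible_edge (rename_edge f e)" for e
    unfolding image_comp prod.map_comp by (rule image_cong) auto
  have vis: "e \<in> edges G \<Longrightarrow> elab (gattach H) (visible_edge (rename_edge f e)) = elab G e" for e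
    using fd by (subst elab_gattach) (auto simp: fe)
  have tree: "(x, Mp) \<notin> e" if "e \<in> visible_edge ` E" for e E x
    using that by auto
  show ?thesis unfolding iso_via_def
  proof (intro conjI)
    show "bij_betw (map_ivertex f) (verts (gattach G)) (verts (gattach H))"
    proof (rule bij_betw_imageI)
      show "inj_on (map_ivertex f) (verts (gattach G))"
      proof (rule inj_onI)
        fix x y assume "x \<in> verts (gattach G)" "y \<in> verts (gattach G)"
          "map_ivertex f x = map_ivertex f y"
        then show "x = y" by (cases x; cases y) (auto simp: gattach_def dest: inj_onD[OF fi])
      qed
      have "Invisible (f v) ds \<in> map_ivertex f ` {Invisible v ds |v ds. v \<in> verts G}"
        if "v \<in> verts G" for v ds
        using that by (intro image_eqI[of _ _ "Invisible v ds"]) auto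
      then show "map_ivertex f ` verts (gattach G) = verts (gattach H)"
        by (auto simp: gattach_def fv image_Un image_image)
    qed
    show "map_ivertex f (ptr (gattach G)) = ptr (gattach H)" by (simp add: gattach_def fp)
    show "edges (gattach H) = rename_edge (map_ivertex f) ` edges (gattach G)"
    proof (intro equalityI subsetI)
      fix e assume "e \<in> edges (gattach H)"
      then show "e \<in> rename_edge (map_ivertex f) ` edges (gattach G)"
      proof (cases rule: gattach_edge_cases)
        case (1 d)
        then obtain c where "c \<in> edges G" "e = rename_edge (map_ivertex f) (visible_edge c)"
          by (auto simp: fe r)
        then show ?thesis using gattach_edgeI(1) by blast
      next
        case (2 v)
        then obtain u where u: "u \<in> verts G" "v = f u" by (auto simp: fv)
        then have "e = rename_edge (map_ivertex f) {(Visible u, Mp), (Invisible u [], Mp)}"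
          using 2 by simp
        then show ?thesis using gattach_edgeI(2)[OF u(1)] by (simp only: imageI)
      next
        case (3 v ds d)
        then obtain u where u: "u \<in> verts G" "v = f u" by (auto simp: fv)
        then have "e = rename_edge (map_ivertex f)
            {(Invisible u ds, if d then Rp else Lp), (Invisible u (ds @ [d]), Mp)}"
          using 3 by simp
        then show ?thesis using gattach_edgeI(3)[OF u(1)] by (simp only: imageI)
      qed
    next
      fix e' assume "e' \<in> rename_edge (map_ivertex f) ` edges (gattach G)"
      then obtain e where e: "e' = rename_edge (map_ivertex f) e" "e \<in> edges (gattach G)" by blast
      from e(2) show "e' \<in> edges (gattach H)"
      proof (cases rule: gattach_edge_cases)
        case (1 d)
        then have "e' = visible_edge (rename_edge f d)" "rename_edge f d \<in> edges H"
          by (simp_all only: e(1) r fe imageI)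
        then show ?thesis using gattach_edgeI(1) by (simp only:)
      next
        case (2 v)
        then have "e' = {(Visible (f v), Mp), (Invisible (f v) [], Mp)}" "f v \<in> verts H"
          by (simp_all add: e(1) fv)
        then show ?thesis using gattach_edgeI(2) by (simp only:)
      next
        case (3 v ds d)
        then have "e' = {(Invisible (f v) ds, if d then Rp else Lp), (Invisible (f v) (ds @ [d]), Mp)}"
          "f v \<in> verts H"
          by (simp_all add: e(1) fv)
        then show ?thesis using gattach_edgeI(3) by (simp only:)
      qed
    qed
    show "\<forall>v\<in>verts (gattach G). vlab (gattach H) (map_ivertex f v) = vlab (gattach G) v"
      by (auto simp: gattach_def fl fv)
    show "\<forall>e\<in>edges (gattach G).
        elab (gattach H) (rename_edge (map_ivertex f) e) = elab (gattach G) e"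
    proof
      fix e assume "e \<in> edges (gattach G)"
      then show "elab (gattach H) (rename_edge (map_ivertex f) e) = elab (gattach G) e"
      proof (cases rule: gattach_edge_cases)
        case (1 d)
        then show ?thesis by (simp only: r vis elab_gattach)
      next
        case (2 v)
        then have "(Visible v, Mp) \<in> e" "(Visible (f v), Mp) \<in> rename_edge (map_ivertex f) e"
          by simp_all
        then have "e \<notin> visible_edge ` edges G"
            "rename_edge (map_ivertex f) e \<notin> visible_edge ` edges H"
          using tree by metis+
        then show ?thesis by (simp add: gattach_def)
      next
        case (3 v ds d)
        then have "(Invisible v (ds @ [d]), Mp) \<in> e"
            "(Invisible (f v) (ds @ [d]), Mp) \<in> rename_edge (map_ivertex f) e"
          by simp_all
        then have "e \<notin> visible_edge ` edges G"
            "rename_edge (map_ivertex f) e \<notin> visible_edge ` edges H"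
          using tree by metis+
        then show ?thesis by (simp add: gattach_def)
      qed
    qed
  qed
qed

lemma attach_modulo:
  assumes G: "pointed_graph \<Sigma> \<Delta> \<pi> (G :: (nat, 'p, 's, 'd) pgraph)"
  shows "attach (modulo G) = modulo (gattach G)"
proof -
  have "modulo (gattach H) = modulo (gattach G)" if "H \<in> modulo G" for H
    using that gattach_iso[of _ G H] modulo_eq[OF _ pointed_graph_gattach[OF G]]
    unfolding modulo_def isomorphic_via by blast
  then show ?thesis using self_in_modulo[OF G] unfolding attach_def by blast
qed

lemma attach_pgms: "X \<in> pgms \<Sigma> \<Delta> \<pi> \<Longrightarrow> attach X \<in> pgms (ilabels \<Sigma>) \<Delta> (iports \<pi>)"
  using attach_modulo modulo_in_pgms[OF pointed_graph_gattach] unfolding pgms_def by fastforce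

lemma walk_ptr [simp]: "walk (G\<lparr>ptr := p\<rparr>) u w v \<longleftrightarrow> walk G u w v"
proof
  show "walk (G\<lparr>ptr := p\<rparr>) u w v \<Longrightarrow> walk G u w v"
    by (induction rule: walk.induct) (auto intro: walk.intros)
  show "walk G u w v \<Longrightarrow> walk (G\<lparr>ptr := p\<rparr>) u w v"
    by (induction rule: walk.induct) (auto intro: walk.intros)
qed

lemma walk_det:
  assumes G: "pointed_graph \<Sigma> \<Delta> \<pi> G"
  shows "walk G u w v \<Longrightarrow> walk G u w v' \<Longrightarrow> v = v'"
proof (induction arbitrary: v' rule: walk.induct)
  case (walk_Nil u) then show ?case by (auto elim: walk.cases)
next
  case (walk_Cons u a v b w x)
  from walk_Cons.prems obtain y where y: "{(u, a), (y, b)} \<in> edges G" "walk G y w v'"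
    by (auto elim: walk.cases)
  have "{(u, a), (v, b)} = {(u, a), (y, b)}"
    by (rule pgD(5)[OF G walk_Cons.hyps(1) y(1)]) simp
  then have "v = y" by (auto simp: doubleton_eq_iff)
  with y walk_Cons.IH show ?case by blast
qed

lemma iso_via_walk_iff:
  assumes f: "iso_via f G H" and G: "pointed_graph \<Sigma> \<Delta> \<pi> G"
    and H: "pointed_graph \<Sigma>' \<Delta>' \<pi>' H" and u: "u \<in> verts G"
  shows "walk H (f u) w y \<longleftrightarrow> (\<exists>v. y = f v \<and> walk G u w v)"
proof
  let ?g = "the_inv_into (verts G) f"
  have inj: "inj_on f (verts G)" using f by (simp add: iso_via_def bij_betw_def)
  assume y: "walk H (f u) w y"
  have "f u \<in> verts H" using f u unfolding iso_via_def by (metis bij_betwE)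
  then have "y \<in> verts H" using walk_verts[OF y H] by simp
  then have "y = f (?g y)" using f by (auto simp: iso_via_def bij_betw_def f_the_inv_into_f)
  moreover have "walk G u w (?g y)"
    using iso_via_walk[OF iso_via_inv[OF f G] y] the_inv_into_f_f[OF inj u] by simp
  ultimately show "\<exists>v. y = f v \<and> walk G u w v" by blast
qed (use iso_via_walk[OF f] in blast)

lemma repoint_modulo:
  assumes G: "pointed_graph \<Sigma> \<Delta> \<pi> (G :: (nat, 'p, 's, 'd) pgraph)"
    and w: "walk G (ptr G) w v" and u: "u \<subseteq> vertex (modulo G) w" "u \<noteq> {}"
  shows "repoint (modulo G) u = modulo (G\<lparr>ptr := v\<rparr>)"
proof -
  have vG: "v \<in> verts G" using walk_verts[OF w G pgD(2)[OF G]] .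
  have Gv: "pointed_graph \<Sigma> \<Delta> \<pi> (G\<lparr>ptr := v\<rparr>)"
    using G vG by (simp add: pointed_graph_def)
  have all: "walk G (ptr G) w' v" if w'u: "w' \<in> u" for w'
  proof -
    obtain H :: "(nat, 'p, 's, 'd) pgraph" and x
      where H: "pointed_graph UNIV UNIV UNIV H" "isomorphic G H"
      and x: "walk H (ptr H) w x" "walk H (ptr H) w' x"
      using subsetD[OF u(1) w'u] unfolding vertex_def modulo_def by blast
    then obtain f where f: "iso_via f G H" by (auto simp: isomorphic_via)
    then have [simp]: "ptr H = f (ptr G)" by (simp add: iso_via_def)
    note iff = iso_via_walk_iff[OF f G H(1) pgD(2)[OF G]]
    obtain y z where y: "x = f y" "walk G (ptr G) w y" "x = f z" "walk G (ptr G) w' z"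
      using x iff unfolding \<open>ptr H = f (ptr G)\<close> by metis
    then have "y \<in> verts G" "z \<in> verts G" using walk_verts[OF _ G pgD(2)[OF G]] by auto
    then have "y = z" using y f by (auto simp: iso_via_def bij_betw_def dest: inj_onD)
    then show ?thesis using y walk_det[OF G w] by blast
  qed
  have eq: "modulo (H\<lparr>ptr := x\<rparr>) = modulo (G\<lparr>ptr := v\<rparr>)"
    if "H \<in> modulo G" "w' \<in> u" "walk H (ptr H) w' x" for H w' x
  proof -
    from that obtain f where H: "pointed_graph UNIV UNIV UNIV H" and f: "iso_via f G H"
      by (auto simp: modulo_def isomorphic_via)
    have "x = f v"
      using iso_via_walk_iff[OF f G H pgD(2)[OF G]] that walk_det[OF G] all f
      by (metis iso_via_def)
    then have "iso_via f (G\<lparr>ptr := v\<rparr>) (H\<lparr>ptr := x\<rparr>)" using f by (simp add: iso_via_def)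
    then show ?thesis using modulo_eq[OF _ Gv] unfolding isomorphic_via by metis
  qed
  obtain w' where w': "w' \<in> u" using u by blast
  show ?thesis
    using eq all[OF w'] w' self_in_modulo[OF G] unfolding repoint_def by blast
qed

lemma repoint_pgms:
  fixes X :: "('p, 's, 'd) pgm"
  assumes X: "X \<in> pgms \<Sigma> \<Delta> \<pi>" and u: "u \<in> V X"
  shows "repoint X u \<in> pgms \<Sigma> \<Delta> \<pi>"
proof -
  obtain G :: "(nat, 'p, 's, 'd) pgraph" where G: "pointed_graph \<Sigma> \<Delta> \<pi> G" "X = modulo G"
    using X unfolding pgms_def by blast
  obtain w where w: "w \<in> paths X" "u = vertex X w" using u by (auto simp: V_def)
  from w(1) obtain H :: "(nat, 'p, 's, 'd) pgraph" and x
    where H: "pointed_graph UNIV UNIV UNIV H" "isomorphic G H" "walk H (ptr H) w x"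
    by (auto simp: paths_def G modulo_def)
  obtain f where f: "iso_via f H G" using iso_sym[OF H(2) G(1)] by (auto simp: isomorphic_via)
  have p: "walk G (ptr G) w (f x)" using iso_via_walk[OF f H(3)] f by (simp add: iso_via_def)
  have "w \<in> u" using p self_in_modulo[OF G(1)] by (auto simp: w(2) vertex_def G(2))
  then have "repoint X u = modulo (G\<lparr>ptr := f x\<rparr>)"
    unfolding G(2) by (intro repoint_modulo[OF G(1) p]) (auto simp: w(2) G(2))
  moreover have "pointed_graph \<Sigma> \<Delta> \<pi> (G\<lparr>ptr := f x\<rparr>)"
    using G(1) walk_verts[OF p G(1) pgD(2)[OF G(1)]] by (simp add: pointed_graph_def)
  ultimately show ?thesis by (simp add: modulo_in_pgms)
qed

lemma imgraphs_pgms: "imgraphs \<Sigma> \<Delta> \<pi> \<subseteq> pgms (ilabels \<Sigma>) \<Delta> (iports \<pi>)"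
  unfolding imgraphs_def using attach_pgms repoint_pgms by blast

end

theory Submission
  imports Defs
begin

text \<open>On concrete graphs, the dynamics sends \<open>G\<close> with its trees to some \<open>H\<close> with its trees, by a
  bijection \<open>\<rho>\<close> of the vertices that does not depend on where \<open>G\<close> is pointed. The projection sends
  \<open>v\<close> to the visible vertex carrying \<open>\<rho> v\<close>, so shift-invariance is inherited at once.

  Continuity and boundedness need uniform bounds, which come from compactness: as labels and ports
  are finite, every sequence of graphs has a subsequence converging to a graph in the topology of
  disks, so that a quantity which is locally bounded is bounded. By continuity this applies to the
  depth in \<open>F(X)\<close> of its pointer, and to the distance from the pointer to the image of any given
  tree vertex. The first bound \<open>D\<close> makes the projected map on radius \<open>m\<close> a function of the original
  one on radius about \<open>m + 2D\<close>. For boundedness, quiescence forces the image of a deep tree vertex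
  to be invisible; hence every visible vertex of \<open>F(X)\<close> is the image of a vertex of bounded depth, and
  the second bound puts it near the image of the visible vertex carrying it.\<close>


section \<open>Vertices and finite observations of graphs modulo\<close>

text \<open>Compactness is available only for graphs without trees. Among invisible matter graphs
  the pointer can sink deeper and deeper, and such a sequence may converge to a graph with no
  visible vertex at all. Every uniform bound is therefore proved for \<open>X\<close> in
  \<open>pgms\<close> and reaches the trees through \<open>attach\<close>, which is continuous with
  no loss of radius. A vertex other than the pointer is treated by re-pointing first.

  The other obstacle is that continuity compares \<open>R\<close> on different graphs only through
  traces in disks, whereas the projection forgets the place of a vertex inside its tree. Words are
  what the two graphs have in common: the way from a tree vertex up to its carrier is a word, the
  label of its end tells whether it has become visible, and deleting the tree letters of a word
  gives the walk of the carriers. A disk of the image that is large enough to contain these climbs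
  therefore determines the projected disk and the projected traces.\<close>

definition paths_to :: "('v, 'p, 's, 'd) pgraph \<Rightarrow> 'v \<Rightarrow> 'p path set" where
  "paths_to G v = {w. walk G (ptr G) w v}"

lemma in_paths_to [simp]: "w \<in> paths_to G v \<longleftrightarrow> walk G (ptr G) w v"
  by (simp add: paths_to_def)

lemma walk_Nil_iff [simp]: "walk G u [] v \<longleftrightarrow> u = v"
  by (auto elim: walk.cases intro: walk.intros)

lemma walk_Cons_iff:
  "walk G u (l # w) v \<longleftrightarrow> (\<exists>x. {(u, fst l), (x, snd l)} \<in> edges G \<and> walk G x w v)"
  by (cases l) (auto elim: walk.cases intro: walk.intros)

lemma pointed_graph_ptr:
  "pointed_graph \<Sigma> \<Delta> \<pi> G \<Longrightarrow> v \<in> verts G \<Longrightarrow> pointed_graph \<Sigma> \<Delta> \<pi> (G\<lparr>ptr := v\<rparr>)"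
  by (simp add: pointed_graph_def)

lemma paths_to_nonempty:
  "pointed_graph \<Sigma> \<Delta> \<pi> G \<Longrightarrow> v \<in> verts G \<Longrightarrow> paths_to G v \<noteq> {}"
  using pgD(10)[OF _ pgD(2)] by (fastforce simp: paths_to_def)

lemma paths_to_obtain:
  assumes "pointed_graph \<Sigma> \<Delta> \<pi> G" "v \<in> verts G"
  obtains w where "walk G (ptr G) w v"
  using pgD(10)[OF assms(1) pgD(2)[OF assms(1)] assms(2)] by blast

text \<open>Ports determine walks, so a single shared path identifies two vertices. Equations
  between path sets thereby become equations between vertices.\<close>

lemma paths_to_inj:
  "pointed_graph \<Sigma> \<Delta> \<pi> G \<Longrightarrow> v \<in> verts G \<Longrightarrow> paths_to G v = paths_to G v' \<Longrightarrow> v = v'"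
  using paths_to_obtain walk_det by (metis in_paths_to)

lemma walk_ptr_verts: "pointed_graph \<Sigma> \<Delta> \<pi> G \<Longrightarrow> walk G (ptr G) w v \<Longrightarrow> v \<in> verts G"
  using walk_verts pgD(2) by metis

lemma iso_via_ptr_walk_iff:
  assumes f: "iso_via f G H" and G: "pointed_graph \<Sigma> \<Delta> \<pi> G"
    and H: "pointed_graph \<Sigma>' \<Delta>' \<pi>' H"
  shows "walk H (ptr H) w y \<longleftrightarrow> (\<exists>v. y = f v \<and> walk G (ptr G) w v)"
  using iso_via_walk_iff[OF f G H pgD(2)[OF G]] f by (simp add: iso_via_def)

section \<open>Operations on graphs modulo, computed on one representative\<close>

lemma modulo_repr:
  fixes G :: "('v, 'p, 's, 'd) pgraph"
  assumes G: "pointed_graph \<Sigma> \<Delta> \<pi> G"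
  obtains H :: "(nat, 'p, 's, 'd) pgraph" and f where "pointed_graph \<Sigma> \<Delta> \<pi> H"
    "iso_via f G H" "modulo G = modulo H"
  using ex_nat_representative[OF G] modulo_eq[OF _ G] by (auto simp: isomorphic_via)

lemma modulo_eq_iff:
  assumes G: "pointed_graph \<Sigma> \<Delta> \<pi> G" and H: "pointed_graph \<Sigma>' \<Delta>' \<pi>' H"
  shows "modulo G = modulo H \<longleftrightarrow> isomorphic G H"
proof
  assume eq: "modulo G = modulo H"
  obtain K where K: "K \<in> modulo G" using modulo_nonempty[OF G] by blast
  then have "isomorphic G K" "isomorphic H K" using eq by (auto simp: modulo_def)
  then show "isomorphic G H" using iso_trans iso_sym[OF _ H] by blast
qed (rule modulo_eq[OF _ G])

text \<open>An isomorphism matches the walks of two representatives word by word, so any one of them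
  decides \<open>vertex\<close>. The vertex type is arbitrary because graphs with trees and limit
  graphs do not live on \<open>nat\<close>.\<close>

lemma vertex_modulo:
  fixes G :: "('v, 'p, 's, 'd) pgraph"
  assumes G: "pointed_graph \<Sigma> \<Delta> \<pi> G"
  shows "vertex (modulo G) w = {w'. \<exists>v. walk G (ptr G) w v \<and> walk G (ptr G) w' v}" (is "?l = ?r")
proof
  show "?l \<subseteq> ?r"
  proof
    fix w' assume "w' \<in> ?l"
    then obtain H :: "(nat, 'p, 's, 'd) pgraph" and x where H: "pointed_graph UNIV UNIV UNIV H"
        "isomorphic G H"
      and x: "walk H (ptr H) w x" "walk H (ptr H) w' x"
      by (auto simp: vertex_def modulo_def)
    obtain f where "iso_via f H G" using iso_sym[OF H(2) G] by (auto simp: isomorphic_via)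
    then show "w' \<in> ?r" using iso_via_ptr_walk_iff[OF _ H(1) G] x by blast
  qed
  show "?r \<subseteq> ?l"
  proof
    fix w' assume w': "w' \<in> ?r"
    obtain H f where H: "pointed_graph UNIV UNIV UNIV H" "iso_via f G H" "H \<in> modulo G"
      using modulo_nonempty[OF G] by (auto simp: modulo_def isomorphic_via)
    then show "w' \<in> ?l" using w' iso_via_ptr_walk_iff[OF H(2) G H(1)] 
      unfolding vertex_def by blast
  qed
qed

lemma paths_vertex: "paths X = {w. w \<in> vertex X w}"
  by (auto simp: paths_def vertex_def)

lemma paths_modulo:
  "pointed_graph \<Sigma> \<Delta> \<pi> G \<Longrightarrow> paths (modulo G) = {w. \<exists>v. walk G (ptr G) w v}"
  by (simp add: paths_vertex vertex_modulo)

lemma vertex_modulo_walk: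
  assumes G: "pointed_graph \<Sigma> \<Delta> \<pi> G" and w: "walk G (ptr G) w v"
  shows "vertex (modulo G) w = paths_to G v"
  using walk_det[OF G w] w unfolding vertex_modulo[OF G] paths_to_def by blast

lemma V_modulo:
  assumes G: "pointed_graph \<Sigma> \<Delta> \<pi> G"
  shows "V (modulo G) = paths_to G ` verts G"
proof (intro equalityI subsetI)
  fix u assume "u \<in> V (modulo G)"
  then show "u \<in> paths_to G ` verts G"
    using vertex_modulo_walk[OF G] walk_ptr_verts[OF G] by (auto simp: V_def paths_modulo[OF G])
next
  fix u assume "u \<in> paths_to G ` verts G"
  then obtain v where v: "v \<in> verts G" "u = paths_to G v" by blast
  obtain w where w: "walk G (ptr G) w v" using paths_to_obtain[OF G v(1)] .
  then have "vertex (modulo G) w = u" using vertex_modulo_walk[OF G] v by simp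
  then show "u \<in> V (modulo G)" using w unfolding V_def paths_modulo[OF G] by blast
qed

text \<open>One path fixes its end, so nonempty subsets of the path sets suffice. This generality
  serves \<open>bounded\<close>, where the second vertex belongs to a disk and consists only of the
  paths that stay inside it.\<close>

lemma cat_modulo:
  assumes G: "pointed_graph \<Sigma> \<Delta> \<pi> G" and u: "U \<subseteq> paths_to G u" "U \<noteq> {}"
    and v: "W \<subseteq> paths_to (G\<lparr>ptr := u\<rparr>) v" "W \<noteq> {}"
  shows "cat (modulo G) U W = paths_to G v"
proof -
  have "vertex (modulo G) (w @ w') = paths_to G v" if "w \<in> U" "w' \<in> W" for w w'
  proof -
    have "walk G (ptr G) w u" "walk G u w' v" using that u v by (auto simp: paths_to_def)
    then show ?thesis using vertex_modulo_walk[OF G] walk_append by metis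
  qed
  then have "cat (modulo G) U W = (\<Union>w\<in>U. \<Union>w'\<in>W. paths_to G v)"
    unfolding cat_def by (intro SUP_cong refl) simp
  then show ?thesis using u v by auto
qed

lemma disk_modulo_any:
  fixes G :: "('v, 'p, 's, 'd) pgraph"
  assumes G: "pointed_graph \<Sigma> \<Delta> \<pi> G"
  shows "disk n (modulo G) = modulo (gdisk n G)"
proof -
  obtain H :: "(nat, 'p, 's, 'd) pgraph" and f
    where H: "pointed_graph \<Sigma> \<Delta> \<pi> H" "iso_via f G H" "modulo G = modulo H"
    using modulo_repr[OF G] .
  then have "isomorphic (gdisk n G) (gdisk n H)" using gdisk_iso[OF _ G] isomorphic_via by metis
  then show ?thesis
    using H disk_modulo[OF H(1)] modulo_eq[OF _ pointed_graph_gdisk[OF G]] by metis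
qed

lemma repoint_modulo_any:
  fixes G :: "('v, 'p, 's, 'd) pgraph"
  assumes G: "pointed_graph \<Sigma> \<Delta> \<pi> G" and v: "v \<in> verts G"
  shows "repoint (modulo G) (paths_to G v) = modulo (G\<lparr>ptr := v\<rparr>)"
proof -
  obtain H :: "(nat, 'p, 's, 'd) pgraph" and f
    where H: "pointed_graph \<Sigma> \<Delta> \<pi> H" and f: "iso_via f G H" and eq: "modulo G = modulo H"
    using modulo_repr[OF G] .
  obtain w where w: "walk G (ptr G) w v" using paths_to_obtain[OF G v] .
  then have fw: "walk H (ptr H) w (f v)" using iso_via_ptr_walk_iff[OF f G H] by blast
  have p: "paths_to G v = vertex (modulo H) w" using vertex_modulo_walk[OF G w] eq by simp
  have "repoint (modulo H) (paths_to G v) = modulo (H\<lparr>ptr := f v\<rparr>)"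
    using repoint_modulo[OF H fw _ paths_to_nonempty[OF G v]] p by simp
  moreover have "iso_via f (G\<lparr>ptr := v\<rparr>) (H\<lparr>ptr := f v\<rparr>)" using f by (simp add: iso_via_def)
  then have "modulo (G\<lparr>ptr := v\<rparr>) = modulo (H\<lparr>ptr := f v\<rparr>)"
    using modulo_eq[OF _ pointed_graph_ptr[OF G v]] isomorphic_via by blast
  ultimately show ?thesis using eq by simp
qed

section \<open>Disks and traces\<close>

lemma ptr_gdisk [simp]: "ptr (gdisk n G) = ptr G"
  by (simp add: gdisk_def)

text \<open>A walk inside the disk is a walk of \<open>G\<close> and ends at the same vertex there.
  So a trace is itself a vertex of the disk, and traces taken in two graphs are comparable once the
  disks are equal.\<close>

lemma trace_modulo:
  assumes G: "pointed_graph \<Sigma> \<Delta> \<pi> G"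
  shows "trace n (modulo G) (paths_to G v) = paths_to (gdisk n G) v"
proof -
  have "walk (gdisk n G) (ptr G) w v \<longleftrightarrow> walk G (ptr G) w v \<and> (\<exists>x. walk (gdisk n G) (ptr G) w x)"
      for w
    using walk_gdisk_imp walk_det[OF G] by metis
  then show ?thesis
    unfolding trace_def disk_modulo_any[OF G] paths_modulo[OF pointed_graph_gdisk[OF G]]
        paths_to_def
    by auto
qed

lemma walk_gdisk_short:
  "walk G (ptr G) w v \<Longrightarrow> length w \<le> n + 1 \<Longrightarrow> walk (gdisk n G) (ptr G) w v"
  using walk_gdisk[of G "ptr G" w v "[]"] by simp

text \<open>The bound is \<open>n + 1\<close> because a disk of radius n retains the vertices one
  step beyond the radius.\<close>

lemma trace_nonempty_iff:
  assumes G: "pointed_graph \<Sigma> \<Delta> \<pi> G"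
  shows "trace n (modulo G) (paths_to G v) \<noteq> {} \<longleftrightarrow> (\<exists>w. length w \<le> n + 1 \<and> walk G (ptr G) w v)"
proof
  assume "trace n (modulo G) (paths_to G v) \<noteq> {}"
  then obtain w where "walk (gdisk n G) (ptr G) w v"
    unfolding trace_modulo[OF G] by (auto simp: paths_to_def)
  then have "v \<in> verts (gdisk n G)"
    using walk_ptr_verts[OF pointed_graph_gdisk[OF G]] by simp
  then show "\<exists>w. length w \<le> n + 1 \<and> walk G (ptr G) w v" by (auto simp: gdisk_def ball_def)
next
  assume "\<exists>w. length w \<le> n + 1 \<and> walk G (ptr G) w v"
  then show "trace n (modulo G) (paths_to G v) \<noteq> {}"
    using walk_gdisk_short[of G] unfolding trace_modulo[OF G] by (fastforce simp: paths_to_def)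
qed

text \<open>Finite observations of a pointed graph from its pointer: all of them determine its isomorphism
  class, those of bounded size a disk. \<open>ELab w a b d\<close> concerns the edge leaving the end of \<open>w\<close> by
  port \<open>a\<close> and arriving by port \<open>b\<close>.\<close>

datatype ('p, 's, 'd) fact = Same "'p path" "'p path" | VLab "'p path" 's | ELab "'p path" 'p 'p 'd

fun fact_size :: "('p, 's, 'd) fact \<Rightarrow> nat" where
  "fact_size (Same w w') = max (length w) (length w')"
| "fact_size (VLab w s) = length w"
| "fact_size (ELab w a b d) = Suc (length w)"

fun holds :: "('v, 'p, 's, 'd) pgraph \<Rightarrow> ('p, 's, 'd) fact \<Rightarrow> bool" where
  "holds G (Same w w') \<longleftrightarrow> (\<exists>v. walk G (ptr G) w v \<and> walk G (ptr G) w' v)"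
| "holds G (VLab w s) \<longleftrightarrow> (\<exists>v. walk G (ptr G) w v \<and> vlab G v = Some s)"
| "holds G (ELab w a b d) \<longleftrightarrow> (\<exists>u v. walk G (ptr G) w u \<and> {(u, a), (v, b)} \<in> edges G \<and>
     elab G {(u, a), (v, b)} = Some d)"

definition agree :: "nat \<Rightarrow> ('v, 'p, 's, 'd) pgraph \<Rightarrow> ('w, 'p, 's, 'd) pgraph \<Rightarrow> bool" where
  "agree n G H \<longleftrightarrow> (\<forall>x. fact_size x \<le> n \<longrightarrow> (holds G x \<longleftrightarrow> holds H x))"

lemma agree_mono: "agree n G H \<Longrightarrow> k \<le> n \<Longrightarrow> agree k G H"
  by (simp add: agree_def)

lemma agreeD: "agree n G H \<Longrightarrow> fact_size x \<le> n \<Longrightarrow> holds G x \<longleftrightarrow> holds H x"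
  by (simp add: agree_def)

lemma iso_via_edge:
  assumes "iso_via f G H" and "{(u, a), (v, b)} \<in> edges G"
  shows "{(f u, a), (f v, b)} \<in> edges H"
    and "elab H {(f u, a), (f v, b)} = elab G {(u, a), (v, b)}"
proof -
  have "rename_edge f {(u, a), (v, b)} = {(f u, a), (f v, b)}" by simp
  moreover have "rename_edge f {(u, a), (v, b)} \<in> edges H"
    "elab H (rename_edge f {(u, a), (v, b)}) = elab G {(u, a), (v, b)}"
    using assms unfolding iso_via_def by (blast, metis)
  ultimately show "{(f u, a), (f v, b)} \<in> edges H"
    "elab H {(f u, a), (f v, b)} = elab G {(u, a), (v, b)}" by simp_all
qed

lemma holds_iso_imp:
  assumes f: "iso_via f G H" and G: "pointed_graph \<Sigma> \<Delta> \<pi> G" and h: "holds G x"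
  shows "holds H x"
proof -
  have p: "ptr H = f (ptr G)" using f by (simp add: iso_via_def)
  note w = iso_via_walk[OF f, of "ptr G", folded p]
  show ?thesis
  proof (cases x)
    case (Same w1 w2) then show ?thesis using h w by auto
  next
    case (VLab w1 s)
    then obtain v where "walk G (ptr G) w1 v" "vlab G v = Some s" using h by auto
    moreover from this have "vlab H (f v) = Some s"
      using f walk_ptr_verts[OF G] by (simp add: iso_via_def)
    ultimately show ?thesis using w VLab by auto
  next
    case (ELab w1 a b d)
    then obtain u v where "walk G (ptr G) w1 u" "{(u, a), (v, b)} \<in> edges G"
      "elab G {(u, a), (v, b)} = Some d" using h by auto
    then show ?thesis using w iso_via_edge[OF f] ELab by (metis holds.simps(3))
  qed
qed

lemma holds_iso:
  assumes "isomorphic G H" and G: "pointed_graph \<Sigma> \<Delta> \<pi> G" and H: "pointed_graph \<Sigma>' \<Delta>' \<pi>' H"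
  shows "holds G x \<longleftrightarrow> holds H x"
proof -
  obtain f g where "iso_via f G H" "iso_via g H G"
    using assms(1) iso_sym[OF assms(1) G] unfolding isomorphic_via by blast
  then show ?thesis using holds_iso_imp G H by metis
qed

section \<open>Facts observed inside a disk\<close>

lemma in_ball_iff:
  assumes G: "pointed_graph \<Sigma> \<Delta> \<pi> G" and w: "walk G (ptr G) w v"
  shows "v \<in> ball G n \<longleftrightarrow> (\<exists>w'. length w' \<le> n \<and> holds G (Same w w'))"
  unfolding ball_def mem_Collect_eq holds.simps using walk_det[OF G w] w by blast

lemma walk_gdisk_ball:
  assumes G: "pointed_graph \<Sigma> \<Delta> \<pi> G" and w: "length w \<le> n + 1"
  shows "walk (gdisk n G) (ptr G) w v \<longleftrightarrow> walk G (ptr G) w v"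
  using walk_gdisk_short[OF _ w] walk_gdisk_imp by metis

lemma holds_gdisk_VLab:
  assumes G: "pointed_graph \<Sigma> \<Delta> \<pi> G" and w: "length w \<le> n + 1"
  shows "holds (gdisk n G) (VLab w s) \<longleftrightarrow>
    holds G (VLab w s) \<and> (\<exists>w'. length w' \<le> n \<and> holds G (Same w w'))"
proof -
  have "holds (gdisk n G) (VLab w s) \<longleftrightarrow> (\<exists>v. walk G (ptr G) w v \<and> v \<in> ball G n \<and> vlab G v = Some s)"
    unfolding holds.simps ptr_gdisk walk_gdisk_ball[OF G w]
    by (auto simp: gdisk_def restrict_map_def split: if_splits)
  also have "\<dots> \<longleftrightarrow> holds G (VLab w s) \<and> (\<exists>w'. length w' \<le> n \<and> holds G (Same w w'))"
    using in_ball_iff[OF G, of w _ n] walk_det[OF G, of "ptr G" w] unfolding holds.simps(2) by metis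
  finally show ?thesis .
qed

lemma holds_gdisk_ELab:
  assumes G: "pointed_graph \<Sigma> \<Delta> \<pi> G" and w: "length w \<le> n + 1"
  shows "holds (gdisk n G) (ELab w a b d) \<longleftrightarrow>
    holds G (ELab w a b d) \<and> (\<exists>w'. length w' \<le> n \<and> holds G (Same w w')) \<and>
    (\<exists>w'. length w' \<le> n \<and> holds G (Same (w @ [(a, b)]) w'))" (is "_ = ?r")
proof -
  have bm: "ball G n \<subseteq> ball G (n + 1)" by (rule ball_mono) simp
  have "holds (gdisk n G) (ELab w a b d) \<longleftrightarrow> (\<exists>u v. walk G (ptr G) w u \<and>
      u \<in> ball G n \<and> v \<in> ball G n \<and> {(u, a), (v, b)} \<in> edges G \<and> elab G {(u, a), (v, b)} = Some d)"
    unfolding holds.simps ptr_gdisk walk_gdisk_ball[OF G w]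
    using bm by (auto simp: gdisk_def restrict_map_def split: if_splits)
  also have "\<dots> \<longleftrightarrow> ?r"
  proof
    assume "\<exists>u v. walk G (ptr G) w u \<and> u \<in> ball G n \<and> v \<in> ball G n \<and>
      {(u, a), (v, b)} \<in> edges G \<and> elab G {(u, a), (v, b)} = Some d"
    then obtain u v where u: "walk G (ptr G) w u" "u \<in> ball G n" and v: "v \<in> ball G n"
      and e: "{(u, a), (v, b)} \<in> edges G" "elab G {(u, a), (v, b)} = Some d" by blast
    have "walk G (ptr G) (w @ [(a, b)]) v" using u e by (intro walk_append walk_single)
    then show ?r using u v e in_ball_iff[OF G] by (metis holds.simps(3))
  next
    assume r: ?r
    then obtain u v where u: "walk G (ptr G) w u"
      and e: "{(u, a), (v, b)} \<in> edges G" "elab G {(u, a), (v, b)} = Some d" by auto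
    have "walk G (ptr G) (w @ [(a, b)]) v" using u e by (intro walk_append walk_single)
    then have "u \<in> ball G n" "v \<in> ball G n" using r u in_ball_iff[OF G] by blast+
    then show "\<exists>u v. walk G (ptr G) w u \<and> u \<in> ball G n \<and> v \<in> ball G n \<and>
      {(u, a), (v, b)} \<in> edges G \<and> elab G {(u, a), (v, b)} = Some d" using u e by blast
  qed
  finally show ?thesis .
qed

text \<open>The size of an edge-label fact counts the edge itself, so size at most n puts both ends
  within distance n, where the disk still keeps labels.\<close>

lemma holds_gdisk:
  assumes G: "pointed_graph \<Sigma> \<Delta> \<pi> G" and x: "fact_size x \<le> n"
  shows "holds (gdisk n G) x \<longleftrightarrow> holds G x"
proof (cases x)
  case (Same w w')
  then show ?thesis using x by (auto simp: walk_gdisk_ball[OF G])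
next
  case (VLab w s)
  then have "length w \<le> n" using x by simp
  then show ?thesis unfolding VLab by (subst holds_gdisk_VLab[OF G]) auto
next
  case (ELab w a b d)
  then have l: "length w \<le> n" "length (w @ [(a, b)]) \<le> n" using x by simp_all
  have "holds G (Same w w) \<and> holds G (Same (w @ [(a, b)]) (w @ [(a, b)]))"
      if "holds G (ELab w a b d)"
    using that by (auto simp: walk_append_iff intro: walk_single)
  moreover have "length w \<le> n + 1" using l by simp
  ultimately show ?thesis using l holds_gdisk_ELab[OF G] unfolding ELab by metis
qed

lemma agree_if_disk_eq:
  assumes G: "pointed_graph \<Sigma> \<Delta> \<pi> G" and H: "pointed_graph \<Sigma>' \<Delta>' \<pi>' H"
    and eq: "disk n (modulo G) = disk n (modulo H)"
  shows "agree n G H"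
proof -
  note Gn = pointed_graph_gdisk[OF G] and Hn = pointed_graph_gdisk[OF H]
  have "isomorphic (gdisk n G) (gdisk n H)"
    using eq modulo_eq_iff[OF Gn Hn] disk_modulo_any[OF G] disk_modulo_any[OF H] by metis
  then show ?thesis
    using holds_iso[OF _ Gn Hn] holds_gdisk[OF G] holds_gdisk[OF H] unfolding agree_def by metis
qed

section \<open>Isomorphisms and equal disks obtained from facts\<close>

lemma edge_ends:
  assumes G: "pointed_graph \<Sigma> \<Delta> \<pi> G" and e: "e \<in> edges G"
  obtains u a v b where "e = {(u, a), (v, b)}" "u \<in> verts G" "v \<in> verts G"
proof -
  obtain x y where "e = {x, y}" using pgD(3)[OF G e] by (auto simp: card_2_iff)
  moreover have "e \<subseteq> verts G \<times> \<pi>" by (rule pgD(4)[OF G e])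
  ultimately show ?thesis using that by (cases x; cases y) auto
qed

lemma edge_det:
  assumes G: "pointed_graph \<Sigma> \<Delta> \<pi> G" and "{(u, a), (v, b)} \<in> edges G" "{(u, a), (v', b')} \<in> edges G"
  shows "v' = v" "b' = b"
proof -
  have "{(u, a), (v, b)} = {(u, a), (v', b')}"
    by (rule pgD(5)[OF G assms(2,3)]) simp
  then have "(v', b') = (v, b)" by (auto simp: doubleton_eq_iff)
  then show "v' = v" "b' = b" by simp_all
qed

text \<open>Edges are observed through \<open>Same\<close>: an edge is the coincidence of a
  one-letter extension of one word with another word.\<close>

lemma holds_Same_snoc:
  assumes G: "pointed_graph \<Sigma> \<Delta> \<pi> G" and "walk G (ptr G) w u" "walk G (ptr G) w' v"
  shows "holds G (Same (w @ [(a, b)]) w') \<longleftrightarrow> {(u, a), (v, b)} \<in> edges G"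
proof
  assume "holds G (Same (w @ [(a, b)]) w')"
  then obtain u' v' where "walk G (ptr G) w u'" "{(u', a), (v', b)} \<in> edges G" "walk G (ptr G) w'
      v'"
    by (auto simp: walk_append_iff walk_Cons_iff)
  moreover have "u' = u" "v' = v" using calculation walk_det[OF G] assms by metis+
  ultimately show "{(u, a), (v, b)} \<in> edges G" by simp
qed (use assms walk_append[OF _ walk_single] in fastforce)

lemma holds_VLab:
  assumes G: "pointed_graph \<Sigma> \<Delta> \<pi> G" and w: "walk G (ptr G) w v"
  shows "holds G (VLab w s) \<longleftrightarrow> vlab G v = Some s"
  unfolding holds.simps using walk_det[OF G w] w by blast

lemma holds_ELab:
  assumes G: "pointed_graph \<Sigma> \<Delta> \<pi> G" and w: "walk G (ptr G) w u"
    and e: "{(u, a), (v, b)} \<in> edges G"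
  shows "holds G (ELab w a b d) \<longleftrightarrow> elab G {(u, a), (v, b)} = Some d"
  unfolding holds.simps using walk_det[OF G w] edge_det(1)[OF G e] w e by blast

text \<open>Vertices reached by the same word are matched. Agreement on \<open>Same\<close> makes
  the matching well defined and injective, and agreement on one-letter extensions makes it respect
  edges. As \<open>W\<close> has only to cover the vertices, one argument serves whole graphs, with
  all words, and disks, with words of length at most \<open>n + 1\<close>.\<close>

lemma isomorphic_by_words:
  fixes K :: "('v, 'p, 's, 'd) pgraph" and L :: "('w, 'p, 's, 'd) pgraph"
  assumes K: "pointed_graph \<Sigma> \<Delta> \<pi> K" and L: "pointed_graph \<Sigma>' \<Delta>' \<pi>' L"
    and covK: "\<And>v. v \<in> verts K \<Longrightarrow> \<exists>w\<in>W. walk K (ptr K) w v"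
    and covL: "\<And>v. v \<in> verts L \<Longrightarrow> \<exists>w\<in>W. walk L (ptr L) w v"
    and nil: "[] \<in> W"
    and S: "\<And>w w'. w \<in> W \<Longrightarrow> w' \<in> W \<Longrightarrow> holds K (Same w w') \<longleftrightarrow> holds L (Same w w')"
    and E: "\<And>w w' l. w \<in> W \<Longrightarrow> w' \<in> W \<Longrightarrow> holds K (Same (w @ [l]) w') \<longleftrightarrow> holds L (Same (w @ [l]) w')"
    and VL: "\<And>w s. w \<in> W \<Longrightarrow> holds K (VLab w s) \<longleftrightarrow> holds L (VLab w s)"
    and EL: "\<And>w a b d. w \<in> W \<Longrightarrow> holds K (ELab w a b d) \<longleftrightarrow> holds L (ELab w a b d)"
  shows "isomorphic K L"
proof -
  note dK = walk_det[OF K] and dL = walk_det[OF L]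
  define f where "f v = (THE x. \<exists>w\<in>W. walk K (ptr K) w v \<and> walk L (ptr L) w x)" for v
  have f: "walk L (ptr L) w (f v)" if w: "w \<in> W" "walk K (ptr K) w v" for w v
  proof -
    have "holds L (Same w w)" using S[OF w(1) w(1)] w(2) by auto
    then obtain x where x: "walk L (ptr L) w x" by auto
    have "f v = x" unfolding f_def
    proof (rule the_equality)
      fix y assume "\<exists>w\<in>W. walk K (ptr K) w v \<and> walk L (ptr L) w y"
      then obtain w' where w': "w' \<in> W" "walk K (ptr K) w' v" "walk L (ptr L) w' y" by blast
      have "holds L (Same w w')" using S[OF w(1) w'(1)] w(2) w'(2) by auto
      then show "y = x" using dL w'(3) x by (metis holds.simps(1))
    qed (use w x in blast)
    then show ?thesis using x by simp
  qed
  have pre: "\<exists>v. walk K (ptr K) w v \<and> f v = x" if w: "w \<in> W" "walk L (ptr L) w x" for w x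
  proof -
    have "holds K (Same w w)" using S[OF w(1) w(1)] w(2) by auto
    then obtain v where "walk K (ptr K) w v" by auto
    then show ?thesis using f[OF w(1)] dL w(2) by blast
  qed
  have edge: "{(u, a), (v, b)} \<in> edges K \<longleftrightarrow> {(f u, a), (f v, b)} \<in> edges L"
    if uv: "u \<in> verts K" "v \<in> verts K" for u v a b
  proof -
    obtain w w' where w: "w \<in> W" "walk K (ptr K) w u" and w': "w' \<in> W" "walk K (ptr K) w' v"
      using covK uv by blast
    show ?thesis
      using holds_Same_snoc[OF K w(2) w'(2)] holds_Same_snoc[OF L f[OF w] f[OF w']] E[OF w(1) w'(1)]
      by blast
  qed
  have inj: "inj_on f (verts K)"
  proof (rule inj_onI)
    fix u v assume uv: "u \<in> verts K" "v \<in> verts K" "f u = f v"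
    obtain w w' where w: "w \<in> W" "walk K (ptr K) w u" and w': "w' \<in> W" "walk K (ptr K) w' v"
      using covK uv by blast
    have "holds L (Same w w')" using f[OF w] f[OF w'] uv by auto
    then have "holds K (Same w w')" using S[OF w(1) w'(1)] by simp
    then show "u = v" using dK w w' by (metis holds.simps(1))
  qed
  have im: "f ` verts K = verts L"
  proof (intro equalityI subsetI)
    fix x assume "x \<in> f ` verts K"
    then obtain v w where "x = f v" "w \<in> W" "walk K (ptr K) w v" using covK by blast
    then show "x \<in> verts L" using f walk_ptr_verts[OF L] by blast
  next
    fix x assume "x \<in> verts L"
    then show "x \<in> f ` verts K" using covL pre walk_ptr_verts[OF K] by blast
  qed
  have ren: "rename_edge f {(u, a), (v, b)} = {(f u, a), (f v, b)}" for u v a b by simp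
  have "iso_via f K L" unfolding iso_via_def
  proof (intro conjI ballI)
    show "bij_betw f (verts K) (verts L)" using inj im by (simp add: bij_betw_def)
    show "f (ptr K) = ptr L" using f[OF nil, of "ptr K"] by simp
    show "edges L = rename_edge f ` edges K"
    proof (intro equalityI subsetI)
      fix e assume e: "e \<in> edges L"
      obtain x a y b where xy: "e = {(x, a), (y, b)}" "x \<in> verts L" "y \<in> verts L"
        using edge_ends[OF L e] .
      then obtain u v where uv: "u \<in> verts K" "v \<in> verts K" "x = f u" "y = f v"
        using im by blast
      then have "{(u, a), (v, b)} \<in> edges K" using edge e xy by simp
      then show "e \<in> rename_edge f ` edges K" using ren xy uv by (metis image_eqI)
    next
      fix e assume "e \<in> rename_edge f ` edges K"
      then obtain e' where e: "e = rename_edge f e'" "e' \<in> edges K" by blast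
      obtain u a v b where uv: "e' = {(u, a), (v, b)}" "u \<in> verts K" "v \<in> verts K"
        using edge_ends[OF K e(2)] .
      then show "e \<in> edges L" using e edge ren by metis
    qed
    fix v assume "v \<in> verts K"
    then obtain w where w: "w \<in> W" "walk K (ptr K) w v" using covK by blast
    have "vlab K v = Some s \<longleftrightarrow> vlab L (f v) = Some s" for s
      using VL[OF w(1)] holds_VLab[OF K w(2)] holds_VLab[OF L f[OF w]] by blast
    then show "vlab L (f v) = vlab K v" by (metis option.exhaust)
  next
    fix e assume e: "e \<in> edges K"
    obtain u a v b where uv: "e = {(u, a), (v, b)}" "u \<in> verts K" "v \<in> verts K"
      using edge_ends[OF K e] .
    obtain w where w: "w \<in> W" "walk K (ptr K) w u" using covK uv by blast
    have eK: "{(u, a), (v, b)} \<in> edges K" and eL: "{(f u, a), (f v, b)} \<in> edges L"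
      using e uv edge by blast+
    have "elab K e = Some d \<longleftrightarrow> elab L (rename_edge f e) = Some d" for d
      unfolding uv(1) ren
      using EL[OF w(1)] holds_ELab[OF K w(2) eK] holds_ELab[OF L f[OF w] eL] by blast
    then show "elab L (rename_edge f e) = elab K e" by (metis option.exhaust)
  qed
  then show ?thesis unfolding isomorphic_via by blast
qed

lemma isomorphic_if_agree:
  assumes G: "pointed_graph \<Sigma> \<Delta> \<pi> G" and H: "pointed_graph \<Sigma>' \<Delta>' \<pi>' H"
    and "\<And>n. agree n G H"
  shows "isomorphic G H"
proof -
  have "holds G x \<longleftrightarrow> holds H x" for x using assms(3)[of "fact_size x"] by (simp add: agree_def)
  moreover have "\<exists>w\<in>UNIV. walk G (ptr G) w v" if "v \<in> verts G" for v
    using paths_to_obtain[OF G that] by blast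
  moreover have "\<exists>w\<in>UNIV. walk H (ptr H) w v" if "v \<in> verts H" for v
    using paths_to_obtain[OF H that] by blast
  ultimately show ?thesis by (intro isomorphic_by_words[OF G H,
      where W = UNIV]) (simp_all del: holds.simps)
qed

lemma holds_gdisk_Same:
  assumes "length w \<le> n + 1" "length w' \<le> n + 1"
  shows "holds (gdisk n K) (Same w w') \<longleftrightarrow> holds K (Same w w')"
  using assms walk_gdisk_short walk_gdisk_imp by (metis holds.simps(1) ptr_gdisk)

lemma holds_gdisk_Same_snoc:
  assumes w: "length w \<le> n + 1" "length w' \<le> n + 1"
  shows "holds (gdisk n K) (Same (w @ [l]) w') \<longleftrightarrow> holds K (Same (w @ [l]) w')"
proof
  assume "holds (gdisk n K) (Same (w @ [l]) w')"
  then show "holds K (Same (w @ [l]) w')" using walk_gdisk_imp by fastforce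
next
  assume "holds K (Same (w @ [l]) w')"
  then obtain u v where u: "walk K (ptr K) w u" and e: "{(u, fst l), (v, snd l)} \<in> edges K"
    and v: "walk K (ptr K) w' v"
    by (auto simp: walk_append_iff walk_Cons_iff)
  then have "u \<in> ball K (n + 1)" "v \<in> ball K (n + 1)" using w by (auto simp: ball_def)
  then have "{(u, fst l), (v, snd l)} \<in> edges (gdisk n K)" using e by (simp add: gdisk_def)
  then show "holds (gdisk n K) (Same (w @ [l]) w')"
    using walk_gdisk_short[OF u w(1)] walk_gdisk_short[OF v w(2)]
    by (auto simp: walk_append_iff walk_Cons_iff)
qed

lemma gdisk_cover:
  assumes "v \<in> verts (gdisk n K)"
  shows "\<exists>w\<in>{w. length w \<le> n + 1}. walk (gdisk n K) (ptr (gdisk n K)) w v"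
  using assms walk_gdisk_short[of K] by (fastforce simp: gdisk_def ball_def)

text \<open>The offset 2 comes from edges between outermost vertices: these lie at distance
  \<open>n + 1\<close>, and testing an edge takes one more letter.\<close>

lemma disk_eq_if_agree:
  fixes G :: "('v, 'p, 's, 'd) pgraph" and H :: "('w, 'p, 's, 'd) pgraph"
  assumes G: "pointed_graph \<Sigma> \<Delta> \<pi> G" and H: "pointed_graph \<Sigma>' \<Delta>' \<pi>' H"
    and A: "agree (n + 2) G H"
  shows "disk n (modulo G) = disk n (modulo H)"
proof -
  note Gn = pointed_graph_gdisk[OF G] and Hn = pointed_graph_gdisk[OF H]
  note ag = agreeD[OF A]
  have sameGH: "holds G (Same w w') \<longleftrightarrow> holds H (Same w w')"
    if "length w \<le> n + 2" "length w' \<le> n + 2" for w w' :: "'p path" using that by (intro ag) simp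
  have ballGH: "(\<exists>w'. length w' \<le> n \<and> holds G (Same w w')) \<longleftrightarrow>
      (\<exists>w'. length w' \<le> n \<and> holds H (Same w w'))" if "length w \<le> n + 2" for w :: "'p path"
    using sameGH[OF that] by (meson le_add1 le_trans)
  have "isomorphic (gdisk n G) (gdisk n H)"
  proof (rule isomorphic_by_words[OF Gn Hn, where W = "{w. length w \<le> n + 1}"])
    fix w w' :: "'p path" and l assume "w \<in> {w. length w \<le> n + 1}" "w' \<in> {w. length w \<le> n + 1}"
    then have l: "length w \<le> n + 1" "length w' \<le> n + 1" by simp_all
    show "holds (gdisk n G) (Same w w') = holds (gdisk n H) (Same w w')"
      unfolding holds_gdisk_Same[OF l] using l by (intro sameGH) simp_all
    show "holds (gdisk n G) (Same (w @ [l]) w') = holds (gdisk n H) (Same (w @ [l]) w')"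
      unfolding holds_gdisk_Same_snoc[OF l] using l by (intro sameGH) simp_all
  next
    fix w :: "'p path" and a b d s assume "w \<in> {w. length w \<le> n + 1}"
    then have l: "length w \<le> n + 1" by simp
    show "holds (gdisk n G) (VLab w s) = holds (gdisk n H) (VLab w s)"
      unfolding holds_gdisk_VLab[OF G l] holds_gdisk_VLab[OF H l]
      using l ag[of "VLab w s"] ballGH[of w] by simp
    show "holds (gdisk n G) (ELab w a b d) = holds (gdisk n H) (ELab w a b d)"
      unfolding holds_gdisk_ELab[OF G l] holds_gdisk_ELab[OF H l]
      using l ag[of "ELab w a b d"] ballGH[of w] ballGH[of "w @ [(a, b)]"] by simp
  qed (use gdisk_cover in auto)
  then show ?thesis
    using modulo_eq_iff[OF Gn Hn] disk_modulo_any[OF G] disk_modulo_any[OF H] by metis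
qed

lemma gdisk_gdisk_le:
  fixes G :: "('v, 'p, 's, 'd) pgraph"
  assumes "k \<le> n" shows "gdisk k (gdisk n G) = gdisk k G"
proof -
  have b: "ball (gdisk n G) (k + 1) = ball G (k + 1)" "ball (gdisk n G) k = ball G k"
    using assms by (simp_all add: ball_gdisk)
  have s: "ball G (k + 1) \<subseteq> ball G (n + 1)" "ball G k \<subseteq> ball G n"
    using assms by (simp_all add: ball_mono)
  have e: "e \<subseteq> ball G k \<times> UNIV \<Longrightarrow> e \<subseteq> ball G n \<times> UNIV"
    "e \<subseteq> ball G (k + 1) \<times> UNIV \<Longrightarrow> e \<subseteq> ball G (n + 1) \<times> UNIV" for e :: "('v \<times> 'p) set"
    using s by blast+
  then have "{e \<in> {e \<in> edges G. e \<subseteq> ball G (n + 1) \<times> UNIV}. e \<subseteq> ball G (k + 1) \<times> UNIV}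
      = {e \<in> edges G. e \<subseteq> ball G (k + 1) \<times> UNIV}"
    "{e :: ('v \<times> 'p) set. e \<subseteq> ball G n \<times> UNIV} \<inter> {e. e \<subseteq> ball G k \<times> UNIV} =
      {e. e \<subseteq> ball G k \<times> UNIV}"
    "ball G n \<inter> ball G k = ball G k" using s(2) by blast+
  then show ?thesis
    unfolding gdisk_def[of k "gdisk n G"] b unfolding gdisk_def
        by (simp only: pgraph.simps restrict_restrict)
qed

lemma disk_disk_le:
  assumes G: "pointed_graph \<Sigma> \<Delta> \<pi> G" and "k \<le> n"
  shows "disk k (disk n (modulo G)) = disk k (modulo G)"
  using disk_modulo_any[OF G] disk_modulo_any[OF pointed_graph_gdisk[OF G]]
    gdisk_gdisk_le[OF assms(2)] by metis

lemma disk_eq_mono: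
  assumes "pointed_graph \<Sigma> \<Delta> \<pi> G" and "pointed_graph \<Sigma>' \<Delta>' \<pi>' H"
    and "disk n (modulo G) = disk n (modulo H)" and "k \<le> n"
  shows "disk k (modulo G) = disk k (modulo H)"
  using assms disk_disk_le by metis


section \<open>Compactness\<close>

lemma walk_letters:
  assumes G: "pointed_graph \<Sigma> \<Delta> \<pi> G"
  shows "walk G u w v \<Longrightarrow> set w \<subseteq> \<pi> \<times> \<pi>"
proof (induction rule: walk.induct)
  case (walk_Cons u a v b w x)
  then show ?case using pgD(4)[OF G walk_Cons.hyps(1)] by auto
qed simp

text \<open>Here finiteness of labels and ports enters compactness: with finitely many letters and
  labels, the facts of each size admit only finitely many patterns, and a pigeonhole argument
  applies.\<close>

lemma finite_short_facts:
  assumes "finite \<Sigma>" "finite \<Delta>" "finite \<pi>"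
  shows "finite {x. fact_size x \<le> n \<and> (\<exists>G :: ('v, 'p, 's, 'd) pgraph. pointed_graph \<Sigma> \<Delta> \<pi> G \<and>
      holds G x)}"
proof -
  let ?W = "{w. set w \<subseteq> \<pi> \<times> \<pi> \<and> length w \<le> n}"
  have W: "finite ?W" using assms by (intro finite_lists_length_le) simp
  have lab: "s \<in> \<Sigma>" if "pointed_graph \<Sigma> \<Delta> \<pi> G" "vlab G v = Some s"
    for G :: "('v, 'p, 's, 'd) pgraph" and v s
    using pgD(7)[OF that(1)] that(2) by (auto intro: ranI)
  have elab: "d \<in> \<Delta>" if "pointed_graph \<Sigma> \<Delta> \<pi> G" "elab G e = Some d"
    for G :: "('v, 'p, 's, 'd) pgraph" and e d
    using pgD(9)[OF that(1)] that(2) by (auto intro: ranI)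
  have sub: "{x. fact_size x \<le> n \<and> (\<exists>G :: ('v, 'p, 's, 'd) pgraph. pointed_graph \<Sigma> \<Delta> \<pi> G \<and>
      holds G x)} \<subseteq>
      (\<lambda>(w, w'). Same w w') ` (?W \<times> ?W) \<union> (\<lambda>(w, s). VLab w s) ` (?W \<times> \<Sigma>) \<union>
      (\<lambda>(w, a, b, d). ELab w a b d) ` (?W \<times> \<pi> \<times> \<pi> \<times> \<Delta>)" (is "_ \<subseteq> ?B")
  proof
    fix x :: "('p, 's, 'd) fact"
    assume "x \<in> {x. fact_size x \<le> n \<and> (\<exists>G :: ('v, 'p, 's, 'd) pgraph. pointed_graph \<Sigma> \<Delta> \<pi> G \<and>
        holds G x)}"
    then obtain G :: "('v, 'p, 's, 'd) pgraph" where n: "fact_size x \<le> n"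
      and G: "pointed_graph \<Sigma> \<Delta> \<pi> G" and x: "holds G x" by blast
    show "x \<in> ?B"
    proof (cases x)
      case (Same w w')
      then have "(w, w') \<in> ?W \<times> ?W" using x n walk_letters[OF G] by auto
      then show ?thesis unfolding Same by (intro UnI1 image_eqI[of _ _ "(w, w')"]) simp_all
    next
      case (VLab w s)
      then have "(w, s) \<in> ?W \<times> \<Sigma>" using x n walk_letters[OF G] lab[OF G] by auto
      then show ?thesis unfolding VLab by (intro UnI1 UnI2 image_eqI[of _ _ "(w, s)"]) simp_all
    next
      case (ELab w a b d)
      then obtain u v where "walk G (ptr G) w u" "{(u, a), (v, b)} \<in> edges G"
        "elab G {(u, a), (v, b)} = Some d" using x by auto
      then have "(w, a, b, d) \<in> ?W \<times> \<pi> \<times> \<pi> \<times> \<Delta>"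
        using n ELab walk_letters[OF G] elab[OF G] pgD(4)[OF G] by fastforce
      then show ?thesis unfolding ELab by (intro UnI2 image_eqI[of _ _ "(w, a, b, d)"]) simp_all
    qed
  qed
  show ?thesis using W assms by (intro finite_subset[OF sub]) simp
qed


text \<open>Koenig's argument: nested infinite index sets on which the facts up to size \<open>n\<close> are constant.\<close>

lemma convergent_facts:
  fixes G :: "nat \<Rightarrow> ('v, 'p, 's, 'd) pgraph"
  assumes fin: "finite \<Sigma>" "finite \<Delta>" "finite \<pi>" and G: "\<And>k. pointed_graph \<Sigma> \<Delta> \<pi> (G k)"
  obtains L where "\<And>n. \<exists>k\<ge>n. \<forall>x. fact_size x \<le> n \<longrightarrow> (L x \<longleftrightarrow> holds (G k) x)"
proof -
  define facts where "facts n k = {x. fact_size x \<le> n \<and> holds (G k) x}" for n k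
  have const: "\<exists>B. infinite B \<and> (\<forall>j\<in>B. \<forall>k\<in>B. facts n j = facts n k) \<and> B \<subseteq> A"
    if A: "infinite A" for n and A :: "nat set"
  proof -
    let ?U = "{x. fact_size x \<le> n \<and> (\<exists>G :: ('v, 'p, 's, 'd) pgraph. pointed_graph \<Sigma> \<Delta> \<pi> G \<and>
        holds G x)}"
    have "facts n ` A \<subseteq> Pow ?U" using G unfolding facts_def by blast
    moreover have "finite (Pow ?U)" using finite_short_facts[OF fin]
        by (rule finite_Pow_iff[THEN iffD2])
    ultimately have "finite (facts n ` A)" by (rule finite_subset)
    then obtain a where "infinite {k \<in> A. facts n k = facts n a}"
      using pigeonhole_infinite[OF A] by blast
    then show ?thesis by (intro exI[of _ "{k \<in> A. facts n k = facts n a}"]) auto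
  qed
  have "\<exists>A. \<forall>n. (infinite (A n) \<and> (\<forall>j\<in>A n. \<forall>k\<in>A n. facts n j = facts n k)) \<and> A (Suc n) \<subseteq> A n"
  proof (rule dependent_nat_choice)
    show "\<exists>B. infinite B \<and> (\<forall>j\<in>B. \<forall>k\<in>B. facts 0 j = facts 0 k)"
      using const[OF infinite_UNIV_nat, of 0] by blast
  next
    fix A n assume "infinite A \<and> (\<forall>j\<in>A. \<forall>k\<in>A. facts n j = facts n k)"
    then show "\<exists>B. (infinite B \<and> (\<forall>j\<in>B. \<forall>k\<in>B. facts (Suc n) j = facts (Suc n) k)) \<and> B \<subseteq> A"
      using const[of A "Suc n"] by blast
  qed
  then obtain A where A: "\<And>n. infinite (A n)" "\<And>n j k. j \<in> A n \<Longrightarrow> k \<in> A n \<Longrightarrow> facts n j = facts n k"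
    "\<And>n. A (Suc n) \<subseteq> A n" by metis
  have mono: "A n \<subseteq> A m" if "m \<le> n" for m n using lift_Suc_antimono_le[of A, OF A(3) that] .
  show ?thesis
  proof
    fix n
    \<comment> \<open>Infinite index sets are unbounded, so the graph that imitates the limit up to
      size n can be taken at an index at least n. \<open>uniform_bound\<close> relies on
      this.\<close>
    obtain k where k: "k \<in> A n" "n \<le> k" using A(1)[of n] infinite_nat_iff_unbounded_le by metis
    \<comment> \<open>The limit accepts x if some graph with index in \<open>A (fact_size x)\<close>
      satisfies it; facts of that size are constant there, so any other index would do. By nesting,
      k in \<open>A n\<close> decides all facts of size up to n at once.\<close>
    have "(\<exists>j\<in>A (fact_size x). holds (G j) x) \<longleftrightarrow> holds (G k) x" if "fact_size x \<le> n" for x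
    proof -
      have kx: "k \<in> A (fact_size x)" using k mono[OF that] by blast
      have "holds (G j) x \<longleftrightarrow> holds (G k) x" if j: "j \<in> A (fact_size x)" for j
      proof -
        have "x \<in> facts (fact_size x) j \<longleftrightarrow> x \<in> facts (fact_size x) k" using A(2)[OF j kx] by simp
        then show ?thesis by (simp add: facts_def)
      qed
      then show ?thesis using kx by metis
    qed
    then show "\<exists>k\<ge>n. \<forall>x. fact_size x \<le> n \<longrightarrow>
        ((\<exists>j\<in>A (fact_size x). holds (G j) x) \<longleftrightarrow> holds (G k) x)"
      using k(2) by (intro exI[of _ k]) simp
  qed
qed

text \<open>Laws valid for the facts of every pointed graph and sufficient to rebuild one. Each
  mentions only facts about boundedly many words, so that it survives limits. \<open>reverse\<close>
  and \<open>elab_reverse\<close> express that edges are unordered; \<open>no_loop\<close> excludes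
  an edge whose two ends coincide in vertex and port, which would be a one-element set, while loops
  between different ports remain possible.\<close>

locale coherent_facts =
  fixes L :: "('p, 's, 'd) fact \<Rightarrow> bool" and \<Sigma> :: "'s set" and \<Delta> :: "'d set" and \<pi> :: "'p set"
  assumes nil: "L (Same [] [])"
    and sym: "L (Same w w') \<Longrightarrow> L (Same w' w)"
    and trans: "L (Same w w') \<Longrightarrow> L (Same w' w'') \<Longrightarrow> L (Same w w'')"
    and init: "L (Same (w @ [l]) w') \<Longrightarrow> L (Same w w)"
    and cong: "L (Same w v) \<Longrightarrow> L (Same (w @ [l]) w') \<Longrightarrow> L (Same (v @ [l]) w')"
    and reverse: "L (Same (w @ [(a, b)]) w') \<Longrightarrow> L (Same (w' @ [(b, a)]) w)"
    and port_det: "L (Same (w @ [(a, b)]) w') \<Longrightarrow> L (Same (w @ [(a, c)]) w'') \<Longrightarrow> b = c \<and>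
        L (Same w' w'')"
    and no_loop: "\<not> L (Same (w @ [(a, a)]) w)"
    and ports: "L (Same (w @ [(a, b)]) w') \<Longrightarrow> a \<in> \<pi>"
    and vlab_same: "L (VLab w s) \<Longrightarrow> L (Same w w)"
    and vlab_in: "L (VLab w s) \<Longrightarrow> s \<in> \<Sigma>"
    and vlab_det: "L (VLab w s) \<Longrightarrow> L (VLab w s') \<Longrightarrow> s = s'"
    and vlab_cong: "L (Same w v) \<Longrightarrow> L (VLab w s) \<Longrightarrow> L (VLab v s)"
    and elab_same: "L (ELab w a b d) \<Longrightarrow> L (Same (w @ [(a, b)]) (w @ [(a, b)]))"
    and elab_in: "L (ELab w a b d) \<Longrightarrow> d \<in> \<Delta>"
    and elab_det: "L (ELab w a b d) \<Longrightarrow> L (ELab w a b d') \<Longrightarrow> d = d'"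
    and elab_cong: "L (Same w v) \<Longrightarrow> L (ELab w a b d) \<Longrightarrow> L (ELab v a b d)"
    and elab_reverse: "L (Same (w @ [(a, b)]) w') \<Longrightarrow> L (ELab w a b d) \<Longrightarrow> L (ELab w' b a d)"

lemma Same_snoc_iff:
  "holds G (Same (w @ [(a, b)]) w') \<longleftrightarrow>
    (\<exists>u v. walk G (ptr G) w u \<and> {(u, a), (v, b)} \<in> edges G \<and> walk G (ptr G) w' v)"
  by (auto simp: walk_append_iff walk_Cons_iff)

lemma coherent_holds:
  fixes G :: "('v, 'p, 's, 'd) pgraph"
  assumes G: "pointed_graph \<Sigma> \<Delta> \<pi> G"
  shows "coherent_facts (holds G) \<Sigma> \<Delta> \<pi>"
proof
  note det = walk_det[OF G, of "ptr G"]
  have swap: "{(u, p), (x, q)} = {(x, q), (u, p)}" for u x :: 'v and p q :: 'p by blast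
  fix w w' w'' v :: "'p path" and l :: "'p \<times> 'p" and a b c :: 'p and s s' :: 's and d d' :: 'd
  show "holds G (Same [] [])" by simp
  show "holds G (Same w w') \<Longrightarrow> holds G (Same w' w)" by auto
  show "holds G (Same w w') \<Longrightarrow> holds G (Same w' w'') \<Longrightarrow> holds G (Same w w'')"
    unfolding holds.simps using det by metis
  show "holds G (Same (w @ [l]) w') \<Longrightarrow> holds G (Same w w)"
    by (auto simp: walk_append_iff)
  show "holds G (Same w v) \<Longrightarrow> holds G (Same (w @ [l]) w') \<Longrightarrow> holds G (Same (v @ [l]) w')"
    unfolding holds.simps walk_append_iff using det by metis
  show "holds G (Same (w @ [(a, b)]) w') \<Longrightarrow> holds G (Same (w' @ [(b, a)]) w)"
    unfolding Same_snoc_iff using swap by metis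
  show "holds G (Same (w @ [(a, b)]) w') \<Longrightarrow> holds G (Same (w @ [(a, c)]) w'') \<Longrightarrow>
      b = c \<and> holds G (Same w' w'')"
    unfolding Same_snoc_iff holds.simps(1)[of G w' w''] using det edge_det[OF G] by metis
  show "\<not> holds G (Same (w @ [(a, a)]) w)"
  proof
    assume "holds G (Same (w @ [(a, a)]) w)"
    then obtain u where "{(u, a), (u, a)} \<in> edges G" unfolding Same_snoc_iff using det by metis
    then show False using pgD(3)[OF G] by fastforce
  qed
  show "holds G (Same (w @ [(a, b)]) w') \<Longrightarrow> a \<in> \<pi>"
    unfolding Same_snoc_iff using pgD(4)[OF G] by blast
  show "holds G (VLab w s) \<Longrightarrow> holds G (Same w w)" by auto
  show "holds G (VLab w s) \<Longrightarrow> s \<in> \<Sigma>" using pgD(7)[OF G] by (auto intro: ranI)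
  show "holds G (VLab w s) \<Longrightarrow> holds G (VLab w s') \<Longrightarrow> s = s'"
    unfolding holds.simps using det by (metis option.inject)
  show "holds G (Same w v) \<Longrightarrow> holds G (VLab w s) \<Longrightarrow> holds G (VLab v s)"
    unfolding holds.simps using det by metis
  show "holds G (ELab w a b d) \<Longrightarrow> holds G (Same (w @ [(a, b)]) (w @ [(a, b)]))"
    by (auto simp: walk_append_iff intro: walk_single)
  show "holds G (ELab w a b d) \<Longrightarrow> d \<in> \<Delta>" using pgD(9)[OF G] by (auto intro: ranI)
  show "holds G (ELab w a b d) \<Longrightarrow> holds G (ELab w a b d') \<Longrightarrow> d = d'"
  proof -
    assume a: "holds G (ELab w a b d)" "holds G (ELab w a b d')"
    then obtain u x where "walk G (ptr G) w u" "{(u, a), (x, b)} \<in> edges G" by auto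
    then show "d = d'" using a holds_ELab[OF G] by (metis option.inject)
  qed
  show "holds G (Same w v) \<Longrightarrow> holds G (ELab w a b d) \<Longrightarrow> holds G (ELab v a b d)"
    unfolding holds.simps using det by metis
  show "holds G (Same (w @ [(a, b)]) w') \<Longrightarrow> holds G (ELab w a b d) \<Longrightarrow> holds G (ELab w' b a d)"
    proof -
    assume a: "holds G (Same (w @ [(a, b)]) w')" "holds G (ELab w a b d)"
    then obtain u x where u: "walk G (ptr G) w u" "{(u, a), (x, b)} \<in> edges G" "walk G (ptr G) w' x"
      unfolding Same_snoc_iff by blast
    then have "elab G {(u, a), (x, b)} = Some d" using a(2) holds_ELab[OF G] by blast
    then show "holds G (ELab w' b a d)" using u holds_ELab[OF G u(3)] swap by metis
  qed
qed

text \<open>Each law involves only finitely many facts, so it passes to the limit.\<close>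

lemma coherent_limit:
  fixes L :: "('p, 's, 'd) fact \<Rightarrow> bool"
  assumes "\<And>n. \<exists>M. coherent_facts M \<Sigma> \<Delta> \<pi> \<and> (\<forall>x. fact_size x \<le> n \<longrightarrow> (L x \<longleftrightarrow> M x))"
  shows "coherent_facts L \<Sigma> \<Delta> \<pi>"
proof
  fix w w' w'' v :: "'p path" and l :: "'p \<times> 'p" and a b c :: 'p and s s' :: 's and d d' :: 'd
  \<comment> \<open>The sum of the lengths, with room for an appended letter, bounds every fact in
    every law, so one \<open>M\<close> serves for all of them.\<close>
  obtain M where M: "coherent_facts M \<Sigma> \<Delta> \<pi>" and eq: "\<And>x.
      fact_size x \<le> length w + length w' + length w'' + length v + 2 \<Longrightarrow> L x \<longleftrightarrow> M x"
    using assms[of "length w + length w' + length w'' + length v + 2"] by blast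
  interpret coherent_facts M \<Sigma> \<Delta> \<pi> by (rule M)
  have L: "L (Same [] []) = M (Same [] [])" "L (Same w w) = M (Same w w)" "L (Same w w') = M (Same
      w w')"
    "L (Same w' w) = M (Same w' w)" "L (Same w' w'') = M (Same w' w'')" "L (Same w w'') = M (Same
        w w'')"
    "L (Same w v) = M (Same w v)" "L (VLab w s) = M (VLab w s)" "L (VLab w s') = M (VLab w s')"
    "L (VLab v s) = M (VLab v s)" by (simp_all add: eq)
  have L': "L (Same (w @ [l]) w') = M (Same (w @ [l]) w')" "L (Same (v @ [l]) w') = M (Same (v @
      [l]) w')"
    "L (Same (w @ [(a, b)]) w') = M (Same (w @ [(a, b)]) w')"
    "L (Same (w @ [(a, c)]) w'') = M (Same (w @ [(a, c)]) w'')"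
    "L (Same (w' @ [(b, a)]) w) = M (Same (w' @ [(b, a)]) w)"
    "L (Same (w @ [(a, a)]) w) = M (Same (w @ [(a, a)]) w)"
    "L (Same (w @ [(a, b)]) (w @ [(a, b)])) = M (Same (w @ [(a, b)]) (w @ [(a, b)]))"
    "L (ELab w a b d) = M (ELab w a b d)" "L (ELab w a b d') = M (ELab w a b d')"
    "L (ELab w' b a d) = M (ELab w' b a d)" "L (ELab v a b d) = M (ELab v a b d)"
    by (simp_all add: eq)
  show "L (Same [] [])" unfolding L by (rule nil)
  show "L (Same w w') \<Longrightarrow> L (Same w' w)" unfolding L by (rule sym)
  show "L (Same w w') \<Longrightarrow> L (Same w' w'') \<Longrightarrow> L (Same w w'')" unfolding L by (rule trans)
  show "L (Same (w @ [l]) w') \<Longrightarrow> L (Same w w)" unfolding L L' by (rule init)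
  show "L (Same w v) \<Longrightarrow> L (Same (w @ [l]) w') \<Longrightarrow> L (Same (v @ [l]) w')" unfolding L L' by (rule cong)
  show "L (Same (w @ [(a, b)]) w') \<Longrightarrow> L (Same (w' @ [(b, a)]) w)" unfolding L L' by (rule reverse)
  show "L (Same (w @ [(a, b)]) w') \<Longrightarrow> L (Same (w @ [(a, c)]) w'') \<Longrightarrow> b = c \<and> L (Same w' w'')"
    unfolding L L' by (rule port_det)
  show "\<not> L (Same (w @ [(a, a)]) w)" unfolding L L' by (rule no_loop)
  show "L (Same (w @ [(a, b)]) w') \<Longrightarrow> a \<in> \<pi>" unfolding L L' by (rule ports)
  show "L (VLab w s) \<Longrightarrow> L (Same w w)" unfolding L L' by (rule vlab_same)
  show "L (VLab w s) \<Longrightarrow> s \<in> \<Sigma>" unfolding L L' by (rule vlab_in)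
  show "L (VLab w s) \<Longrightarrow> L (VLab w s') \<Longrightarrow> s = s'" unfolding L L' by (rule vlab_det)
  show "L (Same w v) \<Longrightarrow> L (VLab w s) \<Longrightarrow> L (VLab v s)" unfolding L L' by (rule vlab_cong)
  show "L (ELab w a b d) \<Longrightarrow> L (Same (w @ [(a, b)]) (w @ [(a, b)]))" unfolding L L'
      by (rule elab_same)
  show "L (ELab w a b d) \<Longrightarrow> d \<in> \<Delta>" unfolding L L' by (rule elab_in)
  show "L (ELab w a b d) \<Longrightarrow> L (ELab w a b d') \<Longrightarrow> d = d'" unfolding L L' by (rule elab_det)
  show "L (Same w v) \<Longrightarrow> L (ELab w a b d) \<Longrightarrow> L (ELab v a b d)" unfolding L L' by (rule elab_cong)
  show "L (Same (w @ [(a, b)]) w') \<Longrightarrow> L (ELab w a b d) \<Longrightarrow> L (ELab w' b a d)"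
    unfolding L L' by (rule elab_reverse)
qed

section \<open>Rebuilding a graph from coherent facts\<close>

context coherent_facts
begin

abbreviation is_path :: "'p path \<Rightarrow> bool" where
  "is_path w \<equiv> L (Same w w)"

definition cls :: "'p path \<Rightarrow> 'p path set" where
  "cls w = {w'. L (Same w w')}"

text \<open>A term model whose vertices are the paths modulo \<open>Same\<close>. An unordered edge
  can be presented from either end and by any representatives, so a label is searched over all
  presentations; the laws make the result unique.\<close>

definition graph :: "('p path set, 'p, 's, 'd) pgraph" where
  "graph = \<lparr>verts = cls ` {w. is_path w},
     edges = {{(cls w, a), (cls w', b)} |w a w' b. L (Same (w @ [(a, b)]) w')},
     vlab = (\<lambda>x. if \<exists>w s. x = cls w \<and> L (VLab w s)
       then Some (THE s. \<exists>w. x = cls w \<and> L (VLab w s)) else None),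
     elab = (\<lambda>e. if \<exists>w a w' b d. e = {(cls w, a), (cls w', b)} \<and> L (Same (w @ [(a, b)]) w') \<and>
         L (ELab w a b d)
       then Some (THE d. \<exists>w a w' b. e = {(cls w, a), (cls w', b)} \<and> L (Same (w @ [(a, b)]) w') \<and>
           L (ELab w a b d))
       else None),
     ptr = cls []\<rparr>"

lemma same_refl: "L (Same w w') \<Longrightarrow> is_path w" "L (Same w w') \<Longrightarrow> is_path w'"
  using sym trans by blast+

lemma cls_eq: "is_path w \<Longrightarrow> cls w = cls w' \<longleftrightarrow> L (Same w w')"
  unfolding cls_def using sym trans by blast

text \<open>Equality of unordered pairs also allows the swapped orientation, which
  \<open>reverse\<close> repairs; \<open>cong\<close> and \<open>trans\<close> change
  representatives.\<close>

lemma edge_graph: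
  assumes w: "is_path w" and w': "is_path w'"
  shows "{(cls w, a), (cls w', b)} \<in> edges graph \<longleftrightarrow> L (Same (w @ [(a, b)]) w')"
proof
  assume "{(cls w, a), (cls w', b)} \<in> edges graph"
  then obtain v c v' d where v: "L (Same (v @ [(c, d)]) v')"
    and eq: "{(cls w, a), (cls w', b)} = {(cls v, c), (cls v', d)}"
    by (auto simp: graph_def)
  from eq consider "cls w = cls v" "cls w' = cls v'" "a = c" "b = d"
    | "cls w = cls v'" "cls w' = cls v" "a = d" "b = c" by (auto simp: doubleton_eq_iff)
  then show "L (Same (w @ [(a, b)]) w')"
  proof cases
    case 1
    then have "L (Same v w)" "L (Same v' w')" using cls_eq w w' sym by simp_all
    then show ?thesis using v cong trans 1 by blast
  next
    case 2
    then have "L (Same v' w)" "L (Same v w')" using cls_eq w w' sym by simp_all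
    then show ?thesis using reverse[OF v] cong trans 2 by blast
  qed
qed (auto simp: graph_def)

lemma edges_graph_cases:
  assumes "e \<in> edges graph"
  obtains w a w' b where "e = {(cls w, a), (cls w', b)}" "is_path w" "is_path w'" "L (Same (w @
      [(a, b)]) w')"
proof -
  obtain w a w' b where e: "e = {(cls w, a), (cls w', b)}" "L (Same (w @ [(a, b)]) w')"
    using assms by (auto simp: graph_def)
  then show ?thesis using that init same_refl by blast
qed

lemma vlab_graph:
  assumes w: "is_path w"
  shows "vlab graph (cls w) = Some s \<longleftrightarrow> L (VLab w s)"
proof -
  have iff: "(\<exists>v. cls w = cls v \<and> L (VLab v t)) \<longleftrightarrow> L (VLab w t)" for t
    using cls_eq[OF w] vlab_cong sym by blast
  then have "vlab graph (cls w) = (if \<exists>t. L (VLab w t) then Some (THE t. L (VLab w t)) else None)"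
    unfolding graph_def pgraph.simps iff by (intro if_cong refl) (use iff in blast)
  moreover have "(THE t. L (VLab w t)) = t" if "L (VLab w t)" for t
    using that vlab_det by blast
  ultimately show ?thesis by (auto split: if_splits)
qed

lemma elab_graph:
  assumes w: "is_path w" and w': "is_path w'" and e: "L (Same (w @ [(a, b)]) w')"
  shows "elab graph {(cls w, a), (cls w', b)} = Some d \<longleftrightarrow> L (ELab w a b d)"
proof -
  let ?e = "{(cls w, a), (cls w', b)}"
  have iff: "(\<exists>v p v' q. ?e = {(cls v, p), (cls v', q)} \<and> L (Same (v @ [(p, q)]) v') \<and>
      L (ELab v p q t)) \<longleftrightarrow>
      L (ELab w a b t)" for t
  proof
    assume "\<exists>v p v' q. ?e = {(cls v, p), (cls v', q)} \<and> L (Same (v @ [(p, q)]) v') \<and>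
        L (ELab v p q t)"
    then obtain v p v' q where eq: "?e = {(cls v, p), (cls v', q)}"
      and v: "L (Same (v @ [(p, q)]) v')" "L (ELab v p q t)" by blast
    from eq consider "cls w = cls v" "cls w' = cls v'" "a = p" "b = q"
      | "cls w = cls v'" "cls w' = cls v" "a = q" "b = p" by (auto simp: doubleton_eq_iff)
    then show "L (ELab w a b t)"
    proof cases
      case 1
      then show ?thesis using v elab_cong cls_eq[OF w] sym by blast
    next
      case 2
      then show ?thesis using elab_reverse[OF v] elab_cong cls_eq[OF w] sym by blast
    qed
  qed (use e in blast)
  have "elab graph ?e = (if \<exists>t v p v' q. ?e = {(cls v, p), (cls v', q)} \<and>
      L (Same (v @ [(p, q)]) v') \<and> L (ELab v p q t)
      then Some (THE t. \<exists>v p v' q. ?e = {(cls v, p), (cls v', q)} \<and> L (Same (v @ [(p, q)]) v') \<and>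
          L (ELab v p q t))
      else None)"
    unfolding graph_def pgraph.simps by (intro if_cong refl) blast
  then have "elab graph ?e = (if \<exists>t. L (ELab w a b t) then Some (THE t. L (ELab w a b t)) else
      None)"
    unfolding iff .
  moreover have "(THE t. L (ELab w a b t)) = t" if "L (ELab w a b t)" for t
    using that elab_det by blast
  ultimately show ?thesis by (auto split: if_splits)
qed

text \<open>In the term model a path leads from the pointer to its own class. This is what makes the
  facts of \<open>graph\<close> exactly those in \<open>L\<close>.\<close>

lemma walk_graph: "walk graph (cls []) w x \<longleftrightarrow> is_path w \<and> x = cls w"
proof (induction w arbitrary: x rule: rev_induct)
  case Nil
  then show ?case using nil by auto
next
  case (snoc l w)
  obtain a b where l: "l = (a, b)" by fastforce
  have "walk graph (cls []) (w @ [l]) x \<longleftrightarrow> is_path w \<and> {(cls w, a), (x, b)} \<in> edges graph"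
    using snoc.IH unfolding walk_append_iff walk_Cons_iff l by auto
  also have "\<dots> \<longleftrightarrow> is_path (w @ [l]) \<and> x = cls (w @ [l])"
  proof
    assume a: "is_path w \<and> {(cls w, a), (x, b)} \<in> edges graph"
    obtain w' where w': "is_path w'" "x = cls w'"
    proof -
      obtain v c v' d where v: "{(cls w, a), (x, b)} = {(cls v, c), (cls v', d)}" "is_path v"
          "is_path v'"
        using a edges_graph_cases by metis
      then show ?thesis using that by (auto simp: doubleton_eq_iff)
    qed
    then have "L (Same (w @ [l]) w')" using a edge_graph unfolding l by blast
    then show "is_path (w @ [l]) \<and> x = cls (w @ [l])" using w' same_refl cls_eq sym by metis
  next
    assume a: "is_path (w @ [l]) \<and> x = cls (w @ [l])"
    then have "is_path w" using init by blast
    then show "is_path w \<and> {(cls w, a), (x, b)} \<in> edges graph" using a edge_graph l by simp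
  qed
  finally show ?case .
qed

lemma path_letters: "is_path w \<Longrightarrow> set w \<subseteq> \<pi> \<times> \<pi>"
proof (induction w rule: rev_induct)
  case (snoc l w)
  obtain a b where l: "l = (a, b)" by fastforce
  have "is_path w" using init snoc.prems by blast
  then show ?case using snoc.IH ports reverse snoc.prems unfolding l by fastforce
qed simp

lemma pointed_graph_graph:
  assumes fin: "finite \<pi>"
  shows "pointed_graph \<Sigma> \<Delta> \<pi> graph"
  unfolding pointed_graph_def
proof (intro conjI)
  have "countable (lists (\<pi> \<times> \<pi>))" using fin by (simp add: countable_finite)
  moreover have "{w. is_path w} \<subseteq> lists (\<pi> \<times> \<pi>)" using path_letters by (auto simp: lists_eq_set)
  ultimately have "countable {w. is_path w}" by (rule countable_subset[rotated])
  then show "countable (verts graph)" by (simp add: graph_def)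
  show "ptr graph \<in> verts graph" using nil by (simp add: graph_def)
  show "\<forall>e\<in>edges graph. card e = 2 \<and> e \<subseteq> verts graph \<times> \<pi>"
  proof
    fix e assume "e \<in> edges graph"
    then obtain w a w' b where e: "e = {(cls w, a), (cls w', b)}" and w: "is_path w" "is_path w'"
      and s: "L (Same (w @ [(a, b)]) w')" using edges_graph_cases by blast
    have "(cls w, a) \<noteq> (cls w', b)"
    proof
      assume "(cls w, a) = (cls w', b)"
      then have "L (Same w' w)" "a = b" using cls_eq[OF w(1)] sym by simp_all
      then show False using trans[OF s] no_loop by blast
    qed
    moreover have "a \<in> \<pi>" "b \<in> \<pi>" using ports[OF s] ports[OF reverse[OF s]] .
    ultimately show "card e = 2 \<and> e \<subseteq> verts graph \<times> \<pi>" using e w by (auto simp: graph_def)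
  qed
  show "\<forall>e\<in>edges graph. \<forall>e'\<in>edges graph. e \<inter> e' \<noteq> {} \<longrightarrow> e = e'"
  proof (intro ballI impI)
    fix e e' assume e: "e \<in> edges graph" and e': "e' \<in> edges graph" and "e \<inter> e' \<noteq> {}"
    then obtain x a where x: "(x, a) \<in> e" "(x, a) \<in> e'" by auto
    \<comment> \<open>Each edge is turned so that the shared vertex and port come first;
      \<open>port_det\<close> then identifies the other ends.\<close>
    have ex: "\<exists>w w' b. e = {(cls w, a), (cls w', b)} \<and> x = cls w \<and> is_path w \<and> is_path w' \<and>
        L (Same (w @ [(a, b)]) w')" if e: "e \<in> edges graph" and x: "(x, a) \<in> e" for e
    proof -
      obtain w c w' b where e: "e = {(cls w, c), (cls w', b)}" and w: "is_path w" "is_path w'"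
        and s: "L (Same (w @ [(c, b)]) w')" using edges_graph_cases[OF e] .
      from x e consider "x = cls w" "a = c" | "x = cls w'" "a = b" by auto
      then show ?thesis
      proof cases
        case 1 then show ?thesis using e w s by blast
      next
        case 2
        then have "e = {(cls w', a), (cls w, c)}" using e by blast
        then show ?thesis using 2 w reverse[OF s] by blast
      qed
    qed
    obtain w w' b where 1: "e = {(cls w, a), (cls w', b)}" "x = cls w" "is_path w" "is_path w'"
      "L (Same (w @ [(a, b)]) w')" using ex[OF e x(1)] by blast
    obtain v v' c where 2: "e' = {(cls v, a), (cls v', c)}" "x = cls v" "is_path v" "is_path v'"
      "L (Same (v @ [(a, c)]) v')" using ex[OF e' x(2)] by blast
    have "L (Same v w)" using 1(2) 2(2) cls_eq[OF 2(3)] by simp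
    then have "L (Same (w @ [(a, c)]) v')" using 2(5) cong by blast
    then have "b = c \<and> L (Same w' v')" using port_det 1(5) by blast
    then have "b = c" "cls w' = cls v'" using cls_eq[OF 1(4)] by simp_all
    then show "e = e'" using 1(1,2) 2(1,2) by simp
  qed
  show "dom (vlab graph) \<subseteq> verts graph"
    using vlab_same by (auto simp: graph_def split: if_splits)
  show "ran (vlab graph) \<subseteq> \<Sigma>"
  proof
    fix s assume "s \<in> ran (vlab graph)"
    then obtain x where x: "vlab graph x = Some s" by (auto simp: ran_def)
    then obtain w where "x = cls w" "is_path w"
      using vlab_same by (auto simp: graph_def split: if_splits)
    then show "s \<in> \<Sigma>" using x vlab_graph vlab_in by simp
  qed
  show dom: "dom (elab graph) \<subseteq> edges graph"
  proof
    fix e assume "e \<in> dom (elab graph)"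
    then obtain w a w' b where "e = {(cls w, a), (cls w', b)}" "L (Same (w @ [(a, b)]) w')"
      by (auto simp: graph_def split: if_splits)
    then show "e \<in> edges graph" unfolding graph_def pgraph.simps by blast
  qed
  show "ran (elab graph) \<subseteq> \<Delta>"
  proof
    fix d assume "d \<in> ran (elab graph)"
    then obtain e where e: "elab graph e = Some d" by (auto simp: ran_def)
    then have "e \<in> edges graph" using dom by blast
    then obtain w a w' b where "e = {(cls w, a), (cls w', b)}" "is_path w" "is_path w'"
      "L (Same (w @ [(a, b)]) w')" using edges_graph_cases by blast
    then show "d \<in> \<Delta>" using e elab_graph elab_in by simp
  qed
  have *: "\<exists>w. walk graph (cls []) w x" if "x \<in> verts graph" for x
    using that walk_graph by (auto simp: graph_def)
  show "\<forall>u\<in>verts graph. \<forall>v\<in>verts graph. \<exists>w. walk graph u w v"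
    using * by (meson walk_sym walk_append)
qed

lemma holds_graph:
  assumes fin: "finite \<pi>"
  shows "holds graph x \<longleftrightarrow> L x"
proof -
  have p: "ptr graph = cls []" by (simp add: graph_def)
  show ?thesis
  proof (cases x)
    case (Same w w')
    then show ?thesis using cls_eq same_refl by (auto simp: p walk_graph)
  next
    case (VLab w s)
    then show ?thesis using vlab_graph vlab_same by (auto simp: p walk_graph)
  next
    case (ELab w a b d)
    show ?thesis
    proof
      assume h: "holds graph x"
      then obtain v where w: "is_path w" and e: "{(cls w, a), (v, b)} \<in> edges graph"
        "elab graph {(cls w, a), (v, b)} = Some d" by (auto simp: ELab p walk_graph)
      have "walk graph (cls []) (w @ [(a, b)]) v"
        using w e(1) walk_graph by (intro walk_append walk_single) auto
      then have "v = cls (w @ [(a, b)])" "is_path (w @ [(a, b)])" using walk_graph by auto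
      then show "L x" using elab_graph[OF w] e ELab by simp
    next
      assume "L x"
      then have "is_path (w @ [(a, b)])" using elab_same ELab by simp
      moreover from this have w: "is_path w" using init by blast
      ultimately have "{(cls w, a), (cls (w @ [(a, b)]), b)} \<in> edges graph"
        "elab graph {(cls w, a), (cls (w @ [(a, b)]), b)} = Some d"
        using elab_graph[OF w] edge_graph[OF w] \<open>L x\<close> unfolding ELab by blast+
      then show "holds graph x" using w unfolding ELab holds.simps p walk_graph by blast
    qed
  qed
qed

end

text \<open>The vertices of the limit are sets of words, whatever the vertex type of the sequence.
  Instead of a convergent subsequence it is enough to have, for every size, one late member that
  agrees with the limit.\<close>

lemma limit_graph:
  fixes G :: "nat \<Rightarrow> ('v, 'p, 's, 'd) pgraph"
  assumes fin: "finite \<Sigma>" "finite \<Delta>" "finite \<pi>" and G: "\<And>k. pointed_graph \<Sigma> \<Delta> \<pi> (G k)"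
  obtains H :: "('p path set, 'p, 's, 'd) pgraph" where "pointed_graph \<Sigma> \<Delta> \<pi> H"
    "\<And>n. \<exists>k\<ge>n. agree n H (G k)"
proof -
  obtain L where L: "\<And>n. \<exists>k\<ge>n. \<forall>x. fact_size x \<le> n \<longrightarrow> (L x \<longleftrightarrow> holds (G k) x)"
    using convergent_facts[where G = G, OF fin G] by blast
  interpret coherent_facts L \<Sigma> \<Delta> \<pi>
    by (rule coherent_limit) (use L coherent_holds[OF G] in blast)
  show ?thesis
  proof
    show "pointed_graph \<Sigma> \<Delta> \<pi> graph" by (rule pointed_graph_graph[OF fin(3)])
    show "\<exists>k\<ge>n. agree n graph (G k)" for n using L[of n] holds_graph[OF fin(3)]
        by (simp add: agree_def)
  qed
qed

text \<open>If every N failed, counterexamples \<open>G N\<close> would have a limit H. The local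
  bound at H holds for all graphs close to H, among them some \<open>G k\<close> with k above that
  bound, which contradicts monotonicity.\<close>

lemma uniform_bound:
  fixes P :: "nat \<Rightarrow> ('p, 's, 'd) pgm \<Rightarrow> bool"
  assumes fin: "finite \<Sigma>" "finite \<Delta>" "finite \<pi>"
    and mono: "\<And>N N' X. P N X \<Longrightarrow> N \<le> N' \<Longrightarrow> P N' X"
    and local: "\<And>X. X \<in> pgms \<Sigma> \<Delta> \<pi> \<Longrightarrow>
      \<exists>n N. \<forall>X'\<in>pgms \<Sigma> \<Delta> \<pi>. disk n X' = disk n X \<longrightarrow> P N X'"
  shows "\<exists>N. \<forall>X\<in>pgms \<Sigma> \<Delta> \<pi>. P N X"
proof (rule ccontr)
  assume "\<nexists>N. \<forall>X\<in>pgms \<Sigma> \<Delta> \<pi>. P N X"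
  then have "\<forall>N. \<exists>G :: (nat, 'p, 's, 'd) pgraph. pointed_graph \<Sigma> \<Delta> \<pi> G \<and> \<not> P N (modulo G)"
    unfolding pgms_def by blast
  then obtain G :: "nat \<Rightarrow> (nat, 'p, 's, 'd) pgraph"
    where G: "\<And>N. pointed_graph \<Sigma> \<Delta> \<pi> (G N)" "\<And>N. \<not> P N (modulo (G N))" by metis
  obtain H :: "('p path set, 'p, 's, 'd) pgraph" where H: "pointed_graph \<Sigma> \<Delta> \<pi> H"
    "\<And>n. \<exists>k\<ge>n. agree n H (G k)" using limit_graph[where G = G, OF fin G(1)] by blast
  obtain n N where n: "\<And>X. X \<in> pgms \<Sigma> \<Delta> \<pi> \<Longrightarrow> disk n X = disk n (modulo H) \<Longrightarrow> P N X"
    using local[OF modulo_in_pgms[OF H(1)]] by blast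
  \<comment> \<open>Size \<open>n + 2\<close> gives equal disks of radius n, and
    \<open>k \<ge> N\<close> lets the bound N refute the choice of \<open>G k\<close>.\<close>
  obtain k where k: "k \<ge> n + 2 + N" "agree (n + 2 + N) H (G k)" using H(2) by blast
  then have "disk n (modulo H) = disk n (modulo (G k))"
    using disk_eq_if_agree[OF H(1) G(1)] agree_mono by (metis le_add1)
  then have "P N (modulo (G k))" using n modulo_in_pgms[OF G(1)] by metis
  then show False using mono G(2) k(1) by (meson add_leE)
qed


section \<open>Graphs with invisible matter\<close>

fun carrier :: "'v ivertex \<Rightarrow> 'v" where
  "carrier (Visible v) = v"
| "carrier (Invisible v ds) = v"

fun depth :: "'v ivertex \<Rightarrow> nat" where
  "depth (Visible v) = 0"
| "depth (Invisible v ds) = Suc (length ds)"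

text \<open>The word followed by the carrier while a vertex moves through a graph with trees.
  Letters mixing a \<open>Port\<close> with a tree port do not occur on walks; dropping them makes
  the function total.\<close>

fun visible_part :: "'p iport path \<Rightarrow> 'p path" where
  "visible_part [] = []"
| "visible_part ((Port a, Port b) # w) = (a, b) # visible_part w"
| "visible_part (l # w) = visible_part w"

abbreviation tree_path :: "bool list \<Rightarrow> 'p iport path" where
  "tree_path \<equiv> map (\<lambda>d. (if d then Rp else Lp, Mp))"

lemma tree_paths_eq: "tree_paths = range tree_path"
proof (intro equalityI subsetI)
  fix s :: "'p iport path" assume "s \<in> tree_paths"
  then show "s \<in> range tree_path"
    unfolding tree_paths_def
  proof (induction rule: lists.induct)
    case (Cons l s)
    then obtain ds where "s = tree_path ds" by blast
    moreover obtain d where "l = (if d then Rp else Lp, Mp)"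
      using Cons.hyps(1) by (metis (full_types) empty_iff insert_iff)
    ultimately show ?case by (intro range_eqI[of _ _ "d # ds"]) simp
  qed simp
qed (auto simp: tree_paths_def split: if_splits)

lemma visible_part_append [simp]: "visible_part (v @ w) = visible_part v @ visible_part w"
  by (induction v rule: visible_part.induct) simp_all

lemma visible_part_visible [simp]: "visible_part (visible_path w) = w"
  by (induction w) auto

lemma visible_part_tree [simp]: "visible_part (tree_path ds) = []"
  by (induction ds) auto

lemma visible_part_backwards [simp]: "visible_part (backwards w) = backwards (visible_part w)"
  by (induction w rule: visible_part.induct) (simp_all add: backwards_def)

lemma backwards_Nil [simp]: "backwards [] = []"
  by (simp add: backwards_def)

lemma length_backwards [simp]: "length (backwards w) = length w"
  by (simp add: backwards_def)

text \<open>The deeper end of a tree edge always has port \<open>Mp\<close>, also on the edge that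
  joins the root to its visible vertex.\<close>

lemma gattach_edge:
  assumes "{(x, p), (y, q)} \<in> edges (gattach G)"
  obtains u a v b where "x = Visible u" "p = Port a" "y = Visible v" "q = Port b"
      "{(u, a), (v, b)} \<in> edges G"
  | "carrier x = carrier y" "depth y = Suc (depth x)" "carrier x \<in> verts G" "q = Mp"
  | "carrier x = carrier y" "depth x = Suc (depth y)" "carrier x \<in> verts G" "p = Mp"
  using assms
proof (cases rule: gattach_edge_cases)
  case (1 d)
  have "(x, p) \<in> visible_edge d" "(y, q) \<in> visible_edge d" using 1(2) by blast+
  then obtain u a v b where uv: "x = Visible u" "p = Port a" "y = Visible v" "q = Port b" by auto
  have "visible_edge {(u, a), (v, b)} = visible_edge d" using 1(2) uv by simp
  then have "{(u, a), (v, b)} = d" using inj_visible_edge by (rule injD[rotated])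
  then show ?thesis using that(1) uv 1(1) by blast
next
  case (2 v)
  then show ?thesis using that(2,3) by (auto simp: doubleton_eq_iff)
next
  case (3 v ds d)
  then show ?thesis using that(2,3) by (auto simp: doubleton_eq_iff split: if_splits)
qed

lemma walk_project:
  "walk (gattach G) x w y \<Longrightarrow> walk G (carrier x) (visible_part w) (carrier y)"
proof (induction rule: walk.induct)
  case (walk_Cons x p y q w z)
  from walk_Cons.hyps(1) show ?case
  proof (cases rule: gattach_edge)
    case (1 u a v b)
    then show ?thesis using walk_Cons.IH by (auto intro: walk.intros)
  next
    case 2
    then show ?thesis using walk_Cons.IH by (cases p) auto
  next
    case 3
    then show ?thesis using walk_Cons.IH by simp
  qed
qed simp

text \<open>Each letter either follows a visible edge at depth 0 or changes the depth by one, so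
  visible steps and descent share the length of the walk.\<close>

lemma walk_depth:
  "walk (gattach G) x w y \<Longrightarrow> length (visible_part w) + depth y \<le> length w + depth x"
proof (induction rule: walk.induct)
  case (walk_Cons x p y q w z)
  from walk_Cons.hyps(1) show ?case
  proof (cases rule: gattach_edge)
    case 2
    then show ?thesis using walk_Cons.IH by (cases p) auto
  qed (use walk_Cons.IH in auto)
qed simp

lemma walk_visible_iff:
  "walk (gattach G) (Visible u) (visible_path w) y \<longleftrightarrow> (\<exists>v. y = Visible v \<and> walk G u w v)"
proof
  show "walk (gattach G) (Visible u) (visible_path w) y \<Longrightarrow> \<exists>v. y = Visible v \<and> walk G u w v"
  proof (induction w arbitrary: u)
    case (Cons l w)
    obtain a b where l: "l = (a, b)" by fastforce
    obtain z where z: "{(Visible u, Port a), (z, Port b)} \<in> edges (gattach G)"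
      and zy: "walk (gattach G) z (visible_path w) y"
      using Cons.prems by (auto simp: l walk_Cons_iff)
    from z obtain v where v: "z = Visible v" "{(u, a), (v, b)} \<in> edges G"
      by (cases rule: gattach_edge) auto
    obtain x where "y = Visible x" "walk G v w x" using Cons.IH zy unfolding v(1) by blast
    then show ?case using walk.walk_Cons[OF v(2)] unfolding l by blast
  qed simp
qed (auto intro: walk_gattach)

lemma walk_tree_path:
  assumes "v \<in> verts G"
  shows "walk (gattach G) (Invisible v ds) (tree_path es) (Invisible v (ds @ es))"
proof (induction es arbitrary: ds)
  case (Cons d es)
  show ?case
    using walk.walk_Cons[OF gattach_edgeI(3)[OF assms, of ds d] Cons.IH[of "ds @ [d]"]] by simp
qed simp

lemma walk_dot: "v \<in> verts G \<Longrightarrow> walk (gattach G) (Visible v) dot (Invisible v [])"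
  by (intro walk_single gattach_edgeI(2))

fun down_path :: "'v ivertex \<Rightarrow> 'p iport path" where
  "down_path (Visible v) = []"
| "down_path (Invisible v ds) = dot @ tree_path ds"

lemma length_down_path [simp]: "length (down_path x) = depth x"
  by (cases x) auto

lemma visible_part_down_path [simp]: "visible_part (down_path x) = []"
  by (cases x) auto

lemma verts_gattach: "x \<in> verts (gattach G) \<longleftrightarrow> carrier x \<in> verts G"
  by (cases x) (auto simp: gattach_def)

lemma walk_down_path:
  assumes "carrier x \<in> verts G"
  shows "walk (gattach G) (Visible (carrier x)) (down_path x) x"
proof (cases x)
  case (Invisible v ds)
  then have v: "v \<in> verts G" using assms by simp
  show ?thesis using walk_append[OF walk_dot[OF v] walk_tree_path[OF v, of "[]" ds]] Invisible
      by simp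
qed simp

lemma walk_up_path:
  "carrier x \<in> verts G \<Longrightarrow> walk (gattach G) x (backwards (down_path x)) (Visible (carrier x))"
  by (rule walk_sym[OF walk_down_path])

section \<open>Disks of graphs with trees attached\<close>

lemma ptr_gattach [simp]: "ptr (gattach G) = Visible (ptr G)"
  by (simp add: gattach_def)

text \<open>Seen from a visible pointer, the distance of a vertex is the distance of its carrier
  plus its depth: a visible walk followed by \<open>down_path\<close> attains it, and
  \<open>walk_depth\<close> shows that nothing is shorter. The condition
  \<open>depth x \<le> r\<close> guards the truncated subtraction.\<close>

lemma ball_gattach:
  assumes G: "pointed_graph \<Sigma> \<Delta> \<pi> G"
  shows "ball (gattach G) r = {x. depth x \<le> r \<and> carrier x \<in> ball G (r - depth x)}"
proof (intro equalityI subsetI)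
  fix x assume "x \<in> ball (gattach G) r"
  then obtain w where w: "length w \<le> r" "walk (gattach G) (Visible (ptr G)) w x"
      by (auto simp: ball_def)
  have "length (visible_part w) + depth x \<le> r" using walk_depth[OF w(2)] w(1) by simp
  then show "x \<in> {x. depth x \<le> r \<and> carrier x \<in> ball G (r - depth x)}"
    using walk_project[OF w(2)] by (auto simp: ball_def intro!: exI[of _ "visible_part w"])
next
  fix x assume "x \<in> {x. depth x \<le> r \<and> carrier x \<in> ball G (r - depth x)}"
  then obtain w where w: "depth x \<le> r" "length w \<le> r - depth x" "walk G (ptr G) w (carrier x)"
    by (auto simp: ball_def)
  have "walk (gattach G) (Visible (ptr G)) (visible_path w @ down_path x) x"
    using walk_append[OF walk_gattach[OF w(3)] walk_down_path[OF walk_ptr_verts[OF G w(3)]]] .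
  then show "x \<in> ball (gattach G) r"
    using w(1,2) unfolding ball_def by (auto intro!: exI[of _ "visible_path w @ down_path x"])
qed

lemma elab_gattach_invisible: "e \<notin> visible_edge ` edges G \<Longrightarrow> elab (gattach G) e = None"
  by (simp add: gattach_def)

text \<open>Tree vertices are farther from the pointer than their carriers, so the disk of radius n
  with trees sees nothing of \<open>G\<close> beyond the disk of radius n. This is the continuity of
  \<open>attach\<close> that pulls neighbourhoods back to graphs without trees.\<close>

lemma gdisk_gattach:
  assumes G: "pointed_graph \<Sigma> \<Delta> \<pi> G"
  shows "gdisk n (gattach (gdisk n G)) = gdisk n (gattach G)"
proof -
  let ?D = "gdisk n G"
  note D = pointed_graph_gdisk[OF G, of n]
  have b: "ball (gattach ?D) r = ball (gattach G) r" if "r \<le> n + 1" for r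
    unfolding ball_gattach[OF G] ball_gattach[OF D] using that by (simp add: ball_gdisk)
  have vD: "verts ?D = ball G (n + 1)" by (simp add: gdisk_def)
  have carrier: "carrier x \<in> ball G r" if "x \<in> ball (gattach G) r" for x r
    using that ball_mono[of "r - depth x" r G] by (auto simp: ball_gattach[OF G])
  have visD: "d \<in> edges ?D \<longleftrightarrow> d \<in> edges G"
    if "visible_edge d \<subseteq> ball (gattach G) (n + 1) \<times> UNIV" for d
  proof -
    have "d \<subseteq> ball G (n + 1) \<times> UNIV"
    proof
      fix x assume "x \<in> d"
      then have "(Visible (fst x), Port (snd x)) \<in> visible_edge d" by (cases x) force
      then have "Visible (fst x) \<in> ball (gattach G) (n + 1)" using that by blast
      then show "x \<in> ball G (n + 1) \<times> UNIV" using carrier[of "Visible (fst x)"] by (cases x) auto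
    qed
    then show ?thesis by (auto simp: gdisk_def)
  qed
  have edges: "e \<in> edges (gattach ?D) \<longleftrightarrow> e \<in> edges (gattach G)"
    if e: "e \<subseteq> ball (gattach G) (n + 1) \<times> UNIV" for e
  proof
    assume "e \<in> edges (gattach ?D)"
    then show "e \<in> edges (gattach G)"
    proof (cases rule: gattach_edge_cases)
      case (1 d)
      then have "d \<in> edges G" using e visD[of d] by simp
      then show ?thesis unfolding 1(2) by (rule gattach_edgeI(1))
    next
      case (2 v)
      then have "v \<in> verts G" using ball_verts[OF G] vD by blast
      then show ?thesis unfolding 2(2) by (rule gattach_edgeI(2))
    next
      case (3 v ds d)
      then have "v \<in> verts G" using ball_verts[OF G] vD by blast
      then show ?thesis unfolding 3(2) by (rule gattach_edgeI(3))
    qed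
  next
    assume "e \<in> edges (gattach G)"
    then show "e \<in> edges (gattach ?D)"
    proof (cases rule: gattach_edge_cases)
      case (1 d)
      then have "d \<in> edges ?D" using e visD[of d] by simp
      then show ?thesis unfolding 1(2) by (rule gattach_edgeI(1))
    next
      case (2 v)
      then have "v \<in> verts ?D" using e carrier[of "Visible v" "n + 1"] vD by simp
      then show ?thesis unfolding 2(2) by (rule gattach_edgeI(2))
    next
      case (3 v ds d)
      then have "v \<in> verts ?D" using e carrier[of "Invisible v ds" "n + 1"] vD by simp
      then show ?thesis unfolding 3(2) by (rule gattach_edgeI(3))
    qed
  qed
  have vlab: "vlab (gattach ?D) x = vlab (gattach G) x" if "x \<in> ball (gattach G) n" for x
  proof -
    have c: "carrier x \<in> ball G n" "carrier x \<in> ball G (n + 1)" "carrier x \<in> verts G"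
      using carrier[OF that] ball_mono[of n "n + 1" G] ball_verts[OF G] by auto
    then show ?thesis by (cases x) (auto simp: gattach_def gdisk_def)
  qed
  have elab: "elab (gattach ?D) e = elab (gattach G) e" if e: "e \<subseteq> ball (gattach G) n \<times> UNIV" for e
  proof (cases "\<exists>d. e = visible_edge d")
    case True
    then obtain d where d: "e = visible_edge d" by blast
    have bm: "ball (gattach G) n \<subseteq> ball (gattach G) (n + 1)" by (rule ball_mono) simp
    have "visible_edge d \<subseteq> ball (gattach G) (n + 1) \<times> UNIV"
      using Sigma_mono[OF bm order_refl] e unfolding d by (rule order_trans[rotated])
    then have dD: "d \<in> edges ?D \<longleftrightarrow> d \<in> edges G" by (rule visD)
    have "d \<subseteq> ball G n \<times> UNIV"
    proof
      fix x assume "x \<in> d"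
      then have "(Visible (fst x), Port (snd x)) \<in> visible_edge d" by (cases x) force
      then have "Visible (fst x) \<in> ball (gattach G) n" using e d by blast
      then show "x \<in> ball G n \<times> UNIV" using carrier[of "Visible (fst x)"] by (cases x) auto
    qed
    then have el: "elab ?D d = elab G d" by (simp add: gdisk_def)
    show ?thesis
    proof (cases "d \<in> edges G")
      case True
      then have "d \<in> edges ?D" using dD by blast
      then show ?thesis unfolding d elab_gattach[OF True] elab_gattach[OF \<open>d \<in> edges ?D\<close>] el by simp
    next
      case False
      then have "e \<notin> visible_edge ` edges G" "e \<notin> visible_edge ` edges ?D"
        using dD unfolding d inj_image_mem_iff[OF inj_visible_edge] by blast+
      then show ?thesis by (simp add: elab_gattach_invisible)
    qed
  next
    case False
    then have "e \<notin> visible_edge ` edges G" "e \<notin> visible_edge ` edges ?D" by blast+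
    then show ?thesis by (simp add: elab_gattach_invisible)
  qed
  have bb: "ball (gattach ?D) (n + 1) = ball (gattach G) (n + 1)" "ball (gattach ?D) n = ball
      (gattach G) n"
    using b by simp_all
  have "{e \<in> edges (gattach ?D). e \<subseteq> ball (gattach G) (n + 1) \<times> UNIV} =
      {e \<in> edges (gattach G). e \<subseteq> ball (gattach G) (n + 1) \<times> UNIV}" using edges by blast
  moreover have "vlab (gattach ?D) |` ball (gattach G) n = vlab (gattach G) |` ball (gattach G) n"
    by (rule ext) (simp add: restrict_map_def vlab)
  moreover have "elab (gattach ?D) |` {e. e \<subseteq> ball (gattach G) n \<times> UNIV} =
      elab (gattach G) |` {e. e \<subseteq> ball (gattach G) n \<times> UNIV}"
    by (rule ext) (simp add: restrict_map_def elab)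
  ultimately show ?thesis
    unfolding gdisk_def[of n "gattach ?D"] gdisk_def[of n "gattach G"] bb
        by (simp only: ptr_gattach ptr_gdisk)
qed

lemma disk_attach:
  assumes G: "pointed_graph \<Sigma> \<Delta> \<pi> (G :: (nat, 'p, 's, 'd) pgraph)"
  shows "disk n (attach (modulo G)) = disk n (attach (disk n (modulo G)))"
proof -
  note D = pointed_graph_gdisk[OF G, of n]
  have "disk n (attach (modulo G)) = modulo (gdisk n (gattach G))"
    using attach_modulo[OF G] disk_modulo_any[OF pointed_graph_gattach[OF G]] by simp
  moreover have "disk n (attach (disk n (modulo G))) = modulo (gdisk n (gattach (gdisk n G)))"
    using disk_modulo[OF G] attach_modulo[OF D] disk_modulo_any[OF pointed_graph_gattach[OF D]]
        by simp
  ultimately show ?thesis using gdisk_gattach[OF G, of n] by simp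
qed

lemma pgmsE:
  assumes "X \<in> pgms \<Sigma> \<Delta> \<pi>"
  obtains G :: "(nat, 'p, 's, 'd) pgraph" where "pointed_graph \<Sigma> \<Delta> \<pi> G" "X = modulo G"
  using assms unfolding pgms_def by blast

lemma disk_attach_cong:
  assumes X: "X \<in> pgms \<Sigma> \<Delta> \<pi>" and X': "X' \<in> pgms \<Sigma> \<Delta> \<pi>" and eq: "disk n X = disk n X'"
  shows "disk n (attach X) = disk n (attach X')"
  using pgmsE[OF X] pgmsE[OF X'] disk_attach eq by metis

section \<open>Recovering the visible graph from facts at a tree vertex\<close>

lemma repointed_simps:
  "ptr (G\<lparr>ptr := x\<rparr>) = x" "verts (G\<lparr>ptr := x\<rparr>) = verts G" "edges (G\<lparr>ptr := x\<rparr>) = edges G"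
  "vlab (G\<lparr>ptr := x\<rparr>) = vlab G" "elab (G\<lparr>ptr := x\<rparr>) = elab G"
  by simp_all

text \<open>With p a way up to the carrier, a fact about the graph pointed at the carrier becomes a
  fact observed from the tree vertex, at the cost of the length of p.\<close>

fun lift_fact :: "'p iport path \<Rightarrow> ('p, 's, 'd) fact \<Rightarrow> ('p iport, 's ilabel, 'd) fact" where
  "lift_fact p (Same w w') = Same (p @ visible_path w) (p @ visible_path w')"
| "lift_fact p (VLab w s) = VLab (p @ visible_path w) (Lab s)"
| "lift_fact p (ELab w a b d) = ELab (p @ visible_path w) (Port a) (Port b) d"

lemma lift_fact_size: "fact_size (lift_fact p x) = length p + fact_size x"
  by (cases x) auto

lemma vlab_gattach_Visible: "vlab (gattach G) (Visible v) = map_option Lab (vlab G v)"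
  by (simp add: gattach_def)

lemma vlab_gattach_Invisible: "v \<in> verts G \<Longrightarrow> vlab (gattach G) (Invisible v ds) = Some MLab"
  by (simp add: gattach_def)

lemma visible_edge_iff:
  "{(Visible u, Port a), (y, Port b)} \<in> edges (gattach G) \<longleftrightarrow>
    (\<exists>v. y = Visible v \<and> {(u, a), (v, b)} \<in> edges G)"
proof
  assume "{(Visible u, Port a), (y, Port b)} \<in> edges (gattach G)"
  then show "\<exists>v. y = Visible v \<and> {(u, a), (v, b)} \<in> edges G" by (cases rule: gattach_edge) auto
next
  assume "\<exists>v. y = Visible v \<and> {(u, a), (v, b)} \<in> edges G"
  then obtain v where v: "y = Visible v" "{(u, a), (v, b)} \<in> edges G" by blast
  have "visible_edge {(u, a), (v, b)} \<in> edges (gattach G)" by (rule gattach_edgeI(1)[OF v(2)])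
  then show "{(Visible u, Port a), (y, Port b)} \<in> edges (gattach G)" using v(1) by simp
qed

lemma holds_lift:
  assumes G: "pointed_graph \<Sigma> \<Delta> \<pi> G" and p: "walk (gattach G) x p (Visible c)"
  shows "holds (gattach G\<lparr>ptr := x\<rparr>) (lift_fact p f) \<longleftrightarrow> holds (G\<lparr>ptr := c\<rparr>) f"
proof -
  note det = walk_det[OF pointed_graph_gattach[OF G] p]
  have w: "walk (gattach G) x (p @ visible_path w) y \<longleftrightarrow> (\<exists>v. y = Visible v \<and> walk G c w v)" for w y
  proof -
    have "walk (gattach G) x (p @ visible_path w) y \<longleftrightarrow> walk (gattach G) (Visible c) (visible_path
        w) y"
      unfolding walk_append_iff using det p by metis
    then show ?thesis unfolding walk_visible_iff .
  qed
  show ?thesis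
  proof (cases f)
    case (Same w w')
    show ?thesis unfolding Same lift_fact.simps holds.simps walk_ptr repointed_simps w by blast
  next
    case (VLab q s)
    have "vlab (gattach G) (Visible v) = Some (Lab s) \<longleftrightarrow> vlab G v = Some s" for v
      by (auto simp: vlab_gattach_Visible)
    then show ?thesis unfolding VLab lift_fact.simps holds.simps walk_ptr repointed_simps w by metis
  next
    case (ELab q a b d)
    have e: "elab (gattach G) {(Visible u, Port a), (Visible v, Port b)} = elab G {(u, a), (v, b)}"
      if "{(u, a), (v, b)} \<in> edges G" for u v using elab_gattach[OF that] by simp
    have "holds (gattach G\<lparr>ptr := x\<rparr>) (lift_fact p f) \<longleftrightarrow> (\<exists>u y. walk G c q u \<and>
        {(Visible u, Port a), (y, Port b)} \<in> edges (gattach G) \<and>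
        elab (gattach G) {(Visible u, Port a), (y, Port b)} = Some d)"
      unfolding ELab lift_fact.simps holds.simps walk_ptr repointed_simps w by blast
    also have "\<dots> \<longleftrightarrow> (\<exists>u v. walk G c q u \<and> {(u, a), (v, b)} \<in> edges G \<and>
        elab (gattach G) {(Visible u, Port a), (Visible v, Port b)} = Some d)"
      unfolding visible_edge_iff by blast
    also have "\<dots> \<longleftrightarrow> holds (G\<lparr>ptr := c\<rparr>) f" unfolding ELab holds.simps walk_ptr repointed_simps
        using e by metis
    finally show ?thesis .
  qed
qed

text \<open>Visibility has to be observable to be transferred between graphs. Every tree vertex is
  labelled \<open>MLab\<close>, whereas a visible vertex has a \<open>Lab\<close> label or none;
  hence the negative condition, together with the existence of the path.\<close>

lemma visible_fact:
  assumes G: "pointed_graph \<Sigma> \<Delta> \<pi> G" and x: "x \<in> verts (gattach G)"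
  shows "holds (gattach G\<lparr>ptr := x\<rparr>) (Same p p) \<and> \<not> holds (gattach G\<lparr>ptr := x\<rparr>) (VLab p MLab) \<longleftrightarrow>
    (\<exists>v. walk (gattach G) x p (Visible v))" (is "?l \<longleftrightarrow> ?r")
proof -
  note A = pointed_graph_gattach[OF G]
  have lab: "vlab (gattach G) y = Some MLab \<longleftrightarrow> (\<nexists>v. y = Visible v)" if y: "walk (gattach G) x p y"
      for y
  proof -
    have "carrier y \<in> verts G" using walk_verts[OF y A x] verts_gattach by metis
    then show ?thesis by (cases y) (auto simp: vlab_gattach_Visible vlab_gattach_Invisible)
  qed
  have "?l \<longleftrightarrow> (\<exists>y. walk (gattach G) x p y) \<and> (\<nexists>y. walk (gattach G) x p y \<and>
      vlab (gattach G) y = Some MLab)"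
    by simp
  also have "\<dots> \<longleftrightarrow> ?r" using lab walk_det[OF A] by blast
  finally show ?thesis .
qed

lemma depth_le_if_visible:
  assumes "walk (gattach G) x p (Visible v)" shows "depth x \<le> length p"
  using walk_depth[OF walk_sym[OF assms]] by simp

text \<open>The climb from x to its carrier ends at a visible vertex, and this can be observed; so
  the same word leads from x' to a visible vertex. Hence x' is no deeper than x, and facts at both
  carriers are lifted along one common word.\<close>

lemma agree_strip:
  fixes G :: "('v, 'p, 's, 'd) pgraph" and G' :: "('w, 'p, 's, 'd) pgraph"
  assumes G: "pointed_graph \<Sigma> \<Delta> \<pi> G" and x: "x \<in> verts (gattach G)"
    and G': "pointed_graph \<Sigma>' \<Delta>' \<pi>' G'" and x': "x' \<in> verts (gattach G')"
    and A: "agree N (gattach G\<lparr>ptr := x\<rparr>) (gattach G'\<lparr>ptr := x'\<rparr>)" and N: "depth x + m \<le> N"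
  shows "agree m (G\<lparr>ptr := carrier x\<rparr>) (G'\<lparr>ptr := carrier x'\<rparr>)" and "depth x' \<le> depth x"
proof -
  define p :: "'p iport path" where "p = backwards (down_path x)"
  have lp: "length p = depth x" by (simp add: p_def)
  have p: "walk (gattach G) x p (Visible (carrier x))"
    unfolding p_def using walk_up_path x verts_gattach by metis
  have "fact_size (Same p p) \<le> N" "fact_size (VLab p MLab) \<le> N" using lp N by simp_all
  then have "\<exists>v. walk (gattach G') x' p (Visible v)"
    using visible_fact[OF G x] visible_fact[OF G' x'] p agreeD[OF A] by blast
  then obtain v where v: "walk (gattach G') x' p (Visible v)" ..
  \<comment> \<open>A walk without visible letters keeps its carrier, so the visible vertex reached
    from x' is the carrier of x'.\<close>
  moreover have "visible_part p = []" by (simp add: p_def)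
  ultimately have p': "walk (gattach G') x' p (Visible (carrier x'))"
    using walk_project[OF v] by simp
  show "depth x' \<le> depth x" using depth_le_if_visible[OF v] lp by simp
  show "agree m (G\<lparr>ptr := carrier x\<rparr>) (G'\<lparr>ptr := carrier x'\<rparr>)"
    unfolding agree_def
  proof (intro allI impI)
    fix f :: "('p, 's, 'd) fact" assume "fact_size f \<le> m"
    then have "fact_size (lift_fact p f) \<le> N" using lp N by (simp add: lift_fact_size)
    then show "holds (G\<lparr>ptr := carrier x\<rparr>) f = holds (G'\<lparr>ptr := carrier x'\<rparr>) f"
      using holds_lift[OF G p] holds_lift[OF G' p'] agreeD[OF A] by metis
  qed
qed

section \<open>Invisible matter graphs pointed anywhere, and their projection\<close>

abbreviation im :: "('v, 'p, 's, 'd) pgraph \<Rightarrow> 'v ivertex \<Rightarrow> ('v ivertex, 'p iport, 's ilabel, 'd)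
    pgraph" where
  "im G x \<equiv> gattach G\<lparr>ptr := x\<rparr>"

lemma pointed_graph_im:
  assumes "pointed_graph \<Sigma> \<Delta> \<pi> G" "x \<in> verts (gattach G)"
  shows "pointed_graph (ilabels \<Sigma>) \<Delta> (iports \<pi>) (im G x)"
  using pointed_graph_ptr[OF pointed_graph_gattach[OF assms(1)] assms(2)] .

lemma gattach_ptr: "gattach (G\<lparr>ptr := v\<rparr>) = im G (Visible v)"
  unfolding gattach_def repointed_simps by simp

lemma im_ptr: "im G (Visible (ptr G)) = gattach G"
  by (simp add: gattach_def)

lemma attach_repoint:
  assumes G: "pointed_graph \<Sigma> \<Delta> \<pi> (G :: (nat, 'p, 's, 'd) pgraph)" and v: "v \<in> verts G"
  shows "attach (modulo (G\<lparr>ptr := v\<rparr>)) = modulo (im G (Visible v))"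
  using attach_modulo[OF pointed_graph_ptr[OF G v]] gattach_ptr by metis

lemma Visible_verts: "v \<in> verts G \<Longrightarrow> Visible v \<in> verts (gattach G)"
  by (simp add: verts_gattach)

lemma Invisible_verts: "v \<in> verts G \<Longrightarrow> Invisible v ds \<in> verts (gattach G)"
  by (simp add: verts_gattach)

lemma repoint_im:
  assumes G: "pointed_graph \<Sigma> \<Delta> \<pi> G" and x: "x \<in> verts (gattach G)" and y: "y \<in> verts (gattach G)"
  shows "repoint (modulo (im G x)) (paths_to (im G x) y) = modulo (im G y)"
  using repoint_modulo_any[OF pointed_graph_im[OF G x], of y] y by simp

lemma dive_modulo:
  assumes G: "pointed_graph \<Sigma> \<Delta> \<pi> (G :: (nat, 'p, 's, 'd) pgraph)" and v: "v \<in> verts G"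
  shows "dive (modulo (G\<lparr>ptr := v\<rparr>)) (tree_path ds) = modulo (im G (Invisible v ds))"
proof -
  note K = pointed_graph_im[OF G Visible_verts[OF v]]
  have "walk (im G (Visible v)) (ptr (im G (Visible v))) (dot @ tree_path ds) (Invisible v ds)"
    using walk_append[OF walk_dot[OF v] walk_tree_path[OF v, of "[]" ds]] by simp
  then have "vertex (modulo (im G (Visible v))) (dot @ tree_path ds) = paths_to (im G (Visible v))
      (Invisible v ds)"
    by (rule vertex_modulo_walk[OF K])
  then show ?thesis
    unfolding dive_def attach_repoint[OF G v]
    using repoint_im[OF G Visible_verts[OF v] Invisible_verts[OF v]] by simp
qed

lemma imgraphsI:
  assumes G: "pointed_graph \<Sigma> \<Delta> \<pi> (G :: (nat, 'p, 's, 'd) pgraph)" and x: "x \<in> verts (gattach G)"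
  shows "modulo (im G x) \<in> imgraphs \<Sigma> \<Delta> \<pi>"
proof -
  note K = pointed_graph_gattach[OF G]
  have "repoint (attach (modulo G)) (paths_to (gattach G) x) = modulo (im G x)"
    using repoint_modulo_any[OF K x] attach_modulo[OF G] by simp
  moreover have "paths_to (gattach G) x \<in> V (attach (modulo G))"
    using V_modulo[OF K] attach_modulo[OF G] x by simp
  ultimately show ?thesis unfolding imgraphs_def using modulo_in_pgms[OF G] by blast
qed

lemma imgraphsE:
  assumes "Y \<in> imgraphs \<Sigma> \<Delta> \<pi>"
  obtains G :: "(nat, 'p, 's, 'd) pgraph" and x where "pointed_graph \<Sigma> \<Delta> \<pi> G"
    "x \<in> verts (gattach G)" "Y = modulo (im G x)"
proof -
  obtain X u where X: "X \<in> pgms \<Sigma> \<Delta> \<pi>" "u \<in> V (attach X)" "Y = repoint (attach X) u"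
    using assms unfolding imgraphs_def by blast
  obtain G :: "(nat, 'p, 's, 'd) pgraph" where G: "pointed_graph \<Sigma> \<Delta> \<pi> G" "X = modulo G"
    using pgmsE[OF X(1)] .
  note K = pointed_graph_gattach[OF G(1)]
  have a: "attach X = modulo (gattach G)" using attach_modulo[OF G(1)] G(2) by simp
  obtain x where x: "x \<in> verts (gattach G)" "u = paths_to (gattach G) x"
    using X(2) unfolding a V_modulo[OF K] by blast
  show ?thesis
    using that[OF G(1) x(1)] X(3) repoint_modulo_any[OF K x(1)] unfolding a x(2) by simp
qed

text \<open>Uniqueness behind the \<open>THE\<close> of \<open>proj_graph\<close>: equal classes
  agree on facts of all sizes, so the stripped graphs do as well and are isomorphic.\<close>

lemma strip_unique:
  assumes G: "pointed_graph \<Sigma> \<Delta> \<pi> G" and x: "x \<in> verts (gattach G)"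
    and H: "pointed_graph \<Sigma>' \<Delta>' \<pi>' H" and y: "y \<in> verts (gattach H)"
    and eq: "modulo (im G x) = modulo (im H y)"
  shows "modulo (G\<lparr>ptr := carrier x\<rparr>) = modulo (H\<lparr>ptr := carrier y\<rparr>)"
proof -
  note K = pointed_graph_im[OF G x] and L = pointed_graph_im[OF H y]
  have "isomorphic (im G x) (im H y)" using eq modulo_eq_iff[OF K L] by simp
  then have "agree n (im G x) (im H y)" for n using holds_iso[OF _ K L] by (simp add: agree_def)
  then have "agree m (G\<lparr>ptr := carrier x\<rparr>) (H\<lparr>ptr := carrier y\<rparr>)" for m
    using agree_strip(1)[OF G x H y _ order_refl] by blast
  moreover have G': "pointed_graph \<Sigma> \<Delta> \<pi> (G\<lparr>ptr := carrier x\<rparr>)"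
    using pointed_graph_ptr[OF G] x verts_gattach by metis
  moreover have H': "pointed_graph \<Sigma>' \<Delta>' \<pi>' (H\<lparr>ptr := carrier y\<rparr>)"
    using pointed_graph_ptr[OF H] y verts_gattach by metis
  ultimately show ?thesis using modulo_eq_iff[OF G' H'] isomorphic_if_agree by blast
qed

lemma proj_graph_modulo:
  assumes H: "pointed_graph \<Sigma> \<Delta> \<pi> (H :: (nat, 'p, 's, 'd) pgraph)" and x: "x \<in> verts (gattach H)"
    and F: "F (attach X) = modulo (im H x)"
  shows "proj_graph \<Sigma> \<Delta> \<pi> F X = modulo (H\<lparr>ptr := carrier x\<rparr>)"
  unfolding proj_graph_def
proof (rule the_equality)
  have c: "carrier x \<in> verts H" using x verts_gattach by metis
  show "modulo (H\<lparr>ptr := carrier x\<rparr>) \<in> pgms \<Sigma> \<Delta> \<pi> \<and> (F (attach X) = attach (modulo (H\<lparr>ptr :=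
      carrier x\<rparr>)) \<or>
      (\<exists>t\<in>tree_paths. F (attach X) = dive (modulo (H\<lparr>ptr := carrier x\<rparr>)) t))"
  proof (intro conjI)
    show "modulo (H\<lparr>ptr := carrier x\<rparr>) \<in> pgms \<Sigma> \<Delta> \<pi>"
      by (rule modulo_in_pgms[OF pointed_graph_ptr[OF H c]])
    show "F (attach X) = attach (modulo (H\<lparr>ptr := carrier x\<rparr>)) \<or>
      (\<exists>t\<in>tree_paths. F (attach X) = dive (modulo (H\<lparr>ptr := carrier x\<rparr>)) t)"
    proof (cases x)
      case (Visible v)
      then show ?thesis using F attach_repoint[OF H c] by simp
    next
      case (Invisible v ds)
      have "tree_path ds \<in> tree_paths" unfolding tree_paths_eq by blast
      moreover have "F (attach X) = dive (modulo (H\<lparr>ptr := carrier x\<rparr>)) (tree_path ds)"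
        using F dive_modulo[OF H c] Invisible by simp
      ultimately show ?thesis by blast
    qed
  qed
next
  fix X' :: "('p, 's, 'd) pgm"
  assume X': "X' \<in> pgms \<Sigma> \<Delta> \<pi> \<and> (F (attach X) = attach X' \<or> (\<exists>t\<in>tree_paths. F (attach X) = dive X'
      t))"
  then obtain G :: "(nat, 'p, 's, 'd) pgraph" where G: "pointed_graph \<Sigma> \<Delta> \<pi> G" "X' = modulo G"
    using pgmsE by blast
  note p = pgD(2)[OF G(1)]
  have "\<exists>y. y \<in> verts (gattach G) \<and> carrier y = ptr G \<and> modulo (im H x) = modulo (im G y)"
    using X'
  proof (elim conjE disjE bexE)
    assume "F (attach X) = attach X'"
    then show ?thesis
      using F attach_repoint[OF G(1) p] G(2) Visible_verts[OF p]
          by (intro exI[of _ "Visible (ptr G)"]) simp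
  next
    fix t :: "'p iport path" assume "t \<in> tree_paths" "F (attach X) = dive X' t"
    moreover from this obtain ds where "t = tree_path ds" unfolding tree_paths_eq by blast
    ultimately show ?thesis
      using F dive_modulo[OF G(1) p] G(2) Invisible_verts[OF p]
      by (intro exI[of _ "Invisible (ptr G) ds"]) simp
  qed
  then obtain y where y: "y \<in> verts (gattach G)" "carrier y = ptr G" "modulo (im H x) = modulo (im
      G y)"
    by blast
  then show "X' = modulo (H\<lparr>ptr := carrier x\<rparr>)"
    using strip_unique[OF H x G(1) y(1) y(3)] G(2) by simp
qed

lemma visible_vertex_modulo:
  assumes G: "pointed_graph \<Sigma> \<Delta> \<pi> (G :: (nat, 'p, 's, 'd) pgraph)" and v: "v \<in> verts G"
  shows "visible_vertex (modulo G) (paths_to G v) = paths_to (gattach G) (Visible v)"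
proof -
  have "vertex (attach (modulo G)) (visible_path w) = paths_to (gattach G) (Visible v)"
    if "w \<in> paths_to G v" for w
    unfolding attach_modulo[OF G]
    using that by (intro vertex_modulo_walk[OF pointed_graph_gattach[OF G]]) (simp add:
        walk_gattach)
  then have "visible_vertex (modulo G) (paths_to G v) = (\<Union>w\<in>paths_to G v. paths_to (gattach G)
      (Visible v))"
    unfolding visible_vertex_def by (intro SUP_cong refl)
  then show ?thesis using paths_to_nonempty[OF G v] by simp
qed

text \<open>All the words allowed by \<open>carried\<close> have visible part w, so projecting any
  of them yields the walk of the carriers.\<close>

lemma carried_imp_walk:
  fixes G :: "('v, 'p, 's, 'd) pgraph"
  assumes G: "pointed_graph \<Sigma> \<Delta> \<pi> G" and x: "x \<in> verts (gattach G)" and y: "y \<in> verts (gattach G)"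
    and c: "carried (modulo (im G x)) (paths_to (im G x) y) w"
  shows "walk G (carrier x) w (carrier y)"
proof -
  note K = pointed_graph_im[OF G x]
  have vp: "visible_part s = []" "visible_part (backwards s) = []" if "s \<in> tree_paths"
      for s :: "'p iport path"
    using that unfolding tree_paths_eq by auto
  obtain s t where st: "s \<in> tree_paths" "t \<in> tree_paths"
    and *: "paths_to (im G x) y \<in> vertex (modulo (im G x)) `
        {backwards s @ dot @ visible_path w @ dot @ t, backwards s @ dot @ visible_path w,
         visible_path w @ dot @ t, visible_path w} \<or>
      w = [] \<and> paths_to (im G x) y \<in> vertex (modulo (im G x)) ` {backwards s @ t, backwards s, t}"
    using c unfolding carried_def by blast
  have "\<exists>p. paths_to (im G x) y = vertex (modulo (im G x)) p \<and> visible_part p = w"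
    using *
  proof (elim disjE conjE)
    assume "paths_to (im G x) y \<in> vertex (modulo (im G x)) `
        {backwards s @ dot @ visible_path w @ dot @ t, backwards s @ dot @ visible_path w,
         visible_path w @ dot @ t, visible_path w}"
    then show ?thesis using vp[OF st(1)] vp[OF st(2)] by (elim imageE) (auto intro!: exI)
  next
    assume "w = []" "paths_to (im G x) y \<in> vertex (modulo (im G x)) ` {backwards s @ t, backwards
        s, t}"
    then show ?thesis using vp[OF st(1)] vp[OF st(2)] by (elim imageE) (auto intro!: exI)
  qed
  then obtain p where p: "paths_to (im G x) y = vertex (modulo (im G x)) p" "visible_part p = w"
      by blast
  \<comment> \<open>A word that is not a path designates the empty set; a nonempty vertex therefore
    makes p a real path.\<close>
  have "vertex (modulo (im G x)) p \<noteq> {}" using paths_to_nonempty[OF K, of y] y p(1) by simp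
  then obtain z where z: "walk (im G x) (ptr (im G x)) p z" unfolding vertex_modulo[OF K] by blast
  have "p \<in> paths_to (im G x) y" unfolding p(1) vertex_modulo[OF K] using z by blast
  then have "walk (gattach G) x p y" by simp
  then show ?thesis using walk_project p(2) by blast
qed

lemma walk_imp_carried:
  fixes G :: "('v, 'p, 's, 'd) pgraph"
  assumes G: "pointed_graph \<Sigma> \<Delta> \<pi> G" and x: "x \<in> verts (gattach G)" and y: "y \<in> verts (gattach G)"
    and w: "walk G (carrier x) w (carrier y)"
  shows "carried (modulo (im G x)) (paths_to (im G x) y) w"
proof -
  note K = pointed_graph_im[OF G x]
  define p where "p = backwards (down_path x) @ visible_path w @ down_path y"
  have "walk (gattach G) x p y"
    unfolding p_def using walk_append[OF walk_up_path walk_append[OF walk_gattach[OF w]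
        walk_down_path]]
      x y verts_gattach by metis
  then have v: "paths_to (im G x) y = vertex (modulo (im G x)) p"
    using vertex_modulo_walk[OF K, of p y] by simp
  have t: "(tree_path ds :: 'p iport path) \<in> tree_paths" for ds unfolding tree_paths_eq by blast
  have "\<exists>s\<in>tree_paths. \<exists>t\<in>tree_paths.
      p \<in> {backwards s @ dot @ visible_path w @ dot @ t, backwards s @ dot @ visible_path w,
         visible_path w @ dot @ t, visible_path w}"
  proof -
    have d: "backwards (dot @ s) = backwards s @ dot" for s :: "'p iport path"
        by (simp add: backwards_def)
    \<comment> \<open>For a visible vertex the empty tree word is a placeholder: the form that
      matches has no tree word at that end.\<close>
    define s where "s x = (case x of Visible _ \<Rightarrow> (tree_path [] :: 'p iport path) | Invisible _ ds
        \<Rightarrow> tree_path ds)" for x :: "'v ivertex"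
    have "s x \<in> tree_paths" "s y \<in> tree_paths" using t t[of "[]"]
        by (simp_all add: s_def split: ivertex.split)
    moreover have "p \<in> {backwards (s x) @ dot @ visible_path w @ dot @ s y, backwards (s x) @ dot
        @ visible_path w,
         visible_path w @ dot @ s y, visible_path w}"
      unfolding p_def s_def by (cases x; cases y) (simp_all only: down_path.simps d ivertex.case
          append_assoc
         append_Nil append_Nil2 backwards_Nil insert_iff simp_thms)
    ultimately show ?thesis by blast
  qed
  then show ?thesis unfolding carried_def v by blast
qed

text \<open>Different words may satisfy \<open>carried\<close>, but all of them run from
  \<open>carrier x\<close> to \<open>carrier y\<close>, so the vertex described by
  \<open>THE\<close> is unique.\<close>

lemma proj_vertex_modulo:
  assumes G: "pointed_graph \<Sigma> \<Delta> \<pi> (G :: (nat, 'p, 's, 'd) pgraph)" and v: "v \<in> verts G"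
    and H: "pointed_graph \<Sigma> \<Delta> \<pi> (H :: (nat, 'p, 's, 'd) pgraph)" and x: "x \<in> verts (gattach H)"
    and y: "y \<in> verts (gattach H)" and F: "F (attach (modulo G)) = modulo (im H x)"
    and R: "R (attach (modulo G)) (paths_to (gattach G) (Visible v)) = paths_to (im H x) y"
  shows "proj_vertex \<Sigma> \<Delta> \<pi> F R (modulo G) (paths_to G v) = paths_to (H\<lparr>ptr := carrier x\<rparr>) (carrier
      y)"
  unfolding proj_vertex_def visible_vertex_modulo[OF G v] R proj_graph_modulo[where F = F, OF H x
      F] F
proof (rule the_equality)
  have cx: "carrier x \<in> verts H" and cy: "carrier y \<in> verts H" using x y verts_gattach by metis+
  note H' = pointed_graph_ptr[OF H cx]
  obtain w where w: "walk H (carrier x) w (carrier y)" using pgD(10)[OF H cx cy] by blast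
  show "paths_to (H\<lparr>ptr := carrier x\<rparr>) (carrier y) \<in> V (modulo (H\<lparr>ptr := carrier x\<rparr>)) \<and>
      (\<exists>w\<in>paths_to (H\<lparr>ptr := carrier x\<rparr>) (carrier y). carried (modulo (im H x)) (paths_to (im H x)
          y) w)"
  proof
    show "paths_to (H\<lparr>ptr := carrier x\<rparr>) (carrier y) \<in> V (modulo (H\<lparr>ptr := carrier x\<rparr>))"
      unfolding V_modulo[OF H'] using cy by simp
    show "\<exists>w\<in>paths_to (H\<lparr>ptr := carrier x\<rparr>) (carrier y). carried (modulo (im H x)) (paths_to (im H
        x) y) w"
      using walk_imp_carried[OF H x y w] w by (intro bexI[of _ w]) simp_all
  qed
  fix u assume u: "u \<in> V (modulo (H\<lparr>ptr := carrier x\<rparr>)) \<and>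
    (\<exists>w\<in>u. carried (modulo (im H x)) (paths_to (im H x) y) w)"
  then obtain c w where c: "u = paths_to (H\<lparr>ptr := carrier x\<rparr>) c" "w \<in> u"
    "carried (modulo (im H x)) (paths_to (im H x) y) w" unfolding V_modulo[OF H'] by blast
  have "walk H (carrier x) w c" using c(1,2) by simp
  then have "c = carrier y" using carried_imp_walk[OF H x y c(3)] walk_det[OF H] by metis
  then show "u = paths_to (H\<lparr>ptr := carrier x\<rparr>) (carrier y)" using c(1) by simp
qed


section \<open>The projected dynamics\<close>

lemma length_visible_part: "length (visible_part w) \<le> length w"
  by (induction w rule: visible_part.induct) simp_all

lemma vertex_in_V:
  assumes G: "pointed_graph \<Sigma> \<Delta> \<pi> G" and "u \<in> V (modulo G)" "w \<in> u"
  shows "u = vertex (modulo G) w"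
  using assms vertex_modulo_walk[OF G] unfolding V_modulo[OF G] by fastforce

locale im_dynamics =
  fixes \<Sigma> :: "'s set" and \<Delta> :: "'d set" and \<pi> :: "'p set"
    and F :: "('p iport, 's ilabel, 'd) gmap" and R :: "('p iport, 's ilabel, 'd) vmap"
  assumes fin: "finite \<Sigma>" "finite \<Delta>" "finite \<pi>"
    and imcgd: "imcgd \<Sigma> \<Delta> \<pi> F R"
begin

text \<open>In terms of concrete graphs, \<open>F\<close> sends \<open>G\<close> to a graph \<open>H\<close> and \<open>R\<close> is a bijection between the
  vertices of \<open>G\<close> and \<open>H\<close> with trees attached, the same for all choices of the pointer.\<close>

definition transports ::
  "(nat, 'p, 's, 'd) pgraph \<Rightarrow> (nat, 'p, 's, 'd) pgraph \<Rightarrow> (nat ivertex \<Rightarrow> nat ivertex) \<Rightarrow> bool" where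
  "transports G H \<rho> \<longleftrightarrow> pointed_graph \<Sigma> \<Delta> \<pi> H \<and>
     bij_betw \<rho> (verts (gattach G)) (verts (gattach H)) \<and>
     (\<forall>x\<in>verts (gattach G). F (modulo (im G x)) = modulo (im H (\<rho> x)) \<and>
       (\<forall>y\<in>verts (gattach G). R (modulo (im G x)) (paths_to (im G x) y) = paths_to (im H (\<rho> x)) (\<rho>
           y)))"

text \<open>\<open>\<rho>\<close> is read off with \<open>G\<close> at its own pointer.
  Shift-invariance extends it to a pointer x: the graph equation re-points \<open>H\<close> at
  \<open>\<rho> x\<close>, and in the vertex equation the detour through x composes away, which
  leaves \<open>\<rho> y\<close>.\<close>

lemma ex_transports:
  assumes G: "pointed_graph \<Sigma> \<Delta> \<pi> (G :: (nat, 'p, 's, 'd) pgraph)"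
  shows "\<exists>H \<rho>. transports G H \<rho>"
proof -
  let ?S = "imgraphs \<Sigma> \<Delta> \<pi>"
  have dyn: "dynamics ?S F R" and shift: "shift_invariant ?S F R" and vp: "vertex_preserving ?S F R"
    using imcgd unfolding imcgd_def cgd_def by simp_all
  define q where "q = Visible (ptr G)"
  have q: "q \<in> verts (gattach G)" unfolding q_def by (rule Visible_verts[OF pgD(2)[OF G]])
  note K = pointed_graph_im[OF G q]
  have S: "modulo (im G q) \<in> ?S" by (rule imgraphsI[OF G q])
  have "F (modulo (im G q)) \<in> ?S" using dyn S unfolding dynamics_def by blast
  then obtain H :: "(nat, 'p, 's, 'd) pgraph" and h where H: "pointed_graph \<Sigma> \<Delta> \<pi> H"
    and h: "h \<in> verts (gattach H)" and F: "F (modulo (im G q)) = modulo (im H h)" using imgraphsE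
        by metis
  note L = pointed_graph_im[OF H h]
  have VG: "V (modulo (im G q)) = paths_to (im G q) ` verts (gattach G)"
    using V_modulo[OF K] by simp
  have VH: "V (modulo (im H h)) = paths_to (im H h) ` verts (gattach H)"
    using V_modulo[OF L] by simp
  have RV: "R (modulo (im G q)) u \<in> V (modulo (im H h))" if "u \<in> V (modulo (im G q))" for u
    using dyn S that F unfolding dynamics_def by metis
  have "\<exists>y'. y' \<in> verts (gattach H) \<and> R (modulo (im G q)) (paths_to (im G q) y) = paths_to (im H
      h) y'"
    if "y \<in> verts (gattach G)" for y
  proof -
    have "R (modulo (im G q)) (paths_to (im G q) y) \<in> paths_to (im H h) ` verts (gattach H)"
      using RV[of "paths_to (im G q) y"] that unfolding VG VH by blast
    then show ?thesis by blast
  qed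
  then obtain \<rho> where \<rho>: "\<And>y. y \<in> verts (gattach G) \<Longrightarrow> \<rho> y \<in> verts (gattach H)"
    "\<And>y. y \<in> verts (gattach G) \<Longrightarrow> R (modulo (im G q)) (paths_to (im G q) y) = paths_to (im H h) (\<rho>
        y)"
    by metis
  have injK: "inj_on (paths_to (im G q)) (verts (gattach G))"
    using paths_to_inj[OF K] by (intro inj_onI) simp
  have "bij_betw (R (modulo (im G q))) (paths_to (im G q) ` verts (gattach G)) (paths_to (im H h)
      ` verts (gattach H))"
    using vp S F unfolding vertex_preserving_def VG[symmetric] VH[symmetric] by metis
  then have "bij_betw (R (modulo (im G q)) \<circ> paths_to (im G q)) (verts (gattach G)) (paths_to (im
      H h) ` verts (gattach H))"
    by (rule bij_betw_trans[OF inj_on_imp_bij_betw[OF injK]])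
  then have b: "bij_betw (\<lambda>y. paths_to (im H h) (\<rho> y)) (verts (gattach G)) (paths_to (im H h) `
      verts (gattach H))"
    using \<rho>(2) by (subst (asm) bij_betw_cong[where g = "\<lambda>y. paths_to (im H h) (\<rho> y)"]) simp_all
  \<comment> \<open>Vertex preservation speaks of path sets; injectivity of \<open>paths_to\<close>
    hands bijectivity down to concrete vertices.\<close>
  have bij: "bij_betw \<rho> (verts (gattach G)) (verts (gattach H))"
    unfolding bij_betw_def
  proof
    show "inj_on \<rho> (verts (gattach G))"
      using bij_betw_imp_inj_on[OF b] by (auto simp: inj_on_def)
    show "\<rho> ` verts (gattach G) = verts (gattach H)"
    proof (intro equalityI subsetI)
      fix z assume z: "z \<in> verts (gattach H)"
      then have "paths_to (im H h) z \<in> (\<lambda>y. paths_to (im H h) (\<rho> y)) ` verts (gattach G)"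
        using bij_betw_imp_surj_on[OF b] by blast
      then obtain y where y: "y \<in> verts (gattach G)" "paths_to (im H h) z = paths_to (im H h) (\<rho>
          y)" by blast
      then show "z \<in> \<rho> ` verts (gattach G)" using paths_to_inj[OF L _ y(2)] z by simp
    qed (use \<rho>(1) in blast)
  qed
  have "F (modulo (im G x)) = modulo (im H (\<rho> x)) \<and>
       (\<forall>y\<in>verts (gattach G). R (modulo (im G x)) (paths_to (im G x) y) = paths_to (im H (\<rho> x)) (\<rho>
           y))"
    if x: "x \<in> verts (gattach G)" for x
  proof -
    have u: "paths_to (im G q) x \<in> V (modulo (im G q))" using x unfolding VG by blast
    have rG: "repoint (modulo (im G q)) (paths_to (im G q) x) = modulo (im G x)"
      by (rule repoint_im[OF G q x])
    have rH: "repoint (modulo (im H h)) (paths_to (im H h) (\<rho> x)) = modulo (im H (\<rho> x))"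
      by (rule repoint_im[OF H h \<rho>(1)[OF x]])
    note sh = shift[unfolded shift_invariant_def, rule_format, OF S u, unfolded rG F \<rho>(2)[OF x] rH]
    have Fx: "F (modulo (im G x)) = modulo (im H (\<rho> x))" using sh by blast
    moreover have "R (modulo (im G x)) (paths_to (im G x) y) = paths_to (im H (\<rho> x)) (\<rho> y)"
      if y: "y \<in> verts (gattach G)" for y
    proof -
      note Kx = pointed_graph_im[OF G x] and Lx = pointed_graph_im[OF H \<rho>(1)[OF x]]
      have yV: "paths_to (im G x) y \<in> V (modulo (im G x))" unfolding V_modulo[OF Kx] using y by simp
      then have "R (modulo (im G x)) (paths_to (im G x) y) \<in> V (modulo (im H (\<rho> x)))"
        using dyn imgraphsI[OF G x] Fx unfolding dynamics_def by metis
      then obtain z where z: "z \<in> verts (gattach H)"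
        "R (modulo (im G x)) (paths_to (im G x) y) = paths_to (im H (\<rho> x)) z"
        unfolding V_modulo[OF Lx] by auto
      have "cat (modulo (im G q)) (paths_to (im G q) x) (paths_to (im G x) y) = paths_to (im G q) y"
        using paths_to_nonempty[OF K, of x] paths_to_nonempty[OF Kx, of y] x y
        by (intro cat_modulo[OF K order_refl]) simp_all
      then have "paths_to (im H h) (\<rho> y) =
          cat (modulo (im H h)) (paths_to (im H h) (\<rho> x)) (paths_to (im H (\<rho> x)) z)"
        using sh yV z(2) \<rho>(2)[OF y] by metis
      also have "\<dots> = paths_to (im H h) z"
        using paths_to_nonempty[OF L, of "\<rho> x"] paths_to_nonempty[OF Lx, of z] \<rho>(1)[OF x] z(1)
        by (intro cat_modulo[OF L order_refl]) simp_all
      finally have "\<rho> y = z" using paths_to_inj[OF L, of "\<rho> y" z] \<rho>(1)[OF y] by simp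
      then show ?thesis using z(2) by simp
    qed
    ultimately show ?thesis by blast
  qed
  then have "transports G H \<rho>" unfolding transports_def using H bij by blast
  then show ?thesis by blast
qed

abbreviation F' :: "('p, 's, 'd) gmap" where
  "F' \<equiv> proj_graph \<Sigma> \<Delta> \<pi> F"

abbreviation R' :: "('p, 's, 'd) vmap" where
  "R' \<equiv> proj_vertex \<Sigma> \<Delta> \<pi> F R"

lemma transportsD:
  assumes G: "pointed_graph \<Sigma> \<Delta> \<pi> (G :: (nat, 'p, 's, 'd) pgraph)" and t: "transports G H \<rho>"
  shows "pointed_graph \<Sigma> \<Delta> \<pi> H"
    and "bij_betw \<rho> (verts (gattach G)) (verts (gattach H))"
    and "\<And>x. x \<in> verts (gattach G) \<Longrightarrow> F (modulo (im G x)) = modulo (im H (\<rho> x))"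
    and "\<And>x y. x \<in> verts (gattach G) \<Longrightarrow> y \<in> verts (gattach G) \<Longrightarrow>
      R (modulo (im G x)) (paths_to (im G x) y) = paths_to (im H (\<rho> x)) (\<rho> y)"
    and "\<And>x. x \<in> verts (gattach G) \<Longrightarrow> \<rho> x \<in> verts (gattach H)"
    and "\<And>x. x \<in> verts (gattach G) \<Longrightarrow> carrier (\<rho> x) \<in> verts H"
    and "\<And>v. v \<in> verts G \<Longrightarrow> F' (modulo (G\<lparr>ptr := v\<rparr>)) = modulo (H\<lparr>ptr := carrier (\<rho> (Visible v))\<rparr>)"
    and "\<And>v u. v \<in> verts G \<Longrightarrow> u \<in> verts G \<Longrightarrow> R' (modulo (G\<lparr>ptr := v\<rparr>)) (paths_to (G\<lparr>ptr := v\<rparr>) u) =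
      paths_to (H\<lparr>ptr := carrier (\<rho> (Visible v))\<rparr>) (carrier (\<rho> (Visible u)))"
proof -
  show H: "pointed_graph \<Sigma> \<Delta> \<pi> H" and bij: "bij_betw \<rho> (verts (gattach G)) (verts (gattach H))"
    and F: "\<And>x. x \<in> verts (gattach G) \<Longrightarrow> F (modulo (im G x)) = modulo (im H (\<rho> x))"
    and R: "\<And>x y. x \<in> verts (gattach G) \<Longrightarrow> y \<in> verts (gattach G) \<Longrightarrow>
      R (modulo (im G x)) (paths_to (im G x) y) = paths_to (im H (\<rho> x)) (\<rho> y)"
    using t unfolding transports_def by blast+
  show \<rho>: "\<rho> x \<in> verts (gattach H)" if "x \<in> verts (gattach G)" for x
    using bij that by (rule bij_betwE[rule_format])
  then show "carrier (\<rho> x) \<in> verts H" if "x \<in> verts (gattach G)" for x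
    using that verts_gattach by metis
  show "F' (modulo (G\<lparr>ptr := v\<rparr>)) = modulo (H\<lparr>ptr := carrier (\<rho> (Visible v))\<rparr>)"
      if v: "v \<in> verts G" for v
  proof (rule proj_graph_modulo[OF H \<rho>[OF Visible_verts[OF v]]])
    show "F (attach (modulo (G\<lparr>ptr := v\<rparr>))) = modulo (im H (\<rho> (Visible v)))"
      using attach_repoint[OF G v] F[OF Visible_verts[OF v]] by simp
  qed
  show "R' (modulo (G\<lparr>ptr := v\<rparr>)) (paths_to (G\<lparr>ptr := v\<rparr>) u) =
      paths_to (H\<lparr>ptr := carrier (\<rho> (Visible v))\<rparr>) (carrier (\<rho> (Visible u)))"
    if v: "v \<in> verts G" and u: "u \<in> verts G" for v u
  proof (rule proj_vertex_modulo[OF pointed_graph_ptr[OF G v] _ H \<rho>[OF Visible_verts[OF v]] \<rho>[OF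
      Visible_verts[OF u]]])
    show "u \<in> verts (G\<lparr>ptr := v\<rparr>)" using u by simp
    show "F (attach (modulo (G\<lparr>ptr := v\<rparr>))) = modulo (im H (\<rho> (Visible v)))"
      using attach_repoint[OF G v] F[OF Visible_verts[OF v]] by simp
    show "R (attach (modulo (G\<lparr>ptr := v\<rparr>))) (paths_to (gattach (G\<lparr>ptr := v\<rparr>)) (Visible u)) =
        paths_to (im H (\<rho> (Visible v))) (\<rho> (Visible u))"
      using attach_repoint[OF G v] gattach_ptr[of v G] R[OF Visible_verts[OF v] Visible_verts[OF
          u]] by simp
  qed
qed

section \<open>Well-definedness and shift-invariance of the projection\<close>

lemma dynamics_projection: "dynamics (pgms \<Sigma> \<Delta> \<pi>) F' R'"
  unfolding dynamics_def
proof (intro ballI conjI)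
  fix X :: "('p, 's, 'd) pgm" assume "X \<in> pgms \<Sigma> \<Delta> \<pi>"
  then obtain G :: "(nat, 'p, 's, 'd) pgraph" where G: "pointed_graph \<Sigma> \<Delta> \<pi> G" "X = modulo G"
    using pgmsE by blast
  obtain H \<rho> where t: "transports G H \<rho>" using ex_transports[OF G(1)] by blast
  note T = transportsD[OF G(1) t] and p = pgD(2)[OF G(1)]
  note H = pointed_graph_ptr[OF T(1) T(6)[OF Visible_verts[OF p]]]
  have FX: "F' X = modulo (H\<lparr>ptr := carrier (\<rho> (Visible (ptr G)))\<rparr>)" using T(7)[OF p] G(2) by simp
  show "F' X \<in> pgms \<Sigma> \<Delta> \<pi>" unfolding FX by (rule modulo_in_pgms[OF H])
  fix u assume "u \<in> V X"
  then obtain v where v: "v \<in> verts G" "u = paths_to G v" using V_modulo[OF G(1)] G(2) by blast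
  have "R' X u = paths_to (H\<lparr>ptr := carrier (\<rho> (Visible (ptr G)))\<rparr>) (carrier (\<rho> (Visible v)))"
    using T(8)[OF p v(1)] G(2) v(2) by simp
  then show "R' X u \<in> V (F' X)" unfolding FX V_modulo[OF H] using T(6)[OF Visible_verts[OF v(1)]]
      by simp
qed

lemma shift_invariant_projection: "shift_invariant (pgms \<Sigma> \<Delta> \<pi>) F' R'"
  unfolding shift_invariant_def
proof (intro ballI conjI)
  fix X :: "('p, 's, 'd) pgm" and u assume X: "X \<in> pgms \<Sigma> \<Delta> \<pi>" and u: "u \<in> V X"
  obtain G :: "(nat, 'p, 's, 'd) pgraph" where G: "pointed_graph \<Sigma> \<Delta> \<pi> G" "X = modulo G"
    using pgmsE[OF X] by blast
  obtain v where v: "v \<in> verts G" "u = paths_to G v" using V_modulo[OF G(1)] G(2) u by blast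
  obtain H \<rho> where t: "transports G H \<rho>" using ex_transports[OF G(1)] by blast
  note T = transportsD[OF G(1) t] and p = pgD(2)[OF G(1)]
  define h where "h v = carrier (\<rho> (Visible v))" for v
  have h: "h v \<in> verts H" if "v \<in> verts G" for v unfolding h_def
      by (rule T(6)[OF Visible_verts[OF that]])
  note H = pointed_graph_ptr[OF T(1) h[OF p]] and Hv = pointed_graph_ptr[OF T(1) h[OF v(1)]]
  note Gv = pointed_graph_ptr[OF G(1) v(1)]
  have FX: "F' X = modulo (H\<lparr>ptr := h (ptr G)\<rparr>)" using T(7)[OF p] G(2) by (simp add: h_def)
  have RX: "R' X (paths_to G x) = paths_to (H\<lparr>ptr := h (ptr G)\<rparr>) (h x)" if "x \<in> verts G" for x
    using T(8)[OF p that] G(2) by (simp add: h_def)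
  have rX: "repoint X u = modulo (G\<lparr>ptr := v\<rparr>)"
    using repoint_modulo_any[OF G(1) v(1)] G(2) v(2) by simp
  have rF: "repoint (F' X) (R' X u) = modulo (H\<lparr>ptr := h v\<rparr>)"
    unfolding FX v(2) RX[OF v(1)] using repoint_modulo_any[OF H, of "h v"] h[OF v(1)] by simp
  show "F' (repoint X u) = repoint (F' X) (R' X u)"
    unfolding rF rX using T(7)[OF v(1)] by (simp add: h_def)
  fix w assume "w \<in> V (repoint X u)"
  then obtain x where x: "x \<in> verts G" "w = paths_to (G\<lparr>ptr := v\<rparr>) x"
    unfolding rX V_modulo[OF Gv] by auto
  have "cat X u w = paths_to G x"
    unfolding G(2) v(2) x(2) using paths_to_nonempty[OF G(1) v(1)] paths_to_nonempty[OF Gv, of x]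
        x(1)
    by (intro cat_modulo[OF G(1) order_refl _ order_refl]) simp_all
  moreover have "R' (repoint X u) w = paths_to (H\<lparr>ptr := h v\<rparr>) (h x)"
    unfolding rX x(2) using T(8)[OF v(1) x(1)] by (simp add: h_def)
  moreover have "cat (F' X) (R' X u) (paths_to (H\<lparr>ptr := h v\<rparr>) (h x)) = paths_to (H\<lparr>ptr := h (ptr
      G)\<rparr>) (h x)"
    unfolding FX v(2) RX[OF v(1)]
    using paths_to_nonempty[OF H, of "h v"] paths_to_nonempty[OF Hv, of "h x"] h[OF v(1)] h[OF x(1)]
    by (intro cat_modulo[OF H order_refl]) simp_all
  ultimately show "R' X (cat X u w) = cat (F' X) (R' X u) (R' (repoint X u) w)"
    using RX[OF x(1)] by simp
qed

section \<open>Uniform bounds on depth and distance\<close>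

lemma attach_eq_im: "pointed_graph \<Sigma> \<Delta> \<pi> (G :: (nat, 'p, 's, 'd) pgraph) \<Longrightarrow>
    attach (modulo G) = modulo (im G (Visible (ptr G)))"
  using attach_modulo im_ptr by metis

lemma attach_imgraphs:
  assumes "X \<in> pgms \<Sigma> \<Delta> \<pi>" shows "attach X \<in> imgraphs \<Sigma> \<Delta> \<pi>"
proof -
  obtain G :: "(nat, 'p, 's, 'd) pgraph" where G: "pointed_graph \<Sigma> \<Delta> \<pi> G" "X = modulo G"
    using pgmsE[OF assms] by blast
  show ?thesis using imgraphsI[OF G(1) Visible_verts[OF pgD(2)[OF G(1)]]] attach_eq_im[OF G(1)]
      G(2) by simp
qed

text \<open>Continuity with neighbourhoods taken among graphs without trees, where compactness
  holds; \<open>disk_attach_cong\<close> keeps the radius n.\<close>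

lemma continuous_attach:
  assumes X: "X \<in> pgms \<Sigma> \<Delta> \<pi>"
  obtains n where "\<And>u. u \<in> restr_dom m F R (attach X) \<Longrightarrow> trace n (attach X) u \<noteq> {}"
    "\<And>X'. X' \<in> pgms \<Sigma> \<Delta> \<pi> \<Longrightarrow> disk n X' = disk n X \<Longrightarrow> disk m (F (attach X)) = disk m (F (attach X'))"
    "\<And>X'. X' \<in> pgms \<Sigma> \<Delta> \<pi> \<Longrightarrow> disk n X' = disk n X \<Longrightarrow>
      restr_graph n m F R (attach X) = restr_graph n m F R (attach X')"
proof -
  have "continuous (imgraphs \<Sigma> \<Delta> \<pi>) F R" using imcgd unfolding imcgd_def cgd_def by simp
  then obtain n where n: "\<forall>u\<in>restr_dom m F R (attach X). trace n (attach X) u \<noteq> {}"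
    "\<And>Y. Y \<in> imgraphs \<Sigma> \<Delta> \<pi> \<Longrightarrow> disk n Y = disk n (attach X) \<Longrightarrow>
      disk m (F (attach X)) = disk m (F Y) \<and> restr_graph n m F R (attach X) = restr_graph n m F R Y"
    using attach_imgraphs[OF X] unfolding continuous_def by metis
  show ?thesis
  proof (rule that)
    show "trace n (attach X) u \<noteq> {}" if "u \<in> restr_dom m F R (attach X)" for u using n(1) that
        by blast
    fix X' :: "('p, 's, 'd) pgm" assume X': "X' \<in> pgms \<Sigma> \<Delta> \<pi>" "disk n X' = disk n X"
    note n(2)[OF attach_imgraphs[OF X'(1)] disk_attach_cong[OF X'(1) X X'(2)]]
    then show "disk m (F (attach X)) = disk m (F (attach X'))"
      "restr_graph n m F R (attach X) = restr_graph n m F R (attach X')" by simp_all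
  qed
qed

lemma F_attach_im:
  assumes X: "X \<in> pgms \<Sigma> \<Delta> \<pi>"
  obtains H :: "(nat, 'p, 's, 'd) pgraph" and x where "pointed_graph \<Sigma> \<Delta> \<pi> H" "x \<in> verts (gattach
      H)"
    "F (attach X) = modulo (im H x)"
proof -
  have "F (attach X) \<in> imgraphs \<Sigma> \<Delta> \<pi>"
    using imcgd attach_imgraphs[OF X] unfolding imcgd_def cgd_def dynamics_def by simp
  then show ?thesis using that imgraphsE by metis
qed

text \<open>A disk of radius \<open>depth x\<close> around the image pointer x contains the climb to
  a visible vertex. Images of nearby graphs share this climb, so their pointers are no deeper. Depth
  is read on representatives, hence the quantification over all of them.\<close>

lemma uniform_depth:
  obtains D where "\<And>X (H :: (nat, 'p, 's, 'd) pgraph) x. X \<in> pgms \<Sigma> \<Delta> \<pi> \<Longrightarrow> pointed_graph \<Sigma> \<Delta> \<pi> H \<Longrightarrow>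
    x \<in> verts (gattach H) \<Longrightarrow> F (attach X) = modulo (im H x) \<Longrightarrow> depth x \<le> D"
proof -
  define P where "P D X \<longleftrightarrow> (\<forall>(H :: (nat, 'p, 's, 'd) pgraph) x. pointed_graph \<Sigma> \<Delta> \<pi> H \<longrightarrow>
    x \<in> verts (gattach H) \<longrightarrow> F (attach X) = modulo (im H x) \<longrightarrow> depth x \<le> D)" for D X
  have "\<exists>D. \<forall>X\<in>pgms \<Sigma> \<Delta> \<pi>. P D X"
  proof (rule uniform_bound[OF fin])
    show "P N X \<Longrightarrow> N \<le> N' \<Longrightarrow> P N' X" for N N' X unfolding P_def by (meson order_trans)
    fix X :: "('p, 's, 'd) pgm" assume X: "X \<in> pgms \<Sigma> \<Delta> \<pi>"
    obtain H :: "(nat, 'p, 's, 'd) pgraph" and x where H: "pointed_graph \<Sigma> \<Delta> \<pi> H"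
      and x: "x \<in> verts (gattach H)" and FX: "F (attach X) = modulo (im H x)"
          using F_attach_im[OF X] .
    obtain n where n: "\<And>X'. X' \<in> pgms \<Sigma> \<Delta> \<pi> \<Longrightarrow> disk n X' = disk n X \<Longrightarrow>
        disk (depth x) (F (attach X)) = disk (depth x) (F (attach X'))"
      using continuous_attach[OF X, of "depth x"] by metis
    have "P (depth x) X'" if X': "X' \<in> pgms \<Sigma> \<Delta> \<pi>" "disk n X' = disk n X" for X'
      unfolding P_def
    proof (intro allI impI)
      fix H' :: "(nat, 'p, 's, 'd) pgraph" and x'
      assume H': "pointed_graph \<Sigma> \<Delta> \<pi> H'" and x': "x' \<in> verts (gattach H')"
        and FX': "F (attach X') = modulo (im H' x')"
      have "disk (depth x) (modulo (im H x)) = disk (depth x) (modulo (im H' x'))"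
        using n[OF X'] FX FX' by simp
      then have "agree (depth x) (im H x) (im H' x')"
        by (rule agree_if_disk_eq[OF pointed_graph_im[OF H x] pointed_graph_im[OF H' x']])
      then show "depth x' \<le> depth x" using agree_strip(2)[OF H x H' x', of "depth x" 0] by simp
    qed
    then show "\<exists>n N. \<forall>X'\<in>pgms \<Sigma> \<Delta> \<pi>. disk n X' = disk n X \<longrightarrow> P N X'" by blast
  qed
  then show ?thesis using that unfolding P_def by metis
qed

text \<open>Continuity yields only a vertex u' of the nearby graph with the same traces as u, and
  the trace of u need not contain w. A short path \<open>w0\<close> in the trace identifies u', and
  the fact that \<open>w0\<close> and w meet carries over on a larger disk.\<close>

lemma uniform_distance:
  assumes w: "\<And>X. X \<in> pgms \<Sigma> \<Delta> \<pi> \<Longrightarrow> w \<in> paths (attach X)"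
  shows "\<exists>N. \<forall>X\<in>pgms \<Sigma> \<Delta> \<pi>. \<exists>q\<in>R (attach X) (vertex (attach X) w). length q \<le> N"
proof (rule uniform_bound[OF fin])
  show "\<exists>q\<in>R (attach X) (vertex (attach X) w). length q \<le> N \<Longrightarrow> N \<le> N' \<Longrightarrow>
      \<exists>q\<in>R (attach X) (vertex (attach X) w). length q \<le> N'" for N N' X by (meson order_trans)
  fix X :: "('p, 's, 'd) pgm" assume X: "X \<in> pgms \<Sigma> \<Delta> \<pi>"
  define u where "u = vertex (attach X) w"
  have uV: "u \<in> V (attach X)" unfolding u_def V_def using w[OF X] by blast
  obtain H :: "(nat, 'p, 's, 'd) pgraph" and h where H: "pointed_graph \<Sigma> \<Delta> \<pi> H"
    and h: "h \<in> verts (gattach H)" and FX: "F (attach X) = modulo (im H h)"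
        using F_attach_im[OF X] .
  note L = pointed_graph_im[OF H h]
  have "R (attach X) u \<in> V (F (attach X))"
    using imcgd attach_imgraphs[OF X] uV unfolding imcgd_def cgd_def dynamics_def by simp
  then obtain z where z: "z \<in> verts (im H h)" "R (attach X) u = paths_to (im H h) z"
    unfolding FX V_modulo[OF L] by blast
  obtain q where q: "walk (im H h) (ptr (im H h)) q z" using paths_to_obtain[OF L z(1)] .
  define M where "M = length q"
  have qt: "q \<in> trace M (F (attach X)) (R (attach X) u)"
    unfolding FX z(2) trace_modulo[OF L] in_paths_to ptr_gdisk
    by (rule walk_gdisk_short[OF q]) (simp add: M_def)
  then have dom: "u \<in> restr_dom M F R (attach X)" unfolding restr_dom_def using uV by blast
  obtain n where n1: "\<And>u. u \<in> restr_dom M F R (attach X) \<Longrightarrow> trace n (attach X) u \<noteq> {}"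
    and n2: "\<And>X'. X' \<in> pgms \<Sigma> \<Delta> \<pi> \<Longrightarrow> disk n X' = disk n X \<Longrightarrow>
      restr_graph n M F R (attach X) = restr_graph n M F R (attach X')"
    using continuous_attach[OF X, of M] by metis
  obtain G :: "(nat, 'p, 's, 'd) pgraph" where G: "pointed_graph \<Sigma> \<Delta> \<pi> G" "X = modulo G"
    using pgmsE[OF X] by blast
  note K = pointed_graph_gattach[OF G(1)]
  have aX: "attach X = modulo (gattach G)" using attach_modulo[OF G(1)] G(2) by simp
  obtain y where y: "walk (gattach G) (ptr (gattach G)) w y" using w[OF X]
      unfolding aX paths_modulo[OF K] by blast
  have u: "u = paths_to (gattach G) y" unfolding u_def aX by (rule vertex_modulo_walk[OF K y])
  obtain w0 where w0: "length w0 \<le> n + 1" "walk (gattach G) (ptr (gattach G)) w0 y"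
    using n1[OF dom] unfolding aX u trace_nonempty_iff[OF K] by blast
  have w0t: "w0 \<in> trace n (attach X) u"
    unfolding aX u trace_modulo[OF K] in_paths_to ptr_gdisk by (rule walk_gdisk_short[OF w0(2,1)])
  \<comment> \<open>Large enough both for continuity at radius n and for the fact
    \<open>Same w0 w\<close>, where \<open>w0\<close> has length at most
    \<open>n + 1\<close>.\<close>
  define n' where "n' = n + length w + 1"
  have "\<exists>q\<in>R (attach X') (vertex (attach X') w). length q \<le> M"
    if X': "X' \<in> pgms \<Sigma> \<Delta> \<pi>" and eq: "disk n' X' = disk n' X" for X'
  proof -
    obtain G' :: "(nat, 'p, 's, 'd) pgraph" where G': "pointed_graph \<Sigma> \<Delta> \<pi> G'" "X' = modulo G'"
      using pgmsE[OF X'] by blast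
    note K' = pointed_graph_gattach[OF G'(1)]
    have aX': "attach X' = modulo (gattach G')" using attach_modulo[OF G'(1)] G'(2) by simp
    have "disk n X' = disk n X"
      using disk_eq_mono[OF G'(1) G(1), of n' n] eq G(2) G'(2) by (simp add: n'_def)
    then have "restr_graph n M F R (attach X) = restr_graph n M F R (attach X')" by (rule n2[OF X'])
    then have "(trace n (attach X) u, trace M (F (attach X)) (R (attach X) u)) \<in> restr_graph n M F
        R (attach X')"
      using dom unfolding restr_graph_def by blast
    then obtain u' where u': "u' \<in> restr_dom M F R (attach X')" "trace n (attach X') u' = trace n
        (attach X) u"
      "trace M (F (attach X')) (R (attach X') u') = trace M (F (attach X)) (R (attach X) u)"
      unfolding restr_graph_def by auto
    have q': "q \<in> R (attach X') u'" using qt u'(3) unfolding trace_def by blast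
    have u'V: "u' \<in> V (attach X')" using u'(1) unfolding restr_dom_def by blast
    have w0': "w0 \<in> u'" using w0t u'(2) unfolding trace_def by blast
    have "disk n' (modulo (gattach G)) = disk n' (modulo (gattach G'))"
      using disk_attach_cong[OF X' X eq] aX aX' by simp
    then have ag: "agree n' (gattach G) (gattach G')" by (rule agree_if_disk_eq[OF K K'])
    have "fact_size (Same w0 w) \<le> n'" using w0(1) by (simp add: n'_def)
    moreover have "holds (gattach G) (Same w0 w)" using y w0(2) by auto
    ultimately have "holds (gattach G') (Same w0 w)" using agreeD[OF ag] by blast
    then obtain y' where y': "walk (gattach G') (ptr (gattach G')) w0 y'" "walk (gattach G') (ptr
        (gattach G')) w y'"
      by auto
    have "u' = vertex (attach X') w0" using vertex_in_V[OF K'] u'V w0' aX' by simp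
    also have "\<dots> = vertex (attach X') w"
      unfolding aX' vertex_modulo_walk[OF K' y'(1)] vertex_modulo_walk[OF K' y'(2)] ..
    finally show ?thesis using q' M_def by blast
  qed
  then show "\<exists>n N. \<forall>X'\<in>pgms \<Sigma> \<Delta> \<pi>. disk n X' = disk n X \<longrightarrow>
      (\<exists>q\<in>R (attach X') (vertex (attach X') w). length q \<le> N)" by blast
qed

text \<open>An edge left by \<open>Lp\<close> or \<open>Rp\<close> and entered by \<open>Mp\<close>
  goes down inside a tree. Quiescence at the parent says that the image of the child is reached by
  such an edge from the image of the parent, hence is invisible.\<close>

lemma quiescent_depth:
  obtains b where "\<And>G H \<rho> v ds. pointed_graph \<Sigma> \<Delta> \<pi> G \<Longrightarrow> transports G H \<rho> \<Longrightarrow> v \<in> verts G \<Longrightarrow>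
    b < length ds \<Longrightarrow> 0 < depth (\<rho> (Invisible v ds))"
proof -
  obtain b where b: "\<And>X s t. X \<in> pgms \<Sigma> \<Delta> \<pi> \<Longrightarrow> s \<in> tree_paths \<Longrightarrow> t \<in> tree_paths \<Longrightarrow> b \<le> length s \<Longrightarrow>
      R (dive X s) (vertex (dive X s) t) = vertex (F (dive X s)) t"
    using imcgd unfolding imcgd_def im_quiescent_def by metis
  have tp: "(tree_path ds :: 'p iport path) \<in> tree_paths" for ds unfolding tree_paths_eq by blast
  show ?thesis
  proof (rule that)
    fix G H :: "(nat, 'p, 's, 'd) pgraph" and \<rho> v and ds :: "bool list"
    assume G: "pointed_graph \<Sigma> \<Delta> \<pi> G" and t: "transports G H \<rho>" and v: "v \<in> verts G"
        and l: "b < length ds"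
    note T = transportsD[OF G t]
    \<comment> \<open>The parent has address \<open>es\<close>, of length at least b because the
      inequality on \<open>ds\<close> is strict; the last turn d is the word t of
      quiescence.\<close>
    define es d where "es = butlast ds" and "d = last ds"
    have ds: "ds = es @ [d]" using l unfolding es_def d_def by (cases ds) auto
    let ?x = "Invisible v es" and ?y = "Invisible v ds" and ?X = "modulo (G\<lparr>ptr := v\<rparr>)"
    let ?t = "tree_path [d] :: 'p iport path"
    have x: "?x \<in> verts (gattach G)" and y: "?y \<in> verts (gattach G)" using v
        by (simp_all add: verts_gattach)
    note K = pointed_graph_im[OF G x] and L = pointed_graph_im[OF T(1) T(5)[OF x]]
    have "walk (im G ?x) (ptr (im G ?x)) ?t ?y"
      using walk_tree_path[OF v, of es "[d]"] unfolding ds walk_ptr repointed_simps .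
    then have vy: "vertex (modulo (im G ?x)) ?t = paths_to (im G ?x) ?y"
        by (rule vertex_modulo_walk[OF K])
    have dive: "dive ?X (tree_path es) = modulo (im G ?x)" by (rule dive_modulo[OF G v])
    have "b \<le> length (tree_path es :: 'p iport path)" using l unfolding ds by simp
    then have "R (dive ?X (tree_path es)) (vertex (dive ?X (tree_path es)) ?t) = vertex (F (dive
        ?X (tree_path es))) ?t"
      by (rule b[OF modulo_in_pgms[OF pointed_graph_ptr[OF G v]] tp tp])
    then have eq: "paths_to (im H (\<rho> ?x)) (\<rho> ?y) = vertex (modulo (im H (\<rho> ?x))) ?t"
      unfolding dive vy T(3)[OF x] T(4)[OF x y] .
    \<comment> \<open>Quiescence alone would also hold between empty sets; nonemptiness turns the
      letter into an actual edge of the image.\<close>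
    have "paths_to (im H (\<rho> ?x)) (\<rho> ?y) \<noteq> {}" using paths_to_nonempty[OF L, of "\<rho> ?y"] T(5)[OF y]
        by simp
    then obtain z where z: "walk (im H (\<rho> ?x)) (ptr (im H (\<rho> ?x))) ?t z"
      unfolding eq vertex_modulo[OF L] by blast
    then have "?t \<in> paths_to (im H (\<rho> ?x)) (\<rho> ?y)" unfolding eq vertex_modulo[OF L] by blast
    then have "{(\<rho> ?x, if d then Rp else Lp), (\<rho> ?y, Mp)} \<in> edges (gattach H)"
      by (simp add: walk_Cons_iff)
    then show "0 < depth (\<rho> ?y)"
      by (cases rule: gattach_edge) (auto split: if_splits)
  qed
qed

lemma bounded_projection: "bounded (pgms \<Sigma> \<Delta> \<pi>) F' R'"
proof -
  obtain b where b: "\<And>G H \<rho> v ds. pointed_graph \<Sigma> \<Delta> \<pi> G \<Longrightarrow> transports G H \<rho> \<Longrightarrow> v \<in> verts G \<Longrightarrow>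
      b < length ds \<Longrightarrow> 0 < depth (\<rho> (Invisible v ds))" by (rule quiescent_depth) (rule that, blast)
  have walk: "walk (gattach G) (ptr (gattach G)) (dot @ tree_path ds) (Invisible (ptr G) ds)"
    if "pointed_graph \<Sigma> \<Delta> \<pi> G" for G :: "(nat, 'p, 's, 'd) pgraph" and ds
    using walk_down_path[of "Invisible (ptr G) ds" G] pgD(2)[OF that] by simp
  have "dot @ tree_path ds \<in> paths (attach X)" if X: "X \<in> pgms \<Sigma> \<Delta> \<pi>" for X :: "('p, 's, 'd) pgm"
      and ds
  proof -
    obtain G :: "(nat, 'p, 's, 'd) pgraph" where G: "pointed_graph \<Sigma> \<Delta> \<pi> G" "X = modulo G"
      using pgmsE[OF X] by blast
    show ?thesis unfolding G(2) attach_modulo[OF G(1)] paths_modulo[OF pointed_graph_gattach[OF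
        G(1)]]
      using walk[OF G(1)] by blast
  qed
  then have "\<forall>ds. \<exists>N. \<forall>X\<in>pgms \<Sigma> \<Delta> \<pi>. \<exists>q\<in>R (attach X) (vertex (attach X) (dot @ tree_path ds)).
      length q \<le> N"
    by (intro allI uniform_distance)
  then obtain N where N: "\<And>ds X. X \<in> pgms \<Sigma> \<Delta> \<pi> \<Longrightarrow>
      \<exists>q\<in>R (attach X) (vertex (attach X) (dot @ tree_path ds)). length q \<le> N ds" by metis
  \<comment> \<open>The distance bounds depend on the tree address, but only the finitely many
    addresses with at most b turns can have a visible image.\<close>
  define B where "B = Max (N ` {ds. set ds \<subseteq> UNIV \<and> length ds \<le> b})"
  have B: "N ds \<le> B" if "length ds \<le> b" for ds
    unfolding B_def using that finite_lists_length_le[of "UNIV :: bool set" b]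
        by (intro Max_ge) auto
  show ?thesis unfolding bounded_def
  proof (intro exI[of _ B] ballI)
    fix X :: "('p, 's, 'd) pgm" and w' assume X: "X \<in> pgms \<Sigma> \<Delta> \<pi>" and w': "w' \<in> V (F' X)"
    obtain G :: "(nat, 'p, 's, 'd) pgraph" where G: "pointed_graph \<Sigma> \<Delta> \<pi> G" "X = modulo G"
      using pgmsE[OF X] by blast
    obtain H \<rho> where t: "transports G H \<rho>" using ex_transports[OF G(1)] by blast
    note T = transportsD[OF G(1) t] and p = pgD(2)[OF G(1)]
    define h where "h v = carrier (\<rho> (Visible v))" for v
    have h: "h v \<in> verts H" if "v \<in> verts G" for v unfolding h_def
        by (rule T(6)[OF Visible_verts[OF that]])
    note H0 = pointed_graph_ptr[OF T(1) h[OF p]]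
    have FX: "F' X = modulo (H\<lparr>ptr := h (ptr G)\<rparr>)" using T(7)[OF p] G(2) by (simp add: h_def)
    obtain c where c: "c \<in> verts H" "w' = paths_to (H\<lparr>ptr := h (ptr G)\<rparr>) c"
      using w' unfolding FX V_modulo[OF H0] by auto
    \<comment> \<open>Since \<open>\<rho>\<close> is onto, the visible vertex c is an image. The
      carrier of its preimage is the vertex of \<open>X\<close> whose projected image will be close
      to c.\<close>
    obtain y where y: "y \<in> verts (gattach G)" "\<rho> y = Visible c"
      using bij_betw_imp_surj_on[OF T(2)] Visible_verts[OF c(1)] by (metis imageE)
    define v where "v = carrier y"
    have v: "v \<in> verts G" using y(1) verts_gattach unfolding v_def by metis
    note Hv = pointed_graph_ptr[OF T(1) h[OF v]]
    have "\<exists>w. length w \<le> B \<and> walk H (h v) w c"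
    proof (cases y)
      case (Visible u)
      then have "h v = c" using y(2) by (simp add: h_def v_def)
      then show ?thesis by (intro exI[of _ "[]"]) simp
    next
      case (Invisible u ds)
      then have yv: "y = Invisible v ds" by (simp add: v_def)
      have len: "length ds \<le> b"
        using b[OF G(1) t v, of ds] y(2) unfolding yv by (cases "b < length ds") auto
      note Gv = pointed_graph_ptr[OF G(1) v]
      have "walk (gattach (G\<lparr>ptr := v\<rparr>)) (ptr (gattach (G\<lparr>ptr := v\<rparr>))) (dot @ tree_path ds) y"
        using walk[OF Gv] yv by simp
      then have "vertex (attach (modulo (G\<lparr>ptr := v\<rparr>))) (dot @ tree_path ds) = paths_to (im G
          (Visible v)) y"
        unfolding attach_modulo[OF Gv] gattach_ptr
        by (rule vertex_modulo_walk[OF pointed_graph_im[OF G(1) Visible_verts[OF v]]])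
      then obtain q where q: "q \<in> R (modulo (im G (Visible v))) (paths_to (im G (Visible v)) y)"
          "length q \<le> N ds"
        using N[OF modulo_in_pgms[OF Gv], of ds] unfolding attach_repoint[OF G(1) v] by auto
      then have "walk (gattach H) (\<rho> (Visible v)) q (Visible c)"
        unfolding T(4)[OF Visible_verts[OF v] y(1)] y(2) by simp
      \<comment> \<open>\<open>\<rho> (Visible v)\<close> may itself be invisible; passing to
        carriers starts the walk at \<open>h v\<close>, and deleting tree letters only shortens
        it.\<close>
      then have "walk H (h v) (visible_part q) c" using walk_project unfolding h_def by fastforce
      moreover have "length (visible_part q) \<le> B" using length_visible_part[of q] q(2) B[OF len]
          by simp
      ultimately show ?thesis by blast
    qed
    then obtain w where w: "length w \<le> B" "walk H (h v) w c" by blast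
    let ?Hv = "H\<lparr>ptr := h v\<rparr>"
    have u': "R' X (paths_to G v) = paths_to (H\<lparr>ptr := h (ptr G)\<rparr>) (h v)"
      using T(8)[OF p v] G(2) by (simp add: h_def)
    have rF: "repoint (F' X) (paths_to (H\<lparr>ptr := h (ptr G)\<rparr>) (h v)) = modulo ?Hv"
      unfolding FX using repoint_modulo_any[OF H0, of "h v"] h[OF v] by simp
    have wd: "walk (gdisk B ?Hv) (ptr ?Hv) w c" by (rule walk_gdisk_short) (use w in simp_all)
    have cB: "c \<in> verts (gdisk B ?Hv)" using walk_ptr_verts[OF pointed_graph_gdisk[OF Hv]] wd
        by (metis ptr_gdisk)
    show "\<exists>u'\<in>R' X ` V X. \<exists>v'\<in>V (disk B (repoint (F' X) u')). w' = cat (F' X) u' v'"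
    proof (intro bexI)
      show "R' X (paths_to G v) \<in> R' X ` V X" unfolding G(2) V_modulo[OF G(1)] using v by blast
      show "paths_to (gdisk B ?Hv) c \<in> V (disk B (repoint (F' X) (R' X (paths_to G v))))"
        unfolding u' rF disk_modulo_any[OF Hv] V_modulo[OF pointed_graph_gdisk[OF Hv]] using cB
            by blast
      have sub: "paths_to (gdisk B ?Hv) c \<subseteq> paths_to ?Hv c"
        using walk_gdisk_imp[of B ?Hv] by (auto simp: paths_to_def)
      have "cat (F' X) (R' X (paths_to G v)) (paths_to (gdisk B ?Hv) c) = paths_to (H\<lparr>ptr := h
          (ptr G)\<rparr>) c"
        unfolding FX u'
      proof (rule cat_modulo[OF H0 order_refl])
        show "paths_to (H\<lparr>ptr := h (ptr G)\<rparr>) (h v) \<noteq> {}" using paths_to_nonempty[OF H0] h[OF v]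
            by simp
        show "paths_to (gdisk B ?Hv) c \<subseteq> paths_to (H\<lparr>ptr := h (ptr G), ptr := h v\<rparr>) c" using sub
            by simp
        show "paths_to (gdisk B ?Hv) c \<noteq> {}" using wd by (auto simp: paths_to_def)
      qed
      then show "w' = cat (F' X) (R' X (paths_to G v)) (paths_to (gdisk B ?Hv) c)" using c(2)
          by simp
    qed
  qed
qed

text \<open>The vertices in the domain of the projected restriction of radius \<open>m\<close> have images at depth at
  most \<open>D\<close>, hence they are in the domain of the restriction of radius \<open>m + 2 * D\<close> of \<open>R\<close>.\<close>

lemma restr_projection:
  assumes X: "X \<in> pgms \<Sigma> \<Delta> \<pi>" and X': "X' \<in> pgms \<Sigma> \<Delta> \<pi>"
    and D: "\<And>X (H :: (nat, 'p, 's, 'd) pgraph) x. X \<in> pgms \<Sigma> \<Delta> \<pi> \<Longrightarrow> pointed_graph \<Sigma> \<Delta> \<pi> H \<Longrightarrow>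
      x \<in> verts (gattach H) \<Longrightarrow> F (attach X) = modulo (im H x) \<Longrightarrow> depth x \<le> D"
    and M: "m + 2 * D \<le> M"
    and dom: "\<And>u. u \<in> restr_dom M F R (attach X) \<Longrightarrow> trace n (attach X) u \<noteq> {}"
    and disk: "disk n X = disk n X'" and diskF: "disk m (F' X) = disk m (F' X')"
    and graph: "restr_graph n M F R (attach X) = restr_graph n M F R (attach X')"
    and u: "u \<in> restr_dom m F' R' X"
  shows "trace n X u \<noteq> {}"
    and "(trace n X u, trace m (F' X) (R' X u)) \<in> restr_graph n m F' R' X'"
proof -
  obtain G :: "(nat, 'p, 's, 'd) pgraph" where G: "pointed_graph \<Sigma> \<Delta> \<pi> G" "X = modulo G"
    using pgmsE[OF X] by blast
  obtain G' :: "(nat, 'p, 's, 'd) pgraph" where G': "pointed_graph \<Sigma> \<Delta> \<pi> G'" "X' = modulo G'"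
    using pgmsE[OF X'] by blast
  obtain H \<rho> where t: "transports G H \<rho>" using ex_transports[OF G(1)] by blast
  obtain H' \<rho>' where t': "transports G' H' \<rho>'" using ex_transports[OF G'(1)] by blast
  note T = transportsD[OF G(1) t] and p = pgD(2)[OF G(1)]
  note T' = transportsD[OF G'(1) t'] and p' = pgD(2)[OF G'(1)]
  note K = pointed_graph_gattach[OF G(1)] and K' = pointed_graph_gattach[OF G'(1)]
  define x where "x = \<rho> (Visible (ptr G))"
  define x' where "x' = \<rho>' (Visible (ptr G'))"
  have x: "x \<in> verts (gattach H)" and x': "x' \<in> verts (gattach H')"
    unfolding x_def x'_def using T(5)[OF Visible_verts[OF p]] T'(5)[OF Visible_verts[OF p']] .
  have cx: "carrier x \<in> verts H" and cx': "carrier x' \<in> verts H'" using x x' verts_gattach by metis+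
  note L = pointed_graph_im[OF T(1) x]
  note S = pointed_graph_ptr[OF T(1) cx] and S' = pointed_graph_ptr[OF T'(1) cx']
  have aX: "attach X = modulo (gattach G)" and aX': "attach X' = modulo (gattach G')"
    using attach_modulo[OF G(1)] attach_modulo[OF G'(1)] G(2) G'(2) by simp_all
  have FX: "F (attach X) = modulo (im H x)"
    using T(3)[OF Visible_verts[OF p]] attach_eq_im[OF G(1)] G(2) by (simp add: x_def)
  have RX: "R (attach X) (paths_to (gattach G) z) = paths_to (im H x) (\<rho> z)"
      if "z \<in> verts (gattach G)" for z
    using T(4)[OF Visible_verts[OF p] that] unfolding aX im_ptr x_def .
  have RX': "R (attach X') (paths_to (gattach G') z) = paths_to (im H' x') (\<rho>' z)"
    if "z \<in> verts (gattach G')" for z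
    using T'(4)[OF Visible_verts[OF p'] that] unfolding aX' im_ptr x'_def .
  have PX: "F' X = modulo (H\<lparr>ptr := carrier x\<rparr>)" and PX': "F' X' = modulo (H'\<lparr>ptr := carrier x'\<rparr>)"
    using T(7)[OF p] T'(7)[OF p'] G(2) G'(2) by (simp_all add: x_def x'_def)
  have QX: "R' X (paths_to G v) = paths_to (H\<lparr>ptr := carrier x\<rparr>) (carrier (\<rho> (Visible v)))"
    if "v \<in> verts G" for v using T(8)[OF p that] G(2) by (simp add: x_def)
  have QX': "R' X' (paths_to G' v) = paths_to (H'\<lparr>ptr := carrier x'\<rparr>) (carrier (\<rho>' (Visible v)))"
    if "v \<in> verts G'" for v using T'(8)[OF p' that] G'(2) by (simp add: x'_def)
  obtain v where v: "v \<in> verts G" "u = paths_to G v"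
    using u V_modulo[OF G(1)] unfolding restr_dom_def G(2) by blast
  define y where "y = \<rho> (Visible v)"
  have y: "y \<in> verts (gattach H)" unfolding y_def using T(5)[OF Visible_verts[OF v(1)]] .
  then have cy: "carrier y \<in> verts H" using verts_gattach by metis
  have dx: "depth x \<le> D" by (rule D[OF X T(1) x FX])
  \<comment> \<open>\<open>D\<close> bounds the depth of image pointers; re-pointing
    \<open>G\<close> at v makes y the pointer of the image.\<close>
  have dy: "depth y \<le> D"
  proof (rule D[OF modulo_in_pgms[OF pointed_graph_ptr[OF G(1) v(1)]] T(1) y])
    show "F (attach (modulo (G\<lparr>ptr := v\<rparr>))) = modulo (im H y)"
      using T(3)[OF Visible_verts[OF v(1)]] attach_repoint[OF G(1) v(1)] by (simp add: y_def)
  qed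
  have "trace m (F' X) (R' X u) \<noteq> {}" using u unfolding restr_dom_def by blast
  then obtain q where q: "length q \<le> m + 1" "walk H (carrier x) q (carrier y)"
    unfolding PX v(2) QX[OF v(1)] trace_nonempty_iff[OF S] by (auto simp: y_def)
  \<comment> \<open>Up from x, across along q, and down to y: each climb or descent costs at most
    \<open>D\<close> letters.\<close>
  define r where "r = backwards (down_path x) @ visible_path q @ down_path y"
  have r: "walk (im H x) (ptr (im H x)) r y"
    unfolding r_def walk_ptr repointed_simps
    by (rule walk_append[OF walk_up_path[OF cx] walk_append[OF walk_gattach[OF q(2)]
        walk_down_path[OF cy]]])
  have lr: "length r \<le> M + 1" using q(1) dx dy M by (simp add: r_def)
  have vr: "visible_part r = q" by (simp add: r_def)
  define U where "U = paths_to (gattach G) (Visible v)"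
  have UV: "U \<in> V (attach X)" unfolding U_def aX V_modulo[OF K] using Visible_verts[OF v(1)]
      by blast
  have RU: "R (attach X) U = paths_to (im H x) y" unfolding U_def y_def
      by (rule RX[OF Visible_verts[OF v(1)]])
  have rt: "r \<in> trace M (F (attach X)) (R (attach X) U)"
    unfolding FX RU trace_modulo[OF L] in_paths_to ptr_gdisk by (rule walk_gdisk_short[OF r lr])
  then have Udom: "U \<in> restr_dom M F R (attach X)" unfolding restr_dom_def using UV by blast
  obtain w1 where w1: "length w1 \<le> n + 1" "walk (gattach G) (ptr (gattach G)) w1 (Visible v)"
    using dom[OF Udom] unfolding U_def aX trace_nonempty_iff[OF K] by blast
  \<comment> \<open>The short path supplied by continuity may enter trees. Its visible part is a
    path of \<open>G\<close> to v and no longer, so the same radius n serves the projection.\<close>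
  define w where "w = visible_part w1"
  have lw: "length w \<le> n + 1" using length_visible_part[of w1] w1(1) by (simp add: w_def)
  have w: "walk G (ptr G) w v" using walk_project[OF w1(2)] by (simp add: w_def)
  show "trace n X u \<noteq> {}" unfolding G(2) v(2) trace_nonempty_iff[OF G(1)] using w lw by blast
  have wU: "visible_path w \<in> trace n (attach X) U"
    unfolding U_def aX trace_modulo[OF K] in_paths_to ptr_gdisk
    using walk_gattach[OF w] lw by (intro walk_gdisk_short) simp_all
  have "(trace n (attach X) U, trace M (F (attach X)) (R (attach X) U)) \<in> restr_graph n M F R
      (attach X)"
    unfolding restr_graph_def using Udom by blast
  then have "(trace n (attach X) U, trace M (F (attach X)) (R (attach X) U)) \<in> restr_graph n M F R
      (attach X')"
    unfolding graph .
  then obtain U' where U': "U' \<in> restr_dom M F R (attach X')" "trace n (attach X') U' = trace n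
      (attach X) U"
    "trace M (F (attach X')) (R (attach X') U') = trace M (F (attach X)) (R (attach X) U)"
    unfolding restr_graph_def by auto
  have "U' \<in> V (attach X')" using U'(1) unfolding restr_dom_def by blast
  then obtain z' where z': "z' \<in> verts (gattach G')" "U' = paths_to (gattach G') z'"
    unfolding aX' V_modulo[OF K'] by blast
  \<comment> \<open>The vertex of \<open>attach X'\<close> with the same trace contains this word,
    and a word of visible letters can only end at a visible vertex.\<close>
  have "visible_path w \<in> U'" using wU U'(2) unfolding trace_def by blast
  then obtain v' where v': "z' = Visible v'" "walk G' (ptr G') w v'"
    unfolding z'(2) in_paths_to ptr_gattach walk_visible_iff by blast
  have vG': "v' \<in> verts G'" by (rule walk_ptr_verts[OF G'(1) v'(2)])
  define y' where "y' = \<rho>' (Visible v')"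
  have "r \<in> R (attach X') U'" using rt U'(3) unfolding trace_def by blast
  moreover have "R (attach X') U' = paths_to (im H' x') y'"
    using RX'[OF z'(1)] unfolding z'(2) v'(1) y'_def .
  ultimately have "walk (gattach H') x' r y'" by simp
  then have q': "walk H' (carrier x') q (carrier y')" using walk_project vr by metis
  define u' where "u' = paths_to G' v'"
  \<comment> \<open>Each trace is the vertex of a disk reached by one word, w for arguments and q
    for values. These words serve both graphs, so equal disks give equal traces.\<close>
  have tu: "trace n X u = vertex (disk n X) w"
    unfolding G(2) v(2) trace_modulo[OF G(1)] disk_modulo_any[OF G(1)]
    using vertex_modulo_walk[OF pointed_graph_gdisk[OF G(1)], of n w v] walk_gdisk_short[OF w lw]
        by simp
  have tu': "trace n X' u' = vertex (disk n X') w"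
    unfolding G'(2) u'_def trace_modulo[OF G'(1)] disk_modulo_any[OF G'(1)]
    using vertex_modulo_walk[OF pointed_graph_gdisk[OF G'(1)], of n w v'] walk_gdisk_short[OF
        v'(2) lw] by simp
  have qd: "walk (gdisk m (H\<lparr>ptr := carrier x\<rparr>)) (ptr (gdisk m (H\<lparr>ptr := carrier x\<rparr>))) q (carrier
      y)"
    unfolding ptr_gdisk by (rule walk_gdisk_short) (use q in simp_all)
  have qd': "walk (gdisk m (H'\<lparr>ptr := carrier x'\<rparr>)) (ptr (gdisk m (H'\<lparr>ptr := carrier x'\<rparr>))) q
      (carrier y')"
    unfolding ptr_gdisk by (rule walk_gdisk_short) (use q(1) q' in simp_all)
  have ru: "trace m (F' X) (R' X u) = vertex (disk m (F' X)) q"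
    unfolding PX v(2) QX[OF v(1)] trace_modulo[OF S] disk_modulo_any[OF S]
      vertex_modulo_walk[OF pointed_graph_gdisk[OF S] qd] y_def ..
  have ru': "trace m (F' X') (R' X' u') = vertex (disk m (F' X')) q"
    unfolding PX' u'_def QX'[OF vG'] trace_modulo[OF S'] disk_modulo_any[OF S']
      vertex_modulo_walk[OF pointed_graph_gdisk[OF S'] qd'] y'_def ..
  have eq: "trace n X u = trace n X' u'" "trace m (F' X) (R' X u) = trace m (F' X') (R' X' u')"
    unfolding tu tu' ru ru' disk diskF by simp_all
  have "u' \<in> V X'" unfolding u'_def G'(2) V_modulo[OF G'(1)] using vG' by blast
  moreover have "trace m (F' X') (R' X' u') \<noteq> {}" using u eq(2) unfolding restr_dom_def by blast
  ultimately have "u' \<in> restr_dom m F' R' X'" unfolding restr_dom_def by blast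
  then show "(trace n X u, trace m (F' X) (R' X u)) \<in> restr_graph n m F' R' X'"
    unfolding restr_graph_def eq by blast
qed

lemma continuous_projection: "continuous (pgms \<Sigma> \<Delta> \<pi>) F' R'"
  unfolding continuous_def
proof (intro ballI allI)
  fix X :: "('p, 's, 'd) pgm" and m assume X: "X \<in> pgms \<Sigma> \<Delta> \<pi>"
  obtain D where D: "\<And>X (H :: (nat, 'p, 's, 'd) pgraph) x. X \<in> pgms \<Sigma> \<Delta> \<pi> \<Longrightarrow> pointed_graph \<Sigma> \<Delta> \<pi> H \<Longrightarrow>
      x \<in> verts (gattach H) \<Longrightarrow> F (attach X) = modulo (im H x) \<Longrightarrow> depth x \<le> D"
          by (rule uniform_depth) (rule that, blast)
  \<comment> \<open>\<open>2 * D\<close> pays for the tree parts at both ends of a route between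
    images; the last 2 is the offset of \<open>disk_eq_if_agree\<close> at radius m.\<close>
  define M where "M = m + 2 * D + 2"
  have M: "m + 2 * D \<le> M" by (simp add: M_def)
  obtain n where dom: "\<And>u. u \<in> restr_dom M F R (attach X) \<Longrightarrow> trace n (attach X) u \<noteq> {}"
    and dF: "\<And>X'. X' \<in> pgms \<Sigma> \<Delta> \<pi> \<Longrightarrow> disk n X' = disk n X \<Longrightarrow>
        disk M (F (attach X)) = disk M (F (attach X'))"
    and gr: "\<And>X'. X' \<in> pgms \<Sigma> \<Delta> \<pi> \<Longrightarrow> disk n X' = disk n X \<Longrightarrow>
      restr_graph n M F R (attach X) = restr_graph n M F R (attach X')"
    using continuous_attach[OF X, of M] by metis
  have disk: "disk m (F' X) = disk m (F' X')" if X': "X' \<in> pgms \<Sigma> \<Delta> \<pi>"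
      and eq: "disk n X' = disk n X" for X'
  proof -
    obtain H :: "(nat, 'p, 's, 'd) pgraph" and x where H: "pointed_graph \<Sigma> \<Delta> \<pi> H"
      and x: "x \<in> verts (gattach H)" and FX: "F (attach X) = modulo (im H x)"
          using F_attach_im[OF X] .
    obtain H' :: "(nat, 'p, 's, 'd) pgraph" and x' where H': "pointed_graph \<Sigma> \<Delta> \<pi> H'"
      and x': "x' \<in> verts (gattach H')" and FX': "F (attach X') = modulo (im H' x')"
          using F_attach_im[OF X'] .
    have c: "carrier x \<in> verts H" "carrier x' \<in> verts H'" using x x' verts_gattach by metis+
    have "disk M (modulo (im H x)) = disk M (modulo (im H' x'))" using dF[OF X' eq] FX FX' by simp
    then have "agree M (im H x) (im H' x')"
      by (rule agree_if_disk_eq[OF pointed_graph_im[OF H x] pointed_graph_im[OF H' x']])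
    moreover have "depth x + (m + 2) \<le> M" using D[OF X H x FX] by (simp add: M_def)
    ultimately have "agree (m + 2) (H\<lparr>ptr := carrier x\<rparr>) (H'\<lparr>ptr := carrier x'\<rparr>)"
      by (rule agree_strip(1)[OF H x H' x'])
    then show ?thesis
      unfolding proj_graph_modulo[where F = F, OF H x FX] proj_graph_modulo[where F = F, OF H' x'
          FX']
      by (rule disk_eq_if_agree[OF pointed_graph_ptr[OF H c(1)] pointed_graph_ptr[OF H' c(2)]])
  qed
  show "\<exists>n. (\<forall>u\<in>restr_dom m F' R' X. trace n X u \<noteq> {}) \<and>
      (\<forall>X'\<in>pgms \<Sigma> \<Delta> \<pi>. disk n X' = disk n X \<longrightarrow>
        disk m (F' X) = disk m (F' X') \<and> restr_graph n m F' R' X = restr_graph n m F' R' X')"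
  proof (intro exI[of _ n] conjI ballI impI)
    show "trace n X u \<noteq> {}" if "u \<in> restr_dom m F' R' X" for u
      by (rule restr_projection(1)[OF X X D M dom refl refl refl that])
    fix X' :: "('p, 's, 'd) pgm" assume X': "X' \<in> pgms \<Sigma> \<Delta> \<pi>" and eq: "disk n X' = disk n X"
    show "disk m (F' X) = disk m (F' X')" by (rule disk[OF X' eq])
    \<comment> \<open>\<open>restr_projection\<close> is used in both directions, while continuity
      at \<open>X\<close> gives nonempty traces for \<open>X\<close> only; the equality of the
      restricted maps carries this over to \<open>X'\<close>.\<close>
    have dom': "trace n (attach X') u \<noteq> {}" if u: "u \<in> restr_dom M F R (attach X')" for u
    proof -
      have "trace n (attach X') u \<in> fst ` restr_graph n M F R (attach X)"
        unfolding gr[OF X' eq] using u unfolding restr_graph_def by force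
      then obtain U where "U \<in> restr_dom M F R (attach X)" "trace n (attach X') u = trace n
          (attach X) U"
        unfolding restr_graph_def by auto
      then show ?thesis using dom by simp
    qed
    show "restr_graph n m F' R' X = restr_graph n m F' R' X'"
    proof (intro equalityI subsetI)
      fix z assume "z \<in> restr_graph n m F' R' X"
      then obtain u where "u \<in> restr_dom m F' R' X" "z = (trace n X u, trace m (F' X) (R' X u))"
        unfolding restr_graph_def by blast
      then show "z \<in> restr_graph n m F' R' X'"
        using restr_projection(2)[OF X X' D M dom eq[symmetric] disk[OF X' eq] gr[OF X' eq]] by simp
    next
      fix z assume "z \<in> restr_graph n m F' R' X'"
      then obtain u where "u \<in> restr_dom m F' R' X'" "z = (trace n X' u, trace m (F' X') (R' X' u))"
        unfolding restr_graph_def by blast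
      then show "z \<in> restr_graph n m F' R' X"
        using restr_projection(2)[OF X' X D M dom' eq disk[OF X' eq, symmetric] gr[OF X' eq,
            symmetric]] by simp
    qed
  qed
qed

end

theorem theorem13:
  fixes \<Sigma> :: "'s set" and \<Delta> :: "'d set" and \<pi> :: "'p set"
    and F :: "('p iport, 's ilabel, 'd) pgm \<Rightarrow> ('p iport, 's ilabel, 'd) pgm"
    and R :: "('p iport, 's ilabel, 'd) pgm \<Rightarrow> 'p iport path set \<Rightarrow> 'p iport path set"
  assumes "finite \<Sigma>" and "finite \<Delta>" and "finite \<pi>"
    and "imcgd \<Sigma> \<Delta> \<pi> F R"
  shows "cgd (pgms \<Sigma> \<Delta> \<pi>) (proj_graph \<Sigma> \<Delta> \<pi> F) (proj_vertex \<Sigma> \<Delta> \<pi> F R)"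
proof -
  interpret im_dynamics \<Sigma> \<Delta> \<pi> F R using assms by unfold_locales
  show ?thesis
    unfolding cgd_def
    using dynamics_projection continuous_projection shift_invariant_projection bounded_projection by blast
qed

end
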